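(* Let $d\geq 4$ be fixed. For positive integers $k$, the number of combinatorially distinct $(d-2)$-simplicial $2$-simple $d$-polytopes with exactly $N=(3d-3)+k(2d-4)$ vertices is $2^{\Omega(N)}=2^{\Omega(k)}$ (as $k\to\infty$).
   Context: A $d$-polytope is $j$-simplicial if all of its $j$-dimensional faces are simplices, and $i$-simple if every face of dimension $d-i-1$ is contained in exactly $i+1$ facets. Two polytopes are combinatorially distinct if their face lattices are not isomorphic. *)

theory Defs
  imports "HOL-Analysis.Analysis" "HOL-Library.Landau_Symbols"
begin

definition d_polytope :: "nat \<Rightarrow> 'a::euclidean_space set \<Rightarrow> bool" where
  "d_polytope d P \<longleftrightarrow> polytope P \<and> aff_dim P = int d"

definition simplicial :: "nat \<Rightarrow> 'a::euclidean_space set \<Rightarrow> bool" where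
  "simplicial j P \<longleftrightarrow> (\<forall>F. F face_of P \<and> aff_dim F = int j \<longrightarrow> int j simplex F)"

definition simple :: "nat \<Rightarrow> 'a::euclidean_space set \<Rightarrow> bool" where
  "simple i P \<longleftrightarrow> (\<forall>F. F face_of P \<and> aff_dim F = aff_dim P - int i - 1 \<longrightarrow>
     card {G. G facet_of P \<and> F \<subseteq> G} = i + 1)"

(* Includes the improper faces: the empty set and P itself. *)
definition face_lattice :: "'a::euclidean_space set \<Rightarrow> 'a set set" where
  "face_lattice P = {F. F face_of P}"

definition comb_equiv :: "'a::euclidean_space set \<Rightarrow> 'b::euclidean_space set \<Rightarrow> bool" where
  "comb_equiv P Q \<longleftrightarrow> (\<exists>f. bij_betw f (face_lattice P) (face_lattice Q) \<and>
     (\<forall>F \<in> face_lattice P. \<forall>G \<in> face_lattice P. F \<subseteq> G \<longleftrightarrow> f F \<subseteq> f G))"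

(* Since card is 0 on infinite sets, a positive lower bound on this number
   also says that there are only finitely many classes. *)
definition num_comb_types :: "'a::euclidean_space set set \<Rightarrow> nat" where
  "num_comb_types A = card (A // {(P, Q). P \<in> A \<and> Q \<in> A \<and> comb_equiv P Q})"

definition simplicial_simple_polytopes :: "nat \<Rightarrow> nat \<Rightarrow> 'a::euclidean_space set set" where
  "simplicial_simple_polytopes d N = {P. d_polytope d P \<and> simplicial (d - 2) P \<and> simple 2 P \<and>
     card {v. v extreme_point_of P} = N}"

end

theory Submission
  imports Defs "HOL-Real_Asymp.Real_Asymp"
begin

text \<open>A \<open>d\<close>-polytope is \<open>(d - 2)\<close>-simplicial and \<open>2\<close>-simple as soon as any \<open>j \<in> {2, 3, 4}\<close> of its facets
  share at most \<open>d + 1 - j\<close> vertices. This condition survives gluing two polytopes at simple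
  vertices lying on simplex facets: the two facets are identified, the vertex disappears and the
  remaining facets at the vertex merge in pairs. There are two gadgets with such a vertex at both
  ends, dual to subdivisions of a \<open>(d - 1)\<close>-cube and of a truncated \<open>(d - 1)\<close>-cube, which add
  \<open>2d - 4\<close> and \<open>3d - 6\<close> vertices to a polytope. Chains of gadgets over a simplex thus realize all words
  in two letters. The lateral facets of the two gadgets have different sizes, so the word can be
  read off the facet family by walking along flags from a marked flag. Hence a combinatorial type
  accounts for at most polynomially many words, whereas there are exponentially many words with
  the prescribed number of vertices.\<close>

subsection \<open>A facet criterion for simpliciality and simplicity\<close>

text \<open>The bounds for j = 2 and j = 4 give simpliciality and simplicity; the bound for j = 3
  enters the count of marked flags. As the condition concerns only a finite set family, geometry is
  needed just to identify the facet family of a union. There the obstacle is position: two polytopes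
  sharing a simplex facet have a convex union with the right facets only if each lies beneath the
  outer facets of the other. The lower polytope is arbitrary, so it is normalized by an affine map
  and then stretched in one direction; the gadget is made once and for all with facets that leave
  every sufficiently stretched polytope beneath them. The gadgets come from heights: (m - s)(m - s -
  1)/2 on the 0/1 points with s ones is strictly convex in s, so it subdivides the cube into slabs
  between consecutive coordinate sums. A lateral facet collects the vertices dual to the facets of
  the cube or truncated cube, hence the sizes 2(d - 1) and 2(d - 1) + 1. Reading is deterministic
  only from a marked flag, so the loss per combinatorial type is the number of marked flags, at most
  4 N^(d - 1).\<close>

definition verts :: "'a::euclidean_space set \<Rightarrow> 'a set" where
  "verts P = {v. v extreme_point_of P}"

definition facet_family :: "'a::euclidean_space set \<Rightarrow> 'a set set" where
  "facet_family P = (\<lambda>Y. verts P \<inter> Y) ` {Y. Y facet_of P}"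

text \<open>Written as a sum to avoid truncated subtraction. For facets: two share at most d - 1
  vertices, as a simplex ridge has; four share at most d - 3, fewer than a (d - 3)-face has.\<close>

definition spread :: "nat \<Rightarrow> 'v set set \<Rightarrow> bool" where
  "spread d \<F> \<longleftrightarrow>
     (\<forall>\<G>\<subseteq>\<F>. 2 \<le> card \<G> \<and> card \<G> \<le> 4 \<longrightarrow> card (\<Inter>\<G>) + card \<G> \<le> d + 1)"

lemma spreadD:
  "\<lbrakk>spread d \<F>; \<G> \<subseteq> \<F>; 2 \<le> card \<G>; card \<G> \<le> 4\<rbrakk> \<Longrightarrow> card (\<Inter>\<G>) + card \<G> \<le> d + 1"
  by (simp add: spread_def)

lemma obtain_two:
  assumes "2 \<le> card X"
  obtains x y where "x \<in> X" "y \<in> X" "x \<noteq> y"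
proof -
  obtain Y where "Y \<subseteq> X" "card Y = 2" using assms by (meson ex_card)
  then show ?thesis using that by (auto simp: card_2_iff)
qed

lemma finite_verts: "polytope P \<Longrightarrow> finite (verts P)"
  unfolding verts_def by (simp add: finite_polyhedron_extreme_points polytope_imp_polyhedron)

lemma convex_hull_verts: "polytope P \<Longrightarrow> convex hull (verts P) = P"
  unfolding verts_def
  by (metis Krein_Milman_Minkowski polytope_imp_compact polytope_imp_convex)

lemma verts_subset: "verts P \<subseteq> P"
  by (auto simp: verts_def extreme_point_of_def)

lemma verts_face: "F face_of P \<Longrightarrow> verts F = verts P \<inter> F"
  by (auto simp: verts_def extreme_point_of_face)

lemma face_eq_hull:
  assumes "polytope P" "F face_of P"
  shows "convex hull (verts P \<inter> F) = F"
  using assms convex_hull_verts[of F] face_of_polytope_polytope verts_face by metis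

lemma face_subset_iff:
  assumes "polytope P" "F face_of P" "G face_of P"
  shows "F \<subseteq> G \<longleftrightarrow> verts P \<inter> F \<subseteq> verts P \<inter> G"
proof
  assume "verts P \<inter> F \<subseteq> verts P \<inter> G"
  then show "F \<subseteq> G"
    using hull_mono[of "verts P \<inter> F" "verts P \<inter> G" convex] face_eq_hull assms by metis
qed blast

lemma inj_on_facets:
  assumes "polytope P"
  shows "inj_on (\<lambda>Y. verts P \<inter> Y) {Y. Y facet_of P}"
  by (intro inj_onI) (metis assms face_eq_hull facet_of_imp_face_of mem_Collect_eq)

lemma facet_family_subset: "A \<in> facet_family P \<Longrightarrow> A \<subseteq> verts P"
  by (auto simp: facet_family_def)

lemma card_verts_face_ge:
  assumes "polytope P" "F face_of P"
  shows "aff_dim F + 1 \<le> int (card (verts P \<inter> F))"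
proof -
  have "aff_dim F = aff_dim (verts P \<inter> F)"
    using face_eq_hull[OF assms] by (metis aff_dim_convex_hull)
  then show ?thesis
    using aff_dim_le_card[of "verts P \<inter> F"] finite_verts[OF assms(1)] by simp
qed

lemma card_common_verts:
  assumes P: "polytope P" and F: "F face_of P" and sp: "spread d (facet_family P)"
    and \<G>: "\<G> \<subseteq> {G. G facet_of P \<and> F \<subseteq> G}" "2 \<le> card \<G>" "card \<G> \<le> 4"
  shows "card (verts P \<inter> F) + card \<G> \<le> d + 1"
proof -
  let ?v = "\<lambda>Y. verts P \<inter> Y"
  have sub: "\<G> \<subseteq> {Y. Y facet_of P}"
    using \<G>(1) by auto
  have c: "card (?v ` \<G>) = card \<G>"
    using inj_on_subset[OF inj_on_facets[OF P] sub] by (rule card_image)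
  have "card (\<Inter>(?v ` \<G>)) + card (?v ` \<G>) \<le> d + 1"
    by (rule spreadD[OF sp]) (use sub \<G> c in \<open>auto simp: facet_family_def\<close>)
  moreover have "card (verts P \<inter> F) \<le> card (\<Inter>(?v ` \<G>))"
  proof (rule card_mono)
    have "\<G> \<noteq> {}" using \<G>(2) by auto
    then have "\<Inter>(?v ` \<G>) \<subseteq> verts P" by blast
    then show "finite (\<Inter>(?v ` \<G>))"
      using finite_verts[OF P] finite_subset by blast
    show "verts P \<inter> F \<subseteq> \<Inter>(?v ` \<G>)" using \<G>(1) by auto
  qed
  ultimately show ?thesis using c by linarith
qed

text \<open>A proper nonempty face is the intersection of the facets containing it; a single such
  facet would equal the face.\<close>

lemma two_facets_through_face:
  assumes P: "polytope P" and F: "F face_of P" "F \<noteq> {}" "aff_dim F < aff_dim P - 1"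
  shows "2 \<le> card {G. G facet_of P \<and> F \<subseteq> G}"
proof -
  let ?G = "{G. G facet_of P \<and> F \<subseteq> G}"
  have fin: "finite ?G"
    using finite_polyhedron_facets[OF polytope_imp_polyhedron[OF P]] by (auto intro: finite_subset)
  have FP: "F \<noteq> P" using F(3) by auto
  have eq: "F = \<Inter>?G"
    by (rule face_of_polyhedron[OF polytope_imp_polyhedron[OF P] F(1,2) FP])
  have "?G \<noteq> {}"
    using face_of_polyhedron_subset_facet[OF polytope_imp_polyhedron[OF P] F(1,2) FP] by blast
  then obtain A where A: "A \<in> ?G" by blast
  have "?G \<noteq> {A}"
  proof
    assume "?G = {A}"
    then have "F = A" using eq by simp
    then show False using A F(3) by (auto simp: facet_of_def)
  qed
  then obtain B where B: "B \<in> ?G" "B \<noteq> A" using A by blast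
  have "card {A,B} \<le> card ?G" using A B fin by (intro card_mono) auto
  then show ?thesis using B by simp
qed

text \<open>With only two facets A, B through F, every facet of A through F would be
  \<open>A \<inter> B\<close>. But F has codimension at least two in A, so it lies in two distinct
  facets of A.\<close>

lemma three_facets_through_face:
  assumes P: "polytope P" and F: "F face_of P" "F \<noteq> {}" "aff_dim F < aff_dim P - 2"
  shows "3 \<le> card {G. G facet_of P \<and> F \<subseteq> G}"
proof (rule ccontr)
  let ?G = "{G. G facet_of P \<and> F \<subseteq> G}"
  assume "\<not> 3 \<le> card ?G"
  then have two: "card ?G = 2"
    using two_facets_through_face[OF P F(1,2)] F(3) by linarith
  then obtain A B where AB: "?G = {A,B}" "A \<noteq> B" by (meson card_2_iff)
  have Af: "A facet_of P" "F \<subseteq> A" and Bf: "B facet_of P" using AB by auto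
  have pA: "polytope A" using P Af face_of_polytope_polytope facet_of_imp_face_of by blast
  have FA: "F face_of A"
    using F(1) Af by (meson face_of_subset facet_of_imp_subset)
  have "2 \<le> card {R. R facet_of A \<and> F \<subseteq> R}"
    using two_facets_through_face[OF pA FA F(2)] F(3) Af by (simp add: facet_of_def)
  then obtain R S where RS: "R facet_of A" "F \<subseteq> R" "S facet_of A" "F \<subseteq> S" "R \<noteq> S"
    by (rule obtain_two) blast
  have key: "T = A \<inter> B" if T: "T facet_of A" "F \<subseteq> T" for T
  proof -
    have TP: "T face_of P"
      using T Af by (meson face_of_trans facet_of_imp_face_of)
    have dimT: "aff_dim T = aff_dim P - 2" using T Af by (simp add: facet_of_def)
    have ne: "T \<noteq> {}" using T by (simp add: facet_of_def)
    let ?H = "{G. G facet_of P \<and> T \<subseteq> G}"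
    have "2 \<le> card ?H" using two_facets_through_face[OF P TP ne] dimT by simp
    moreover have "?H \<subseteq> {A,B}" using T(2) AB by auto
    ultimately have "?H = {A,B}"
      using AB by (metis card_seteq finite.emptyI finite_insert two)
    moreover have "T = \<Inter>?H"
      by (rule face_of_polyhedron[OF polytope_imp_polyhedron[OF P] TP ne]) (use dimT in auto)
    ultimately show ?thesis by auto
  qed
  show False using key RS by metis
qed

text \<open>A (d - 2)-face lies in two facets, so it has at most d - 1 vertices, the fewest its
  dimension allows. A (d - 3)-face has at least d - 2 vertices, whereas four facets share at most d
  - 3; so only three contain it.\<close>

proposition spread_imp_simplicial_simple:
  assumes P: "polytope P" "aff_dim P = int d" and d: "4 \<le> d" and sp: "spread d (facet_family P)"
  shows "simplicial (d - 2) P" "simple 2 P"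
proof -
  show "simplicial (d - 2) P"
    unfolding simplicial_def
  proof (intro allI impI)
    fix F assume F: "F face_of P \<and> aff_dim F = int (d - 2)"
    then have ne: "F \<noteq> {}" by auto
    have "2 \<le> card {G. G facet_of P \<and> F \<subseteq> G}"
      using two_facets_through_face[OF P(1) _ ne] F P d by simp
    then obtain \<G> where \<G>: "\<G> \<subseteq> {G. G facet_of P \<and> F \<subseteq> G}" "card \<G> = 2"
      by (meson ex_card)
    have "card (verts P \<inter> F) + card \<G> \<le> d + 1"
      by (rule card_common_verts[OF P(1) _ sp]) (use F \<G> in auto)
    then have le: "int (card (verts P \<inter> F)) \<le> int (d - 2) + 1"
      using \<G>(2) d by simp
    moreover have ge: "aff_dim F + 1 \<le> int (card (verts P \<inter> F))"
      using card_verts_face_ge P F by blast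
    ultimately have c: "int (card (verts P \<inter> F)) = int (d - 2) + 1" using F by simp
    have hull: "F = convex hull (verts P \<inter> F)" using face_eq_hull P F by metis
    moreover have "aff_dim (verts P \<inter> F) = int (card (verts P \<inter> F)) - 1"
      using c F hull by (metis aff_dim_convex_hull add_diff_cancel_right')
    then have "\<not> affine_dependent (verts P \<inter> F)"
      using finite_verts[OF P(1)] by (simp add: affine_independent_iff_card)
    ultimately show "int (d - 2) simplex F"
      unfolding simplex_def using c by blast
  qed
  show "simple 2 P"
    unfolding simple_def
  proof (intro allI impI)
    fix F assume F: "F face_of P \<and> aff_dim F = aff_dim P - int 2 - 1"
    then have ne: "F \<noteq> {}" using P(2) d by auto
    let ?G = "{G. G facet_of P \<and> F \<subseteq> G}"
    have "3 \<le> card ?G"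
      using three_facets_through_face[OF P(1) _ ne] F by simp
    moreover have "\<not> 4 \<le> card ?G"
    proof
      assume "4 \<le> card ?G"
      then obtain \<G> where \<G>: "\<G> \<subseteq> ?G" "card \<G> = 4" by (meson ex_card)
      have "card (verts P \<inter> F) + card \<G> \<le> d + 1"
        by (rule card_common_verts[OF P(1) _ sp]) (use F \<G> in auto)
      moreover have "aff_dim F + 1 \<le> int (card (verts P \<inter> F))"
        using card_verts_face_ge P F by blast
      ultimately show False using F P \<G>(2) by simp
    qed
    ultimately show "card ?G = 2 + 1" by simp
  qed
qed

subsection \<open>Combinatorial equivalence\<close>

lemma comb_equivE:
  assumes "comb_equiv P Q"
  obtains f where "bij_betw f {F. F face_of P} {F. F face_of Q}"
    "\<And>F G. \<lbrakk>F face_of P; G face_of P\<rbrakk> \<Longrightarrow> f F \<subseteq> f G \<longleftrightarrow> F \<subseteq> G"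
  using assms unfolding comb_equiv_def face_lattice_def by auto

lemma comb_equiv_refl: "comb_equiv P P"
  unfolding comb_equiv_def by (rule exI[of _ id]) auto

lemma comb_equiv_sym:
  assumes "comb_equiv P Q" shows "comb_equiv Q P"
proof -
  obtain f where f: "bij_betw f (face_lattice P) (face_lattice Q)"
    "\<forall>F \<in> face_lattice P. \<forall>G \<in> face_lattice P. F \<subseteq> G \<longleftrightarrow> f F \<subseteq> f G"
    using assms unfolding comb_equiv_def by blast
  let ?g = "inv_into (face_lattice P) f"
  have "bij_betw ?g (face_lattice Q) (face_lattice P)" by (rule bij_betw_inv_into[OF f(1)])
  moreover have "F \<subseteq> G \<longleftrightarrow> ?g F \<subseteq> ?g G" if "F \<in> face_lattice Q" "G \<in> face_lattice Q" for F G
  proof -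
    have "?g F \<in> face_lattice P" "?g G \<in> face_lattice P" using bij_betwE[OF calculation] that by auto
    then have "?g F \<subseteq> ?g G \<longleftrightarrow> f (?g F) \<subseteq> f (?g G)" using f(2) by blast
    then show ?thesis using bij_betw_inv_into_right[OF f(1)] that by simp
  qed
  ultimately show ?thesis unfolding comb_equiv_def by blast
qed

lemma comb_equiv_trans:
  assumes "comb_equiv P Q" "comb_equiv Q R" shows "comb_equiv P R"
proof -
  obtain f where f: "bij_betw f (face_lattice P) (face_lattice Q)"
    "\<forall>F \<in> face_lattice P. \<forall>G \<in> face_lattice P. F \<subseteq> G \<longleftrightarrow> f F \<subseteq> f G"
    using assms unfolding comb_equiv_def by blast
  obtain g where g: "bij_betw g (face_lattice Q) (face_lattice R)"
    "\<forall>F \<in> face_lattice Q. \<forall>G \<in> face_lattice Q. F \<subseteq> G \<longleftrightarrow> g F \<subseteq> g G"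
    using assms unfolding comb_equiv_def by blast
  have "bij_betw (g \<circ> f) (face_lattice P) (face_lattice R)"
    by (rule bij_betw_trans[OF f(1) g(1)])
  moreover have "F \<subseteq> G \<longleftrightarrow> (g \<circ> f) F \<subseteq> (g \<circ> f) G"
    if "F \<in> face_lattice P" "G \<in> face_lattice P" for F G
    using that f g bij_betwE[OF f(1)] by simp
  ultimately show ?thesis unfolding comb_equiv_def by blast
qed

text \<open>Vertices and facets are the minimal nonempty and the maximal proper elements of the
  face lattice.\<close>

lemma vertex_face_iff:
  assumes "polytope P" "F face_of P"
  shows "(\<exists>v\<in>verts P. F = {v}) \<longleftrightarrow>
    (F \<noteq> {} \<and> (\<forall>G. G face_of P \<and> G \<subseteq> F \<longrightarrow> G = {} \<or> G = F))"
proof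
  assume "F \<noteq> {} \<and> (\<forall>G. G face_of P \<and> G \<subseteq> F \<longrightarrow> G = {} \<or> G = F)"
  moreover then obtain v where "v \<in> verts P \<inter> F"
    using face_eq_hull[OF assms] by (metis convex_hull_empty equals0I)
  ultimately show "\<exists>v\<in>verts P. F = {v}"
    by (auto simp: verts_def face_of_singleton[symmetric])
qed auto

lemma facet_iff_maximal:
  assumes P: "polytope P" and F: "F face_of P" and d: "0 < aff_dim P"
  shows "F facet_of P \<longleftrightarrow>
    (F \<noteq> P \<and> (\<forall>G. G face_of P \<and> F \<subseteq> G \<longrightarrow> G = F \<or> G = P))"
proof
  assume L: "F facet_of P"
  have "G = F \<or> G = P" if G: "G face_of P" "F \<subseteq> G" for G
  proof (rule ccontr)
    assume c: "\<not> (G = F \<or> G = P)"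
    have "F face_of G" using F G by (meson face_of_imp_subset face_of_subset)
    then have "aff_dim F < aff_dim G"
      using c G(1) face_of_aff_dim_lt[of G F] face_of_imp_convex by blast
    moreover have "aff_dim G < aff_dim P"
      using c G(1) face_of_aff_dim_lt[of P G] polytope_imp_convex[OF P] by blast
    ultimately show False using L by (simp add: facet_of_def)
  qed
  then show "F \<noteq> P \<and> (\<forall>G. G face_of P \<and> F \<subseteq> G \<longrightarrow> G = F \<or> G = P)" using L by auto
next
  assume R: "F \<noteq> P \<and> (\<forall>G. G face_of P \<and> F \<subseteq> G \<longrightarrow> G = F \<or> G = P)"
  have "verts P \<noteq> {}" using d convex_hull_verts[OF P] by auto
  then obtain v where v: "v \<in> verts P" by blast
  have "F \<noteq> {}"
  proof
    assume "F = {}"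
    moreover have "{v} face_of P" using v by (simp add: verts_def face_of_singleton)
    ultimately have "P = {v}" using R by blast
    then show False using d by simp
  qed
  then obtain G where "G facet_of P" "F \<subseteq> G"
    using face_of_polyhedron_subset_facet[OF polytope_imp_polyhedron[OF P] F] R by blast
  moreover then have "G = F" using R facet_of_imp_face_of facet_of_irrefl by metis
  ultimately show "F facet_of P" by simp
qed

text \<open>Vertices and facets are characterized by the order alone, so a lattice isomorphism
  restricts to both; a vertex lies on a facet iff its singleton face is below it. This is the form
  in which decoding uses combinatorial equivalence.\<close>

proposition comb_equiv_imp_family_iso:
  fixes P :: "'a::euclidean_space set" and Q :: "'b::euclidean_space set"
  assumes PQ: "comb_equiv P Q" and P: "polytope P" "0 < aff_dim P" and Q: "polytope Q" "0 < aff_dim Q"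
  obtains \<phi> where "bij_betw \<phi> (verts P) (verts Q)" "facet_family Q = (\<lambda>A. \<phi> ` A) ` facet_family P"
proof -
  obtain f where bij: "bij_betw f {F. F face_of P} {F. F face_of Q}"
    and mono: "\<And>F G. \<lbrakk>F face_of P; G face_of P\<rbrakk> \<Longrightarrow> f F \<subseteq> f G \<longleftrightarrow> F \<subseteq> G"
    using comb_equivE[OF PQ] by blast
  have fQ: "f F face_of Q" if "F face_of P" for F using bij_betwE[OF bij] that by auto
  have surj: "\<exists>F. F face_of P \<and> f F = G" if "G face_of Q" for G
    using bij that by (metis (mono_tags, lifting) bij_betw_def imageE mem_Collect_eq)
  have inj: "F = G" if "f F = f G" "F face_of P" "G face_of P" for F G
    using bij that by (metis (mono_tags, lifting) bij_betw_def inj_onD mem_Collect_eq)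
  have femp: "f {} = {}"
    using surj[of "{}"] mono[of "{}"] fQ[of "{}"] by (metis empty_subsetI face_of_empty subset_empty empty_face_of)
  have fP: "f P = Q"
  proof -
    have "P face_of P" "Q face_of Q" using P Q by (auto simp: face_of_refl polytope_imp_convex)
    then show ?thesis
      using surj[of Q] mono[of _ P] fQ[of P] by (metis face_of_imp_subset subset_antisym)
  qed
  have vert: "(\<exists>v\<in>verts Q. f F = {v}) \<longleftrightarrow> (\<exists>v\<in>verts P. F = {v})" if "F face_of P" for F
  proof -
    have "f F \<noteq> {} \<longleftrightarrow> F \<noteq> {}" using inj[OF _ that empty_face_of] femp by auto
    moreover have "(\<forall>G. G face_of Q \<and> G \<subseteq> f F \<longrightarrow> G = {} \<or> G = f F) \<longleftrightarrow>
        (\<forall>G. G face_of P \<and> f G \<subseteq> f F \<longrightarrow> f G = {} \<or> f G = f F)"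
      by (rule iffI) (use fQ in blast, metis surj)
    moreover have "f G = f F \<longleftrightarrow> G = F" "f G = {} \<longleftrightarrow> G = {}" if "G face_of P" for G
      using inj[OF _ that] \<open>F face_of P\<close> empty_face_of femp by auto
    ultimately show ?thesis
      unfolding vertex_face_iff[OF P(1) that] vertex_face_iff[OF Q(1) fQ[OF that]]
      using mono[OF _ that] by (simp cong: conj_cong imp_cong)
  qed
  have facet: "f F facet_of Q \<longleftrightarrow> F facet_of P" if "F face_of P" for F
  proof -
    have PP: "P face_of P" using P by (simp add: face_of_refl polytope_imp_convex)
    have "f F \<noteq> Q \<longleftrightarrow> F \<noteq> P" using inj[OF _ that PP] fP by auto
    moreover have "(\<forall>G. G face_of Q \<and> f F \<subseteq> G \<longrightarrow> G = f F \<or> G = Q) \<longleftrightarrow>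
        (\<forall>G. G face_of P \<and> f F \<subseteq> f G \<longrightarrow> f G = f F \<or> f G = Q)"
      by (rule iffI) (use fQ in blast, metis surj)
    moreover have "f G = f F \<longleftrightarrow> G = F" "f G = Q \<longleftrightarrow> G = P" if "G face_of P" for G
      using inj[OF _ that] \<open>F face_of P\<close> PP fP by auto
    ultimately show ?thesis
      unfolding facet_iff_maximal[OF P(1) that P(2)] facet_iff_maximal[OF Q(1) fQ[OF that] Q(2)]
      using mono[OF that] by (simp cong: conj_cong imp_cong)
  qed
  define \<phi> where "\<phi> v = the_elem (f {v})" for v
  have sing: "{v} face_of P" if "v \<in> verts P" for v
    using that by (simp add: verts_def face_of_singleton)
  have phi: "f {v} = {\<phi> v} \<and> \<phi> v \<in> verts Q" if v: "v \<in> verts P" for v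
  proof -
    obtain w where "w \<in> verts Q" "f {v} = {w}" using vert[OF sing[OF v]] v by auto
    then show ?thesis by (simp add: \<phi>_def)
  qed
  have "bij_betw \<phi> (verts P) (verts Q)"
    unfolding bij_betw_def
  proof
    show "inj_on \<phi> (verts P)"
    proof (rule inj_onI)
      fix v w assume vw: "v \<in> verts P" "w \<in> verts P" "\<phi> v = \<phi> w"
      then have "f {v} = f {w}" using phi by simp
      then show "v = w" using inj sing vw by blast
    qed
    show "\<phi> ` verts P = verts Q"
    proof
      show "\<phi> ` verts P \<subseteq> verts Q" using phi by auto
      show "verts Q \<subseteq> \<phi> ` verts P"
      proof
        fix w assume w: "w \<in> verts Q"
        then have "{w} face_of Q" by (simp add: verts_def face_of_singleton)
        then obtain F where F: "F face_of P" "f F = {w}" using surj by blast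
        then obtain v where "v \<in> verts P" "F = {v}" using vert[OF F(1)] w by auto
        then show "w \<in> \<phi> ` verts P" using F phi by auto
      qed
    qed
  qed
  moreover have fam: "verts Q \<inter> f Y = \<phi> ` (verts P \<inter> Y)" if Y: "Y face_of P" for Y
  proof -
    have "\<phi> v \<in> f Y \<longleftrightarrow> v \<in> Y" if "v \<in> verts P" for v
      using mono[OF sing[OF that] Y] phi[OF that] by auto
    then show ?thesis
      unfolding bij_betw_imp_surj_on[OF calculation, symmetric] by blast
  qed
  have "facet_family Q = (\<lambda>A. \<phi> ` A) ` facet_family P"
  proof (intro set_eqI iffI)
    fix A assume "A \<in> facet_family Q"
    then obtain Z where Z: "Z facet_of Q" "A = verts Q \<inter> Z" by (auto simp: facet_family_def)
    then obtain Y where "Y face_of P" "f Y = Z" using surj facet_of_imp_face_of by blast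
    then show "A \<in> (\<lambda>A. \<phi> ` A) ` facet_family P"
      using Z fam facet unfolding facet_family_def by auto
  next
    fix A assume "A \<in> (\<lambda>A. \<phi> ` A) ` facet_family P"
    then obtain Y where "Y facet_of P" "A = \<phi> ` (verts P \<inter> Y)" by (auto simp: facet_family_def)
    then show "A \<in> facet_family Q"
      using fam facet facet_of_imp_face_of unfolding facet_family_def by (metis image_eqI mem_Collect_eq)
  qed
  ultimately show ?thesis using that by blast
qed

text \<open>For a fixed numbering of the vertices, the code collects the index sets of the faces. A
  face is determined by its vertices, so each code is order isomorphic to its face lattice.\<close>

lemma comb_equiv_if_same_code:
  fixes P :: "'a::euclidean_space set" and Q :: "'b::euclidean_space set"
  assumes P: "polytope P" and Q: "polytope Q"
    and e: "bij_betw e I (verts P)" and e': "bij_betw e' I (verts Q)"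
    and code: "(\<lambda>F. {i\<in>I. e i \<in> F}) ` {F. F face_of P} = (\<lambda>F. {i\<in>I. e' i \<in> F}) ` {F. F face_of Q}"
  shows "comb_equiv P Q"
proof -
  let ?c = "\<lambda>F. {i\<in>I. e i \<in> F}" and ?c' = "\<lambda>F. {i\<in>I. e' i \<in> F}"
  have sub: "?c F \<subseteq> ?c G \<longleftrightarrow> F \<subseteq> G" if "F face_of P" "G face_of P" for F G
    unfolding face_subset_iff[OF P that] bij_betw_imp_surj_on[OF e, symmetric] by blast
  have sub': "?c' F \<subseteq> ?c' G \<longleftrightarrow> F \<subseteq> G" if "F face_of Q" "G face_of Q" for F G
    unfolding face_subset_iff[OF Q that] bij_betw_imp_surj_on[OF e', symmetric] by blast
  have b: "bij_betw ?c {F. F face_of P} (?c ` {F. F face_of P})"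
    unfolding bij_betw_def using sub by (auto intro!: inj_onI)
  have b': "bij_betw ?c' {F. F face_of Q} (?c ` {F. F face_of P})"
    unfolding bij_betw_def code using sub' by (auto intro!: inj_onI)
  let ?g = "inv_into {F. F face_of Q} ?c'"
  have g: "bij_betw ?g (?c ` {F. F face_of P}) {F. F face_of Q}" by (rule bij_betw_inv_into[OF b'])
  have "bij_betw (?g \<circ> ?c) {F. F face_of P} {F. F face_of Q}" by (rule bij_betw_trans[OF b g])
  moreover have "F \<subseteq> G \<longleftrightarrow> ?g (?c F) \<subseteq> ?g (?c G)" if F: "F face_of P" and G: "G face_of P" for F G
  proof -
    have Fm: "?c F \<in> ?c ` {F. F face_of P}" and Gm: "?c G \<in> ?c ` {F. F face_of P}" using F G by auto
    have "?g (?c F) face_of Q" "?g (?c G) face_of Q" using bij_betwE[OF g] Fm Gm by auto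
    moreover have "?c' (?g (?c F)) = ?c F" "?c' (?g (?c G)) = ?c G"
      using bij_betw_inv_into_right[OF b'] Fm Gm by auto
    ultimately show ?thesis using sub[OF F G] sub'[of "?g (?c F)" "?g (?c G)"] by simp
  qed
  ultimately show ?thesis unfolding comb_equiv_def face_lattice_def
    by (intro exI[of _ "?g \<circ> ?c"]) simp
qed

text \<open>Codes are families of subsets of \<open>{..<N}\<close>, so there are finitely many, and
  a class is recovered from the codes that occur in it. Finiteness matters because the cardinality
  of an infinite quotient would be 0.\<close>

lemma finite_comb_types:
  fixes A :: "'a::euclidean_space set set"
  assumes A: "\<And>P. P \<in> A \<Longrightarrow> polytope P \<and> card (verts P) = N"
  shows "finite (A // {(P, Q). P \<in> A \<and> Q \<in> A \<and> comb_equiv P Q})"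
proof -
  let ?r = "{(P, Q). P \<in> A \<and> Q \<in> A \<and> comb_equiv P Q}"
  have "\<exists>e. bij_betw e {..<N} (verts P)" if "P \<in> A" for P
    using A[OF that] finite_verts ex_bij_betw_nat_finite[of "verts P"]
    by (auto simp: atLeast0LessThan)
  then obtain e where e: "\<And>P. P \<in> A \<Longrightarrow> bij_betw (e P) {..<N} (verts P)" by metis
  define c where "c P = (\<lambda>F. {i\<in>{..<N}. e P i \<in> F}) ` {F. F face_of P}" for P
  have "c ` A \<subseteq> Pow (Pow {..<N})" by (auto simp: c_def)
  then have fin: "finite (c ` A)" by (rule finite_subset) simp
  have cl: "?r `` {P} = {Q \<in> A. c Q \<in> c ` (?r `` {P})}" for P
  proof (intro set_eqI iffI)
    fix Q assume "Q \<in> {Q \<in> A. c Q \<in> c ` (?r `` {P})}"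
    then obtain R where R: "Q \<in> A" "P \<in> A" "R \<in> A" "comb_equiv P R" "c R = c Q" by auto
    have "comb_equiv R Q"
      by (rule comb_equiv_if_same_code[OF _ _ e e]) (use R A in \<open>auto simp: c_def\<close>)
    then show "Q \<in> ?r `` {P}" using R comb_equiv_trans by blast
  qed auto
  have "A // ?r \<subseteq> (\<lambda>X. {Q \<in> A. c Q \<in> X}) ` Pow (c ` A)"
  proof
    fix X assume "X \<in> A // ?r"
    then obtain P where "X = ?r `` {P}" by (auto simp: quotient_def)
    then show "X \<in> (\<lambda>X. {Q \<in> A. c Q \<in> X}) ` Pow (c ` A)"
      by (intro image_eqI[of _ _ "c ` (?r `` {P})"]) (use cl in blast)+
  qed
  then show ?thesis using fin by (meson finite_Pow_iff finite_imageI finite_subset)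
qed

subsection \<open>Gluing facet families at a port\<close>

text \<open>Models a simple vertex v on a simplex facet with other vertices \<open>a b\<close>. Each
  further facet \<open>H b\<close> at v omits just one base vertex, and w stands for the far end of
  the edge at v that leaves the simplex. The labelling fixes how two ports are matched.\<close>

definition port :: "'v set set \<Rightarrow> 'b set \<Rightarrow> 'v \<Rightarrow> 'v \<Rightarrow> ('b \<Rightarrow> 'v) \<Rightarrow> ('b \<Rightarrow> 'v set) \<Rightarrow> bool" where
  "port \<F> B v w a H \<longleftrightarrow> v \<notin> a ` B \<and> inj_on a B \<and> w \<notin> insert v (a ` B) \<and> insert v (a ` B) \<in> \<F> \<and>
     (\<forall>b\<in>B. H b \<in> \<F> \<and> v \<in> H b \<and> w \<in> H b \<and> a ` (B - {b}) \<subseteq> H b \<and> a b \<notin> H b) \<and>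
     (\<forall>A\<in>\<F>. v \<in> A \<longrightarrow> A = insert v (a ` B) \<or> A \<in> H ` B)"

text \<open>Every facet at z drops out, in particular both copies of the base; the others at z come
  back merged in pairs, according to the label they omit.\<close>

definition glued :: "'v set set \<Rightarrow> 'v set set \<Rightarrow> 'v \<Rightarrow> 'v set \<Rightarrow> ('v \<Rightarrow> 'v set) \<Rightarrow> ('v \<Rightarrow> 'v set) \<Rightarrow> 'v set set" where
  "glued \<P> \<Q> z B HP HQ =
     {A \<in> \<P>. z \<notin> A} \<union> {A \<in> \<Q>. z \<notin> A} \<union> (\<lambda>b. (HP b \<union> HQ b) - {z}) ` B"

lemma spread_mono_card:
  assumes sp: "spread d \<F>" and fin: "finite (\<Union>\<F>)" and \<G>: "\<G> \<subseteq> \<F>" "2 \<le> card \<G>" "card \<G> \<le> 4"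
    and X: "X \<subseteq> \<Inter>\<G>"
  shows "card X + card \<G> \<le> d + 1"
proof -
  have "\<G> \<noteq> {}" using \<G>(2) by auto
  then have "finite (\<Inter>\<G>)"
    using \<G>(1) fin by (meson Inf_lower2 Sup_upper ex_in_conv finite_subset subsetD)
  then have "card X \<le> card (\<Inter>\<G>)" using X card_mono by blast
  then show ?thesis using spreadD[OF sp \<G>] by linarith
qed

locale gluing =
  fixes d :: nat and \<P> \<Q> :: "'v set set" and z :: 'v and B :: "'v set" and wP wQ HP HQ
  assumes finB: "finite B" and cardB: "card B + 1 = d" and d4: "4 \<le> d"
    and finP: "finite (\<Union>\<P>)" and finQ: "finite (\<Union>\<Q>)" and common: "\<Union>\<P> \<inter> \<Union>\<Q> \<subseteq> insert z B"
    and spP: "spread d \<P>" and spQ: "spread d \<Q>"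
    and portP: "port \<P> B z wP id HP" and portQ: "port \<Q> B z wQ id HQ"
begin

lemma sym: "gluing d \<Q> \<P> z B wQ wP HQ HP"
  using finB cardB d4 finP finQ common spP spQ portP portQ by unfold_locales auto

lemma zB: "z \<notin> B" and FP: "insert z B \<in> \<P>" and wP: "wP \<noteq> z" "wP \<notin> B"
  using portP by (auto simp: port_def)

lemma HP: assumes "b \<in> B"
  shows "HP b \<in> \<P>" "z \<in> HP b" "wP \<in> HP b" "B - {b} \<subseteq> HP b" "b \<notin> HP b"
  using portP assms by (auto simp: port_def)

lemma wP_notin: "wP \<notin> \<Union>\<Q>"
proof -
  have "B \<noteq> {}" using cardB d4 by auto
  then obtain b where "b \<in> B" by blast
  then have "wP \<in> \<Union>\<P>" using HP by blast
  then show ?thesis using common wP by blast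
qed

lemma P_cases: assumes "A \<in> \<P>" "z \<in> A" obtains "A = insert z B" | b where "b \<in> B" "A = HP b"
  using portP assms by (auto simp: port_def)

lemma HP_inj: "inj_on HP B"
  by (rule inj_onI) (metis DiffI HP(4) HP(5) singletonD subsetD)

text \<open>The listed elements already number 1 + 1 + (d - 3) = d - 1, the maximum for two members
  of a spread family.\<close>

lemma HP_pair: assumes "b \<in> B" "c \<in> B" "b \<noteq> c"
  shows "HP b \<inter> HP c \<subseteq> insert z (insert wP (B - {b,c}))"
proof (rule ccontr)
  assume "\<not> ?thesis"
  then obtain x where x: "x \<in> HP b" "x \<in> HP c" "x \<notin> insert z (insert wP (B - {b,c}))" by blast
  have "HP b \<noteq> HP c" using HP_inj assms by (meson inj_onD)
  then have c2: "card {HP b, HP c} = 2" by simp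
  let ?X = "insert x (insert z (insert wP (B - {b,c})))"
  have sub: "?X \<subseteq> \<Inter>{HP b, HP c}" using x HP[OF assms(1)] HP[OF assms(2)] by auto
  have "card ?X + card {HP b, HP c} \<le> d + 1"
    by (rule spread_mono_card[OF spP finP]) (use HP assms c2 sub in auto)
  moreover have "card (B - {b,c}) = d - 3"
    using assms finB cardB by (simp add: card_Diff_subset)
  moreover have "card ?X = card (B - {b,c}) + 3"
    using x finB zB wP by (simp add: card_insert_if)
  ultimately show False using c2 d4 by simp
qed

lemma HP_Inter: assumes "J \<subseteq> B" "2 \<le> card J"
  shows "\<Inter>(HP ` J) \<subseteq> insert z (insert wP (B - J))"
proof
  fix x assume x: "x \<in> \<Inter>(HP ` J)"
  obtain b c where bc: "b \<in> J" "c \<in> J" "b \<noteq> c" using obtain_two[OF assms(2)] .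
  then have "x \<in> insert z (insert wP (B - {b,c}))" using HP_pair[of b c] assms x by blast
  moreover have "x \<notin> J" if "x \<in> B" using x HP(5) assms by blast
  ultimately show "x \<in> insert z (insert wP (B - J))" by auto
qed

text \<open>The part of \<open>HQ b\<close> visible in \<P> lies in the base and omits b, so
  \<open>HP b\<close> contains it. Merging thus adds nothing on the \<P> side, and intersections
  there can be computed in \<P>.\<close>

lemma HP_HQ: assumes "b \<in> B" shows "(HP b \<union> HQ b) \<inter> \<Union>\<P> \<subseteq> HP b"
proof -
  have "HQ b \<inter> \<Union>\<P> \<subseteq> insert z B - {b}"
    using gluing.HP[OF sym assms] common zB by blast
  then show ?thesis using HP[OF assms] by auto
qed


end

text \<open>Facets of \<open>\<Q>\<close> that avoid \<open>z\<close> are replaced by the base facet, so that a family of glued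
  facets is compared with an equally large family in \<open>\<P>\<close>.\<close>

lemma (in gluing) spread_glued: "spread d (glued \<P> \<Q> z B HP HQ)"
  unfolding spread_def
proof (intro allI impI, elim conjE)
  fix \<G> assume \<G>: "\<G> \<subseteq> glued \<P> \<Q> z B HP HQ" "2 \<le> card \<G>" "card \<G> \<le> 4"
  define K where "K b = (HP b \<union> HQ b) - {z}" for b
  define J where "J = {b \<in> B. K b \<in> \<G>}"
  define GP where "GP = {A \<in> \<G>. A \<in> \<P> \<and> z \<notin> A}"
  define GQ where "GQ = {A \<in> \<G>. A \<in> \<Q> \<and> z \<notin> A \<and> A \<notin> \<P>}"
  interpret s: gluing d \<Q> \<P> z B wQ wP HQ HP by (rule sym)
  have fin\<G>: "finite \<G>" using \<G>(2) by (metis card.infinite not_numeral_le_zero)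
  have wQP: "wQ \<notin> \<Union>\<P>" by (rule s.wP_notin)
  have Kb: "b \<notin> K b" "B - {b} \<subseteq> K b" "wP \<in> K b" "wQ \<in> K b" if "b \<in> B" for b
    using HP[OF that] s.HP[OF that] zB wP s.wP by (auto simp: K_def)
  have Kinj: "inj_on K B" by (rule inj_onI) (metis DiffI Kb(1) Kb(2) singletonD subsetD)
  have KnP: "K b \<notin> \<P>" and KnQ: "K b \<notin> \<Q>" if "b \<in> B" for b
    using Kb(3,4)[OF that] wQP wP_notin by blast+
  have \<G>eq: "\<G> = GP \<union> GQ \<union> K ` J"
    using \<G>(1) unfolding glued_def GP_def GQ_def J_def K_def by blast
  have JB: "J \<subseteq> B" by (auto simp: J_def)
  have finJ: "finite J" using JB finB finite_subset by blast
  have fGP: "finite GP" "finite GQ" using fin\<G> by (auto simp: GP_def GQ_def)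
  have cJ: "card (K ` J) = card J" using Kinj JB by (simp add: card_image inj_on_subset)
  have c\<G>: "card \<G> = card GP + card GQ + card J"
  proof -
    have "card (GP \<union> GQ) = card GP + card GQ"
      by (rule card_Un_disjoint) (use fGP in \<open>auto simp: GP_def GQ_def\<close>)
    moreover have "card (GP \<union> GQ \<union> K ` J) = card (GP \<union> GQ) + card (K ` J)"
      by (rule card_Un_disjoint) (use fGP finJ KnP KnQ JB in \<open>auto simp: GP_def GQ_def\<close>)
    ultimately show ?thesis using \<G>eq cJ by simp
  qed
  have HPJ: "card (HP ` J) = card J" "card (HQ ` J) = card J"
    using HP_inj s.HP_inj JB by (simp_all add: card_image inj_on_subset)
  have zH: "z \<in> A" if "A \<in> HP ` J \<or> A \<in> HQ ` J" for A using that JB HP s.HP by auto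
  have FnH: "insert z B \<notin> HP ` J" "insert z B \<notin> HQ ` J" using JB HP(5) s.HP(5) by blast+
  have interP: "\<Inter>\<G> \<subseteq> \<Inter>(GP \<union> HP ` J)" if "GP \<noteq> {}"
  proof -
    have "\<Inter>\<G> \<subseteq> \<Union>\<P>" using that by (auto simp: GP_def)
    then have "\<Inter>\<G> \<subseteq> HP b" if "b \<in> J" for b
      using HP_HQ[of b] that JB by (auto simp: J_def K_def)
    then show ?thesis using \<G>eq by blast
  qed
  have interQ: "\<Inter>\<G> \<subseteq> \<Inter>(GQ \<union> HQ ` J)" if "GQ \<noteq> {}"
  proof -
    have "\<Inter>\<G> \<subseteq> \<Union>\<Q>" using that by (auto simp: GQ_def)
    then have "\<Inter>\<G> \<subseteq> HQ b" if "b \<in> J" for b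
      using s.HP_HQ[of b] that JB by (auto simp: J_def K_def)
    then show ?thesis using \<G>eq by blast
  qed
  consider "GP = {}" "GQ = {}" | "GP \<noteq> {}" "GQ = {}" | "GP = {}" "GQ \<noteq> {}" | "GP \<noteq> {}" "GQ \<noteq> {}"
    by blast
  then show "card (\<Inter>\<G>) + card \<G> \<le> d + 1"
  proof cases
    case 1
    then have cJ2: "2 \<le> card J" and \<G>J: "\<G> = K ` J" using c\<G> \<G>(2) \<G>eq by auto
    \<comment> \<open>Merged facets gain the two common vertices \<open>wP\<close> and
      \<open>wQ\<close> but lose the labels in J: at most (d - 1) - |J| + 2 remain, exactly the
      allowed number.\<close>
    have "\<Inter>\<G> \<subseteq> insert wP (insert wQ (B - J))"
    proof
      fix x assume x: "x \<in> \<Inter>\<G>"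
      have xK: "x \<in> K b" if "b \<in> J" for b using x \<G>J that by blast
      have xJ: "x \<notin> J" using x \<G>J Kb(1) JB by blast
      obtain b where b: "b \<in> J" using cJ2 by fastforce
      have xz: "x \<noteq> z" using xK[OF b] by (auto simp: K_def)
      have "HP b \<in> \<P>" "HQ b \<in> \<Q>" using b JB HP(1) s.HP(1) by auto
      then have "x \<in> \<Union>\<P> \<or> x \<in> \<Union>\<Q>" using xK[OF b] unfolding K_def by blast
      then show "x \<in> insert wP (insert wQ (B - J))"
      proof
        assume "x \<in> \<Union>\<P>"
        then have "x \<in> HP b" if "b \<in> J" for b
          using xK[OF that] HP_HQ[of b] that JB unfolding K_def by blast
        then have "x \<in> \<Inter>(HP ` J)" by blast
        then show ?thesis using HP_Inter[OF JB cJ2] xz xJ by blast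
      next
        assume "x \<in> \<Union>\<Q>"
        then have "x \<in> HQ b" if "b \<in> J" for b
          using xK[OF that] s.HP_HQ[of b] that JB unfolding K_def by blast
        then have "x \<in> \<Inter>(HQ ` J)" by blast
        then show ?thesis using s.HP_Inter[OF JB cJ2] xz xJ by blast
      qed
    qed
    then have "card (\<Inter>\<G>) \<le> card (insert wP (insert wQ (B - J)))"
      by (rule card_mono[rotated]) (use finB in simp)
    also have "\<dots> \<le> card (B - J) + 2"
      using finB by (simp add: card_insert_if)
    also have "\<dots> = card B - card J + 2" using JB finJ by (simp add: card_Diff_subset)
    finally show ?thesis using c\<G> 1 cardB card_mono[OF finB JB] by simp
  next
    case 2
    have "card (GP \<union> HP ` J) = card GP + card (HP ` J)"
      by (rule card_Un_disjoint) (use fGP finJ zH in \<open>auto simp: GP_def\<close>)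
    then have c: "card (GP \<union> HP ` J) = card \<G>" using c\<G> 2 HPJ by simp
    have "card (\<Inter>\<G>) + card (GP \<union> HP ` J) \<le> d + 1"
      by (rule spread_mono_card[OF spP finP _ _ _ interP[OF 2(1)]])
        (use c \<G> HP JB in \<open>auto simp: GP_def\<close>)
    then show ?thesis using c by simp
  next
    case 3
    have "card (GQ \<union> HQ ` J) = card GQ + card (HQ ` J)"
      by (rule card_Un_disjoint) (use fGP finJ zH in \<open>auto simp: GQ_def\<close>)
    then have c: "card (GQ \<union> HQ ` J) = card \<G>" using c\<G> 3 HPJ by simp
    have "card (\<Inter>\<G>) + card (GQ \<union> HQ ` J) \<le> d + 1"
      by (rule spread_mono_card[OF spQ finQ _ _ _ interQ[OF 3(2)]])
        (use c \<G> s.HP JB in \<open>auto simp: GQ_def\<close>)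
    then show ?thesis using c by simp
  next
    case 4
    have "\<Inter>\<G> \<subseteq> \<Union>\<P> \<inter> \<Union>\<Q>" using 4 by (auto simp: GP_def GQ_def)
    moreover have "z \<notin> \<Inter>\<G>" using 4 by (auto simp: GP_def)
    ultimately have inB: "\<Inter>\<G> \<subseteq> B" using common by blast
    \<comment> \<open>All common vertices now lie in B, so the base facet can join the family on
      either side without shrinking the intersection. It makes up for a single facet from the other
      side.\<close>
    have cPF: "card (insert (insert z B) (GP \<union> HP ` J)) = card GP + card J + 1"
    proof -
      have "card (GP \<union> HP ` J) = card GP + card (HP ` J)"
        by (rule card_Un_disjoint) (use fGP finJ zH in \<open>auto simp: GP_def\<close>)
      moreover have "insert z B \<notin> GP \<union> HP ` J" using FnH by (auto simp: GP_def)
      ultimately show ?thesis using HPJ fGP finJ by simp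
    qed
    have cQF: "card (insert (insert z B) (GQ \<union> HQ ` J)) = card GQ + card J + 1"
    proof -
      have "card (GQ \<union> HQ ` J) = card GQ + card (HQ ` J)"
        by (rule card_Un_disjoint) (use fGP finJ zH in \<open>auto simp: GQ_def\<close>)
      moreover have "insert z B \<notin> GQ \<union> HQ ` J" using FnH by (auto simp: GQ_def)
      ultimately show ?thesis using HPJ fGP finJ by simp
    qed
    have pos: "card GP \<ge> 1" "card GQ \<ge> 1" using 4 fGP by (simp_all add: Suc_leI card_gt_0_iff)
    consider "card GQ = 1" | "card GP = 1" | "2 \<le> card GP" "2 \<le> card GQ" using pos by linarith
    then show ?thesis
    proof cases
      case 1
      have "card (\<Inter>\<G>) + card (insert (insert z B) (GP \<union> HP ` J)) \<le> d + 1"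
        by (rule spread_mono_card[OF spP finP])
          (use cPF c\<G> 1 \<G> FP HP JB interP[OF 4(1)] inB in \<open>auto simp: GP_def\<close>)
      then show ?thesis using cPF c\<G> 1 by simp
    next
      case 2
      have "card (\<Inter>\<G>) + card (insert (insert z B) (GQ \<union> HQ ` J)) \<le> d + 1"
        by (rule spread_mono_card[OF spQ finQ])
          (use cQF c\<G> 2 \<G> s.FP s.HP JB interQ[OF 4(2)] inB in \<open>auto simp: GQ_def\<close>)
      then show ?thesis using cQF c\<G> 2 by simp
    next
      case 3
      then have GP2: "card GP = 2" and "card J = 0" and \<G>4: "card \<G> = 4"
        using c\<G> \<G>(3) by linarith+
      show ?thesis
      proof (rule ccontr)
        assume "\<not> ?thesis"
        then have big: "card B - 1 \<le> card (\<Inter>\<G>)" using \<G>4 cardB by simp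
        \<comment> \<open>With two facets on each side the base facet alone is one too few. If the
          bound fails, the intersection contains all of B but one b; then the base,
          \<open>HP b\<close> and the two facets of \<P> form four members sharing d - 2 vertices,
          one too many.\<close>
        have "\<exists>b\<in>B. B - {b} \<subseteq> \<Inter>\<G>"
        proof (cases "\<Inter>\<G> = B")
          case True
          moreover have "B \<noteq> {}" using cardB d4 by auto
          ultimately show ?thesis by blast
        next
          case False
          then obtain b where b: "b \<in> B" "b \<notin> \<Inter>\<G>" using inB by blast
          have sub: "\<Inter>\<G> \<subseteq> B - {b}" using b inB by blast
          have "card (B - {b}) \<le> card (\<Inter>\<G>)" using b(1) finB big by simp
          then have "\<Inter>\<G> = B - {b}" using sub finB card_seteq[of "B - {b}" "\<Inter>\<G>"] by auto
          then show ?thesis using b by blast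
        qed
        then obtain b where b: "b \<in> B" "B - {b} \<subseteq> \<Inter>\<G>" by blast
        let ?X = "insert (insert z B) (insert (HP b) GP)"
        have "HP b \<notin> GP" "insert z B \<notin> insert (HP b) GP" using HP[OF b(1)] b by (auto simp: GP_def)
        then have c4: "card ?X = 4" using GP2 fGP by simp
        have "?X \<subseteq> \<P>" using FP HP(1)[OF b(1)] by (auto simp: GP_def)
        moreover have "B - {b} \<subseteq> \<Inter>?X" using HP(4)[OF b(1)] b(2) by (auto simp: GP_def)
        ultimately have "card (B - {b}) + card ?X \<le> d + 1"
          by (intro spread_mono_card[OF spP finP]) (simp_all only: c4)
        then show False using c4 b cardB finB d4 by simp
      qed
    qed
  qed
qed

section \<open>Facets and ports after a gluing\<close>

context gluing
begin

text \<open>Tells where a facet of either piece goes. The base facet has no successor of its own, so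
  it is sent to a chosen facet G of the other piece. A merged facet is found from the one label its
  parts omit, which makes the map symmetric in the two pieces.\<close>

definition repl :: "'v set \<Rightarrow> 'v set \<Rightarrow> 'v set" where
  "repl G A = (if z \<notin> A then A else if A = insert z B then G
     else let b = (THE b. b \<in> B \<and> b \<notin> A) in (HP b \<union> HQ b) - {z})"

lemma repl_simps:
  "z \<notin> A \<Longrightarrow> repl G A = A" "repl G (insert z B) = G"
  "b \<in> B \<Longrightarrow> repl G (HP b) = (HP b \<union> HQ b) - {z}"
  "b \<in> B \<Longrightarrow> repl G (HQ b) = (HP b \<union> HQ b) - {z}"
proof -
  interpret s: gluing d \<Q> \<P> z B wQ wP HQ HP by (rule sym)
  show "z \<notin> A \<Longrightarrow> repl G A = A" "repl G (insert z B) = G" by (auto simp: repl_def)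
  assume b: "b \<in> B"
  have "(THE c. c \<in> B \<and> c \<notin> HP b) = b" "(THE c. c \<in> B \<and> c \<notin> HQ b) = b"
    using HP[OF b] s.HP[OF b] b by (auto intro!: the_equality)
  then show "repl G (HP b) = (HP b \<union> HQ b) - {z}" "repl G (HQ b) = (HP b \<union> HQ b) - {z}"
    using HP[OF b] s.HP[OF b] b unfolding repl_def by (auto simp: Let_def)
qed

lemma repl_glued:
  assumes "A \<in> \<P>" "G \<in> \<Q>" "z \<notin> G" shows "repl G A \<in> glued \<P> \<Q> z B HP HQ"
proof (cases "z \<in> A")
  case True
  show ?thesis
    by (rule P_cases[OF assms(1) True]) (use assms in \<open>auto simp: repl_simps glued_def\<close>)
qed (use assms in \<open>auto simp: repl_simps glued_def\<close>)

lemma repl_supset: "\<lbrakk>A \<in> \<P>; B \<subseteq> G\<rbrakk> \<Longrightarrow> A - {z} \<subseteq> repl G A"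
  by (cases "z \<in> A") (auto elim!: P_cases simp: repl_simps)

lemma merged_notin: "b \<in> B \<Longrightarrow> (HP b \<union> HQ b) - {z} \<notin> \<P> \<and> (HP b \<union> HQ b) - {z} \<notin> \<Q>"
  using HP[of b] gluing.HP[OF sym, of b] wP_notin gluing.wP_notin[OF sym] wP gluing.wP[OF sym] by blast

lemma merged_inj: "inj_on (\<lambda>b. (HP b \<union> HQ b) - {z}) B"
proof (rule inj_onI)
  fix b c assume bc: "b \<in> B" "c \<in> B" "HP b \<union> HQ b - {z} = HP c \<union> HQ c - {z}"
  show "b = c"
  proof (rule ccontr)
    assume "b \<noteq> c"
    then have "b \<in> HP c - {z}" using bc HP(4)[of c] zB by blast
    then have "b \<in> HP b \<union> HQ b" using bc(3) by blast
    then show False using bc(1) HP(5) gluing.HP(5)[OF sym] by blast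
  qed
qed

text \<open>G has a vertex outside the shared ones, so it is no member of \<P>; merged facets
  contain \<open>wP\<close> and \<open>wQ\<close> and are new on both sides.\<close>

lemma repl_inj:
  assumes G: "G \<in> \<Q>" "z \<notin> G" "\<not> G \<subseteq> B"
  shows "inj_on (repl G) \<P>"
proof (rule inj_onI)
  fix A C assume A: "A \<in> \<P>" and C: "C \<in> \<P>" and eq: "repl G A = repl G C"
  have GP: "G \<notin> \<P>" using common G by blast
  have c: "A = insert z B \<or> (\<exists>b\<in>B. A = HP b) \<or> z \<notin> A" if "A \<in> \<P>" for A
    using P_cases[OF that] by blast
  show "A = C"
    using c[OF A] c[OF C] eq A C G GP merged_notin inj_onD[OF merged_inj]
    by (elim disjE bexE) (simp_all add: repl_simps, metis+)
qed

text \<open>The far port keeps its vertex, simplex and labels because u lies outside \<P>. A facet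
  of it through z is some \<open>HQ b'\<close> and grows by \<open>HP b'\<close>. This adds no
  omitted label: such a label could enter only as an element of B, but b' is the only element of B
  missing from \<open>HQ b'\<close>, and \<open>HP b'\<close> misses it too.\<close>

lemma glued_port:
  assumes top: "port \<Q> B u w c H" and u: "u \<notin> \<Union>\<P>" and w: "w \<noteq> z" and zc: "z \<notin> c ` B"
    and G: "G \<in> \<P>" "z \<notin> G"
  shows "port (glued \<P> \<Q> z B HP HQ) B u w c (repl G \<circ> H)"
proof -
  interpret s: gluing d \<Q> \<P> z B wQ wP HQ HP by (rule sym)
  have [simp]: "s.repl = repl" 
    unfolding fun_eq_iff s.repl_def repl_def by (auto simp: Un_commute Let_def)
  have gl: "glued \<Q> \<P> z B HQ HP = glued \<P> \<Q> z B HP HQ"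
    by (auto simp: glued_def Un_commute)
  have uz: "u \<noteq> z" "u \<notin> B" using u FP by auto
  have H: "H b \<in> \<Q>" "u \<in> H b" "w \<in> H b" "c ` (B - {b}) \<subseteq> H b" "c b \<notin> H b" if "b \<in> B" for b
    using top that by (auto simp: port_def)
  have Hc: "z \<notin> H b \<or> (\<exists>b'\<in>B. H b = HQ b')" if "b \<in> B" for b
    using s.P_cases[OF H(1)[OF that]] H(2)[OF that] uz by blast
  have F: "insert u (c ` B) \<in> \<Q>" "z \<notin> insert u (c ` B)" using top uz zc by (auto simp: port_def)
  have cb: "c b \<notin> HP b'" if "b \<in> B" "b' \<in> B" "c b \<notin> HQ b'" for b b'
  proof
    assume "c b \<in> HP b'"
    moreover have "c b \<in> \<Union>\<Q>" using F that by blast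
    moreover have "c b \<noteq> z" using zc that by blast
    ultimately have "c b \<in> B" "c b \<in> HP b'" using common HP(1)[OF that(2)] by blast+
    then show False using that HP(5)[OF that(2)] s.HP(4)[OF that(2)] by blast
  qed
  have "repl G (H b) \<in> glued \<P> \<Q> z B HP HQ \<and> u \<in> repl G (H b) \<and> w \<in> repl G (H b) \<and>
      c ` (B - {b}) \<subseteq> repl G (H b) \<and> c b \<notin> repl G (H b)" if b: "b \<in> B" for b
    using Hc[OF b]
  proof (elim disjE bexE)
    assume z: "z \<notin> H b" then show ?thesis using H[OF b] by (auto simp: repl_simps glued_def)
  next
    fix b' assume b': "b' \<in> B" "H b = HQ b'"
    then have r: "repl G (H b) = (HP b' \<union> HQ b') - {z}" by (simp add: repl_simps)
    then have "repl G (H b) \<in> glued \<P> \<Q> z B HP HQ" using b' by (simp add: glued_def)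
    then show ?thesis unfolding r using H[OF b] b' cb[OF b b'(1)] uz w zc by auto
  qed
  moreover have "A = insert u (c ` B) \<or> A \<in> (repl G \<circ> H) ` B"
    if A: "A \<in> glued \<P> \<Q> z B HP HQ" "u \<in> A" for A
  proof -
    consider "A \<in> \<P>" | "A \<in> \<Q>" "z \<notin> A" | b where "b \<in> B" "A = (HP b \<union> HQ b) - {z}"
      using A(1) by (auto simp: glued_def)
    then show ?thesis
    proof cases
      case 1 then show ?thesis using u A(2) by blast
    next
      case 2
      then have "A = insert u (c ` B) \<or> A \<in> H ` B" using top A(2) by (auto simp: port_def)
      moreover have "A \<in> (repl G \<circ> H) ` B" if "b \<in> B" "A = H b" for b
        using that 2 repl_simps(1) by (intro image_eqI[of _ _ b]) auto
      ultimately show ?thesis by blast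
    next
      case (3 b)
      then have "u \<in> HQ b" using A(2) u HP(1)[of b] by blast
      then have "HQ b = insert u (c ` B) \<or> HQ b \<in> H ` B"
        using top s.HP(1)[of b] 3 by (auto simp: port_def)
      then have "HQ b \<in> H ` B" using F s.HP(2) 3 by auto
      then obtain b' where "b' \<in> B" "HQ b = H b'" by blast
      then have "A \<in> (repl G \<circ> H) ` B"
        using 3 repl_simps(4)[of b G] by (intro image_eqI[of _ _ b']) auto
      then show ?thesis by blast
    qed
  qed
  ultimately show ?thesis
    using top F unfolding port_def by (auto simp: glued_def)
qed

end

subsection \<open>Decoding words\<close>

text \<open>One step flips a flag inside the boundary of the fixed facet G: the ridge spanned by the
  labelled vertices is left across the face without label b, and the vertex x of the next ridge
  takes over this label.\<close>

inductive walk :: "'v set set \<Rightarrow> 'b set \<Rightarrow> 'v set \<Rightarrow> 'b list \<Rightarrow> 'v set \<Rightarrow> ('b \<Rightarrow> 'v) \<Rightarrow> 'v set \<Rightarrow> ('b \<Rightarrow> 'v) \<Rightarrow> bool"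
  for \<F> B G where
  walk_Nil: "walk \<F> B G [] Y r Y r"
| walk_Cons: "\<lbrakk>b \<in> B; Y' \<in> \<F>; Y' \<noteq> G; Y' \<noteq> Y; r ` (B - {b}) \<subseteq> Y'; x \<in> Y' \<inter> G; x \<notin> r ` (B - {b});
    walk \<F> B G bs Y' (r(b := x)) Y'' r''\<rbrakk> \<Longrightarrow> walk \<F> B G (b # bs) Y r Y'' r''"

inductive_cases walk_NilE: "walk \<F> B G [] Y r Y' r'"
inductive_cases walk_ConsE: "walk \<F> B G (b # bs) Y r Y' r'"

text \<open>A word is read off a facet family by a walk along flags: a pair of adjacent facets
  \<open>G\<close>, \<open>Y\<close> together with a labelling \<open>r\<close> of the vertices of the simplex \<open>G \<inter> Y\<close>.\<close>

definition state :: "'v set set \<Rightarrow> 'b set \<Rightarrow> 'v set \<Rightarrow> 'v set \<Rightarrow> ('b \<Rightarrow> 'v) \<Rightarrow> bool" where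
  "state \<F> B G Y r \<longleftrightarrow> G \<in> \<F> \<and> Y \<in> \<F> \<and> G \<noteq> Y \<and> inj_on r B \<and> r ` B \<subseteq> G \<inter> Y"

text \<open>The size of G gives a letter; after its walk the two facets change roles, which leads
  into the next gadget. Size d marks the initial simplex. The set U keeps the facets that are read
  away from the open port vertex, so the next gluing leaves them intact.\<close>

inductive decodes :: "'v set set \<Rightarrow> 'b set \<Rightarrow> nat \<Rightarrow> ('l \<Rightarrow> nat) \<Rightarrow> ('l \<Rightarrow> 'b list) \<Rightarrow> 'v set \<Rightarrow>
    'l list \<Rightarrow> 'v set \<Rightarrow> 'v set \<Rightarrow> ('b \<Rightarrow> 'v) \<Rightarrow> bool"
  for \<F> B d sz bs U where
  dec_Nil: "\<lbrakk>G \<subseteq> U; card G = d\<rbrakk> \<Longrightarrow> decodes \<F> B d sz bs U [] G Y r"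
| dec_Cons: "\<lbrakk>G \<subseteq> U; card G = sz l; walk \<F> B G (bs l) Y r Y' r'; decodes \<F> B d sz bs U ws Y' G r'\<rbrakk>
    \<Longrightarrow> decodes \<F> B d sz bs U (l # ws) G Y r"

inductive_cases dec_NilE: "decodes \<F> B d sz bs U [] G Y r"
inductive_cases dec_ConsE: "decodes \<F> B d sz bs U (l # ws) G Y r"

lemma decodes_subset: "decodes \<F> B d sz bs U ws G Y r \<Longrightarrow> G \<subseteq> U"
  by (erule decodes.cases) auto

lemma walk_step_state:
  assumes st: "state \<F> B G Y r" and b: "b \<in> B" "Y' \<in> \<F>" "Y' \<noteq> G" "r ` (B - {b}) \<subseteq> Y'"
    and x: "x \<in> Y' \<inter> G" "x \<notin> r ` (B - {b})"
  shows "state \<F> B G Y' (r(b := x))"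
proof -
  have "inj_on (r(b := x)) B"
  proof (rule inj_onI)
    fix i j assume "i \<in> B" "j \<in> B" "(r(b := x)) i = (r(b := x)) j"
    then show "i = j" using st x(2) unfolding state_def
      by (auto split: if_splits dest: inj_onD simp: image_iff)
  qed
  moreover have "(r(b := x)) ` B \<subseteq> G \<inter> Y'"
    using st b x by (auto simp: state_def)
  ultimately show ?thesis using st b by (auto simp: state_def)
qed

lemma walk_state:
  "\<lbrakk>walk \<F> B G bs Y r Y' r'; state \<F> B G Y r\<rbrakk> \<Longrightarrow> state \<F> B G Y' r'"
proof (induction rule: walk.induct)
  case (walk_Cons b Y' Y r x bs Y'' r'')
  have "state \<F> B G Y' (r(b := x))"
    by (rule walk_step_state[OF walk_Cons.prems]) (use walk_Cons.hyps in auto)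
  then show ?case by (rule walk_Cons.IH)
qed

lemma state_swap: "state \<F> B G Y r \<Longrightarrow> state \<F> B Y G r"
  by (auto simp: state_def)

lemma walk_cong:
  "\<lbrakk>walk \<F> B G bs Y r Y' r'; \<forall>b\<in>B. s b = r b\<rbrakk> \<Longrightarrow> \<exists>s'. walk \<F> B G bs Y s Y' s' \<and> (\<forall>b\<in>B. s' b = r' b)"
proof (induction arbitrary: s rule: walk.induct)
  case (walk_Nil Y r) then show ?case by (blast intro: walk.intros)
next
  case (walk_Cons b Y' Y r x bs Y'' r'')
  have im: "s ` (B - {b}) = r ` (B - {b})" using walk_Cons.prems by auto
  have "\<forall>c\<in>B. (s(b := x)) c = (r(b := x)) c" using walk_Cons.prems by simp
  then obtain s' where s': "walk \<F> B G bs Y' (s(b := x)) Y'' s'" "\<forall>b\<in>B. s' b = r'' b"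
    using walk_Cons.IH by blast
  have "walk \<F> B G (b # bs) Y s Y'' s'"
    by (rule walk.walk_Cons[OF walk_Cons.hyps(1-4) _ walk_Cons.hyps(6) _ s'(1)])
      (use walk_Cons.hyps im in auto)
  then show ?case using s'(2) by blast
qed

lemma decodes_cong:
  "\<lbrakk>decodes \<F> B d sz bs U ws G Y r; \<forall>b\<in>B. s b = r b\<rbrakk> \<Longrightarrow> decodes \<F> B d sz bs U ws G Y s"
proof (induction arbitrary: s rule: decodes.induct)
  case (dec_Nil G Y r) then show ?case by (blast intro: decodes.intros)
next
  case (dec_Cons G l Y r Y' r' ws)
  then show ?case using walk_cong[OF dec_Cons.hyps(3) dec_Cons.prems] 
    by (metis decodes.dec_Cons)
qed

lemma decodes_mono: "\<lbrakk>decodes \<F> B d sz bs U ws G Y r; U \<subseteq> U'\<rbrakk> \<Longrightarrow> decodes \<F> B d sz bs U' ws G Y r"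
  by (induction rule: decodes.induct) (auto intro: decodes.intros)

text \<open>Two candidates for the next facet would form, with G and Y, four members sharing d - 2
  vertices; two candidates for the new vertex would give G and Y' at least d common vertices. Both
  exceed the bound.\<close>

lemma walk_det:
  assumes sp: "spread d \<F>" and fin: "finite (\<Union>\<F>)" and B: "finite B" "card B + 1 = d" "4 \<le> d"
  shows "\<lbrakk>walk \<F> B G bs Y r Y1 r1; state \<F> B G Y r; walk \<F> B G bs Y r Y2 r2\<rbrakk> \<Longrightarrow> Y1 = Y2 \<and> r1 = r2"
proof (induction rule: walk.induct)
  case (walk_Nil Y r) then show ?case by (auto elim: walk_NilE)
next
  case (walk_Cons b Y' Y r x bs Y'' r'')
  from walk_Cons.prems(2) obtain Z y where
    Z: "Z \<in> \<F>" "Z \<noteq> G" "Z \<noteq> Y" "r ` (B - {b}) \<subseteq> Z" and y: "y \<in> Z \<inter> G" "y \<notin> r ` (B - {b})"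
    and w: "walk \<F> B G bs Z (r(b := y)) Y2 r2"
    by (elim walk_ConsE) blast
  note st = walk_Cons.prems(1)
  have rG: "r ` (B - {b}) \<subseteq> G \<inter> Y" "inj_on r B" "G \<in> \<F>" "Y \<in> \<F>" "G \<noteq> Y"
    using st by (auto simp: state_def)
  have cr: "card (r ` (B - {b})) = d - 2"
    using rG(2) walk_Cons.hyps(1) B by (subst card_image) (auto intro: inj_on_subset)
  have "Y' = Z"
  proof (rule ccontr)
    assume "Y' \<noteq> Z"
    then have c4: "card {G,Y,Y',Z} = 4" using walk_Cons.hyps Z rG by simp
    have "card (r ` (B - {b})) + card {G,Y,Y',Z} \<le> d + 1"
      by (rule spread_mono_card[OF sp fin]) (use c4 walk_Cons.hyps Z rG in auto)
    then show False using c4 cr B by simp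
  qed
  moreover have "x = y"
  proof (rule ccontr)
    assume "x \<noteq> y"
    have c2: "card {G,Y'} = 2" using walk_Cons.hyps by simp
    let ?X = "insert x (insert y (r ` (B - {b})))"
    have "card ?X + card {G,Y'} \<le> d + 1"
      by (rule spread_mono_card[OF sp fin]) (use c2 walk_Cons.hyps Z rG y \<open>Y' = Z\<close> in auto)
    moreover have "card ?X = d"
      using \<open>x \<noteq> y\<close> walk_Cons.hyps y cr B by simp
    ultimately show False using c2 by simp
  qed
  moreover have "state \<F> B G Y' (r(b := x))"
    by (rule walk_step_state[OF st]) (use walk_Cons.hyps in auto)
  ultimately show ?case using walk_Cons.IH w by blast
qed

text \<open>Sizes separate the letters from each other and from the end of the word, and the walk of
  a letter is deterministic. So a marked flag accounts for at most one word.\<close>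

lemma decodes_det:
  assumes sp: "spread d \<F>" and fin: "finite (\<Union>\<F>)" and B: "finite B" "card B + 1 = d" "4 \<le> d"
    and sz: "inj sz" "d \<notin> range sz"
  shows "\<lbrakk>decodes \<F> B d sz bs U ws G Y r; state \<F> B G Y r; decodes \<F> B d sz bs U ws' G Y r\<rbrakk> \<Longrightarrow> ws = ws'"
proof (induction arbitrary: ws' rule: decodes.induct)
  case (dec_Nil G Y r)
  then show ?case using sz(2) by (cases ws') (auto elim!: dec_ConsE)
next
  case (dec_Cons G l Y r Y' r' ws)
  show ?case
  proof (cases ws')
    case Nil then show ?thesis using dec_Cons.prems dec_Cons.hyps sz(2) by (auto elim!: dec_NilE)
  next
    case (Cons l' vs)
    then obtain Z s where d: "card G = sz l'" "walk \<F> B G (bs l') Y r Z s" "decodes \<F> B d sz bs U vs Z G s"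
      using dec_Cons.prems(2) by (auto elim!: dec_ConsE)
    have l: "l' = l" using d(1) dec_Cons.hyps(2) sz(1) by (simp add: inj_eq)
    then have "Y' = Z \<and> r' = s"
      using walk_det[OF sp fin B dec_Cons.hyps(3) dec_Cons.prems(1)] d(2) by simp
    moreover have "state \<F> B Y' G r'"
      using walk_state[OF dec_Cons.hyps(3) dec_Cons.prems(1)] by (rule state_swap)
    ultimately show ?thesis using dec_Cons.IH d(3) l Cons by blast
  qed
qed

lemma walk_image:
  assumes inj: "inj_on \<phi> S" and S: "\<Union>\<F> \<subseteq> S"
  shows "\<lbrakk>walk \<F> B G bs Y r Y' r'; state \<F> B G Y r\<rbrakk> \<Longrightarrow>
    walk ((\<lambda>A. \<phi> ` A) ` \<F>) B (\<phi> ` G) bs (\<phi> ` Y) (\<phi> \<circ> r) (\<phi> ` Y') (\<phi> \<circ> r')"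
proof (induction rule: walk.induct)
  case (walk_Nil Y r) then show ?case by (blast intro: walk.intros)
next
  case (walk_Cons b Y' Y r x bs Y'' r'')
  have sub: "A \<subseteq> S" if "A \<in> \<F>" for A using S that by blast
  have imeq: "\<phi> ` A = \<phi> ` C \<longleftrightarrow> A = C" if "A \<in> \<F>" "C \<in> \<F>" for A C
    using inj_on_image_eq_iff[OF inj] sub that by blast
  have st: "G \<in> \<F>" "Y \<in> \<F>" "r ` B \<subseteq> G" using walk_Cons.prems by (auto simp: state_def)
  have x: "\<phi> x \<notin> (\<phi> \<circ> r) ` (B - {b})"
  proof
    assume "\<phi> x \<in> (\<phi> \<circ> r) ` (B - {b})"
    then obtain c where c: "c \<in> B - {b}" "\<phi> x = \<phi> (r c)" by auto
    moreover have "x \<in> S" "r c \<in> S" using c st sub[OF st(1)] walk_Cons.hyps by auto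
    ultimately have "x = r c" using inj by (meson inj_onD)
    then show False using c walk_Cons.hyps by auto
  qed
  have "state \<F> B G Y' (r(b := x))"
    by (rule walk_step_state[OF walk_Cons.prems]) (use walk_Cons.hyps in auto)
  then have w: "walk ((\<lambda>A. \<phi> ` A) ` \<F>) B (\<phi> ` G) bs (\<phi> ` Y') ((\<phi> \<circ> r)(b := \<phi> x)) (\<phi> ` Y'') (\<phi> \<circ> r'')"
    using walk_Cons.IH unfolding fun_upd_comp by blast
  show ?case
    by (rule walk.walk_Cons[OF _ _ _ _ _ _ x w])
      (use walk_Cons.hyps imeq st in \<open>auto simp: image_comp[symmetric]\<close>)
qed

lemma decodes_image:
  assumes inj: "inj_on \<phi> S" and S: "\<Union>\<F> \<subseteq> S"
  shows "\<lbrakk>decodes \<F> B d sz bs U ws G Y r; state \<F> B G Y r\<rbrakk> \<Longrightarrow>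
    decodes ((\<lambda>A. \<phi> ` A) ` \<F>) B d sz bs (\<phi> ` U) ws (\<phi> ` G) (\<phi> ` Y) (\<phi> \<circ> r)"
proof (induction rule: decodes.induct)
  case (dec_Nil G Y r)
  then have "G \<subseteq> S" using S by (auto simp: state_def)
  then have "card (\<phi> ` G) = card G" using inj by (meson card_image inj_on_subset)
  then show ?case using dec_Nil.hyps by (intro decodes.dec_Nil) auto
next
  case (dec_Cons G l Y r Y' r' ws)
  then have "G \<subseteq> S" using S by (auto simp: state_def)
  then have c: "card (\<phi> ` G) = sz l" using inj dec_Cons.hyps by (metis card_image inj_on_subset)
  have "state \<F> B Y' G r'"
    using walk_state[OF dec_Cons.hyps(3) dec_Cons.prems] by (rule state_swap)
  then have IH: "decodes ((\<lambda>A. \<phi> ` A) ` \<F>) B d sz bs (\<phi> ` U) ws (\<phi> ` Y') (\<phi> ` G) (\<phi> \<circ> r')"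
    using dec_Cons.IH by blast
  show ?case
    by (rule decodes.dec_Cons[OF _ c walk_image[OF inj S dec_Cons.hyps(3) dec_Cons.prems] IH])
      (use dec_Cons.hyps(1) in blast)
qed

text \<open>Intended for \<open>repl\<close>, which enlarges facets except that they may lose z. A
  walk tolerates this: its steps ask only for containments of vertices of G, which avoids z, and for
  distinctness, which injectivity preserves.\<close>

lemma walk_transfer:
  assumes inj: "inj_on \<rho> \<P>" and sup: "\<And>A. A \<in> \<P> \<Longrightarrow> A - {z} \<subseteq> \<rho> A" and mem: "\<And>A. A \<in> \<P> \<Longrightarrow> \<rho> A \<in> \<R>"
    and G: "z \<notin> G" "\<rho> G = G"
  shows "\<lbrakk>walk \<P> B G bs Y r Y' r'; state \<P> B G Y r\<rbrakk> \<Longrightarrow> walk \<R> B G bs (\<rho> Y) r (\<rho> Y') r'"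
proof (induction rule: walk.induct)
  case (walk_Nil Y r) then show ?case by (blast intro: walk.intros)
next
  case (walk_Cons b Y' Y r x bs Y'' r'')
  have st: "G \<in> \<P>" "Y \<in> \<P>" "r ` B \<subseteq> G" using walk_Cons.prems by (auto simp: state_def)
  have ne: "\<rho> Y' \<noteq> G" "\<rho> Y' \<noteq> \<rho> Y"
    using inj st walk_Cons.hyps G(2) by (metis inj_onD)+
  have Y': "Y' - {z} \<subseteq> \<rho> Y'" using sup walk_Cons.hyps by blast
  have "z \<notin> r ` B" using st(3) G(1) by blast
  then have sub: "r ` (B - {b}) \<subseteq> \<rho> Y'" using Y' walk_Cons.hyps(5) by blast
  have x: "x \<in> \<rho> Y' \<inter> G" using Y' walk_Cons.hyps(6) G(1) by blast
  have "state \<P> B G Y' (r(b := x))"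
    by (rule walk_step_state[OF walk_Cons.prems]) (use walk_Cons.hyps in auto)
  then have w: "walk \<R> B G bs (\<rho> Y') (r(b := x)) (\<rho> Y'') r''" using walk_Cons.IH by blast
  show ?case
    by (rule walk.walk_Cons[OF walk_Cons.hyps(1) mem[OF walk_Cons.hyps(2)] ne sub x walk_Cons.hyps(7) w])
qed

lemma decodes_transfer:
  assumes inj: "inj_on \<rho> \<P>" and sup: "\<And>A. A \<in> \<P> \<Longrightarrow> A - {z} \<subseteq> \<rho> A" and mem: "\<And>A. A \<in> \<P> \<Longrightarrow> \<rho> A \<in> \<R>"
    and id: "\<And>A. z \<notin> A \<Longrightarrow> \<rho> A = A" and zU: "z \<notin> U"
  shows "\<lbrakk>decodes \<P> B d sz bs U ws G Y r; state \<P> B G Y r\<rbrakk> \<Longrightarrow> decodes \<R> B d sz bs U ws G (\<rho> Y) r"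
proof (induction rule: decodes.induct)
  case (dec_Nil G Y r) then show ?case by (blast intro: decodes.intros)
next
  case (dec_Cons G l Y r Y' r' ws)
  have zG: "z \<notin> G" "z \<notin> Y'" using dec_Cons.hyps(1) decodes_subset[OF dec_Cons.hyps(4)] zU by auto
  have "walk \<R> B G (bs l) (\<rho> Y) r (\<rho> Y') r'"
    by (rule walk_transfer[OF inj sup mem zG(1) id[OF zG(1)] dec_Cons.hyps(3) dec_Cons.prems])
  moreover have "state \<P> B Y' G r'"
    using walk_state[OF dec_Cons.hyps(3) dec_Cons.prems] by (rule state_swap)
  then have "decodes \<R> B d sz bs U ws Y' G r'" using dec_Cons.IH id[OF zG(1)] by simp
  ultimately show ?case
    using dec_Cons.hyps id[OF zG(2)] by (intro decodes.dec_Cons) auto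
qed

subsection \<open>Gluing polytopes in standard position\<close>

lemma affine_image_polytope:
  fixes L :: "'a::euclidean_space \<Rightarrow> 'a" and c :: 'a
  assumes L: "linear L" "inj L" and P: "polytope P"
  defines "f \<equiv> \<lambda>x. c + L x"
  shows "polytope (f ` P)" "aff_dim (f ` P) = aff_dim P" "verts (f ` P) = f ` verts P"
    "facet_family (f ` P) = (\<lambda>A. f ` A) ` facet_family P" "inj f"
    "\<And>Y. Y facet_of (f ` P) \<longleftrightarrow> (\<exists>X. X facet_of P \<and> Y = f ` X)"
proof -
  have fim: "f ` X = (\<lambda>x. c + x) ` (L ` X)" for X by (auto simp: f_def)
  show inj: "inj f" using L(2) by (auto simp: f_def inj_def)
  show pf: "polytope (f ` P)"
    unfolding fim polytope_def 
    using polytope_linear_image[OF L(1) P] by (metis convex_hull_translation finite_imageI polytope_def)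
  show ad: "aff_dim (f ` P) = aff_dim P"
    unfolding fim by (simp add: aff_dim_translation_eq aff_dim_injective_linear_image L)
  have ad': "aff_dim (f ` X) = aff_dim X" for X
    unfolding fim by (simp add: aff_dim_translation_eq aff_dim_injective_linear_image L)
  have face: "f ` X face_of f ` P \<longleftrightarrow> X face_of P" for X
    unfolding fim by (simp add: face_of_linear_image[OF L])
  have fac: "f ` X facet_of f ` P \<longleftrightarrow> X facet_of P" for X
    unfolding facet_of_def face ad' by simp
  show facet: "Y facet_of (f ` P) \<longleftrightarrow> (\<exists>X. X facet_of P \<and> Y = f ` X)" for Y
  proof
    assume Y: "Y facet_of (f ` P)"
    then have "Y \<subseteq> f ` P" by (rule facet_of_imp_subset)
    then obtain X where "Y = f ` X" by (metis subset_imageE)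
    then show "\<exists>X. X facet_of P \<and> Y = f ` X" using fac Y by blast
  qed (use fac in blast)
  show v: "verts (f ` P) = f ` verts P"
  proof (intro set_eqI iffI)
    fix x assume x: "x \<in> verts (f ` P)"
    then obtain y where "y \<in> P" "x = f y" using verts_subset by blast
    then show "x \<in> f ` verts P"
      using x face[of "{y}"] by (auto simp: verts_def face_of_singleton)
  next
    fix x assume "x \<in> f ` verts P"
    then show "x \<in> verts (f ` P)"
      using face[of "{y}" for y] by (auto simp: verts_def face_of_singleton[symmetric])
  qed
  show "facet_family (f ` P) = (\<lambda>A. f ` A) ` facet_family P"
  proof -
    have "{Y. Y facet_of f ` P} = (\<lambda>X. f ` X) ` {X. X facet_of P}" using facet by auto
    then show ?thesis unfolding facet_family_def v by (simp add: image_image image_Int[OF inj])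
  qed
qed

text \<open>Standard position of a port at 0: the base is spanned by 0 and the unit vectors other
  than b0, the remaining facets at 0 are coordinate hyperplanes, and \<sigma> gives the side. The
  inequalities on \<open>x \<bullet> b\<close> and \<open>x \<bullet> One\<close> cut out exactly
  the base in the hyperplane of b0, which is what makes unions convex.\<close>

definition corner :: "'a::euclidean_space \<Rightarrow> real \<Rightarrow> 'a set \<Rightarrow> bool" where
  "corner b0 \<sigma> P \<longleftrightarrow> polytope P \<and> aff_dim P = int DIM('a) \<and>
     (\<forall>x\<in>P. 0 \<le> \<sigma> * (x \<bullet> b0) \<and> (\<forall>b\<in>Basis - {b0}. 0 \<le> x \<bullet> b) \<and> x \<bullet> One \<le> 1) \<and>
     (\<exists>t. 0 < \<sigma> * t \<and> t *\<^sub>R b0 \<in> P) \<and>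
     convex hull (insert 0 (Basis - {b0})) facet_of P \<and>
     (\<forall>b\<in>Basis - {b0}. P \<inter> {x. x \<bullet> b = 0} facet_of P) \<and>
     (\<forall>Y. Y facet_of P \<and> 0 \<in> Y \<longrightarrow> Y = convex hull (insert 0 (Basis - {b0})) \<or>
        (\<exists>b\<in>Basis - {b0}. Y = P \<inter> {x. x \<bullet> b = 0}))"

text \<open>A facet of P away from 0 leaves Q strictly on its inner side, apart from the shared
  base, and hence survives in the union. The level 1 can be prescribed because the facet avoids
  0.\<close>

definition beneath :: "'a::euclidean_space \<Rightarrow> 'a set \<Rightarrow> 'a set \<Rightarrow> bool" where
  "beneath b0 P Q \<longleftrightarrow> (\<forall>Y. Y facet_of P \<and> 0 \<notin> Y \<longrightarrow>
     (\<exists>c. Y = P \<inter> {x. c \<bullet> x = 1} \<and> (\<forall>x\<in>P. c \<bullet> x \<le> 1) \<and>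
        (\<forall>x\<in>Q - convex hull (insert 0 (Basis - {b0})). c \<bullet> x < 1)))"

locale corner_pair =
  fixes b0 :: "'a::euclidean_space" and \<sigma> :: real and P Q :: "'a set"
  assumes b0: "b0 \<in> Basis" and \<sigma>: "\<sigma> = 1 \<or> \<sigma> = -1"
    and cP: "corner b0 \<sigma> P" and cQ: "corner b0 (-\<sigma>) Q"
    and PQ: "beneath b0 P Q" and QP: "beneath b0 Q P"
begin

abbreviation "\<Delta> \<equiv> convex hull (insert 0 (Basis - {b0}))"

lemma flip: "corner_pair b0 (-\<sigma>) Q P"
  using b0 \<sigma> cP cQ PQ QP by unfold_locales auto

lemma P: "polytope P" "convex P" "aff_dim P = int DIM('a)"
  and Pineq: "x \<in> P \<Longrightarrow> 0 \<le> \<sigma> * (x \<bullet> b0)" "\<lbrakk>x \<in> P; b \<in> Basis - {b0}\<rbrakk> \<Longrightarrow> 0 \<le> x \<bullet> b"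
    "x \<in> P \<Longrightarrow> x \<bullet> One \<le> 1"
  and FP: "\<Delta> facet_of P" "b \<in> Basis - {b0} \<Longrightarrow> P \<inter> {x. x \<bullet> b = 0} facet_of P"
  using cP unfolding corner_def by (auto simp: polytope_imp_convex)

lemma Delta_iff:
  "x \<in> \<Delta> \<longleftrightarrow> x \<bullet> b0 = 0 \<and> (\<forall>b\<in>Basis - {b0}. 0 \<le> x \<bullet> b) \<and> x \<bullet> One \<le> 1"
proof -
  have "x \<bullet> One = x \<bullet> b0 + (\<Sum>i\<in>Basis - {b0}. x \<bullet> i)"
    using b0 by (simp only: inner_sum_right) (simp add: sum.remove)
  moreover have "x \<in> \<Delta> \<longleftrightarrow> (\<forall>i\<in>Basis. 0 \<le> x \<bullet> i) \<and> (\<Sum>i\<in>Basis - {b0}. x \<bullet> i) \<le> 1 \<and>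
      (\<forall>i\<in>Basis. i \<notin> Basis - {b0} \<longrightarrow> x \<bullet> i = 0)"
    by (subst substd_simplex) auto
  ultimately show ?thesis using b0 by auto
qed

lemma P_Delta: "x \<in> P \<Longrightarrow> x \<in> \<Delta> \<longleftrightarrow> x \<bullet> b0 = 0"
  using Delta_iff Pineq by blast

lemma Delta_P: "\<Delta> \<subseteq> P" using FP(1) facet_of_imp_subset by blast

lemma Delta_indep: "\<not> affine_dependent (insert 0 (Basis - {b0}))"
proof -
  have "(0::'a) \<notin> Basis - {b0}" using nonzero_Basis by blast
  then have "affine_dependent (insert 0 (Basis - {b0})) \<longleftrightarrow> dependent ((\<lambda>x. - 0 + x) ` (Basis - {b0}))"
    by (rule affine_dependent_iff_dependent)
  then show ?thesis using independent_mono[OF independent_Basis, of "Basis - {b0}"] by simp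
qed

lemma verts_Delta: "verts \<Delta> = insert 0 (Basis - {b0})"
  unfolding verts_def using extreme_point_of_convex_hull_affine_independent[OF Delta_indep] by blast

lemma verts_P_Delta: "verts P \<inter> \<Delta> = insert 0 (Basis - {b0})"
  using verts_face[of \<Delta> P] FP(1) verts_Delta by (simp add: facet_of_imp_face_of)

text \<open>A segment from P to Q meets the hyperplane of b0 in a point satisfying the inequalities
  common to both, hence in the base. It splits there into a part in P and a part in Q.\<close>

lemma convex_union: "convex (P \<union> Q)"
proof -
  interpret f: corner_pair b0 "-\<sigma>" Q P by (rule flip)
  have main: "closed_segment p q \<subseteq> P \<union> Q" if p: "p \<in> P" and q: "q \<in> Q" for p q
  proof -
    have "\<exists>z\<in>closed_segment p q. z \<in> \<Delta>"
    proof (cases "p \<bullet> b0 = 0")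
      case True then show ?thesis using P_Delta[OF p] by auto
    next
      case False
      define s t where "s = \<bar>p \<bullet> b0\<bar>" and "t = \<bar>q \<bullet> b0\<bar>"
      have s: "s > 0" "t \<ge> 0" and pq: "p \<bullet> b0 = \<sigma> * s" "q \<bullet> b0 = - \<sigma> * t"
        using False Pineq(1)[OF p] f.Pineq(1)[OF q] \<sigma> by (auto simp: s_def t_def)
      \<comment> \<open>The parameter at which the b0-coordinate, running from
        \<open>\<sigma> * s\<close> to \<open>- \<sigma> * t\<close>, vanishes.\<close>
      define u where "u = s / (s + t)"
      have u: "0 \<le> u" "u \<le> 1" using s by (auto simp: u_def)
      let ?z = "(1 - u) *\<^sub>R p + u *\<^sub>R q"
      have "?z \<bullet> b0 = \<sigma> * ((1 - u) * s - u * t)"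
        using pq by (simp add: inner_add_left algebra_simps)
      also have "(1 - u) * s - u * t = 0"
        using s by (simp add: u_def field_simps)
      finally have "?z \<bullet> b0 = 0" by simp
      moreover have "0 \<le> ?z \<bullet> b" if "b \<in> Basis - {b0}" for b
        using Pineq(2)[OF p that] f.Pineq(2)[OF q that] u by (simp add: inner_add_left)
      moreover have "?z \<bullet> One \<le> 1"
        using Pineq(3)[OF p] f.Pineq(3)[OF q] u
          convex_bound_le[of "p \<bullet> One" 1 "q \<bullet> One" "1-u" u] by (simp add: inner_add_left)
      ultimately have "?z \<in> \<Delta>" using Delta_iff by blast
      then show ?thesis using u by (auto simp: closed_segment_def)
    qed
    then obtain z where z: "z \<in> closed_segment p q" "z \<in> P" "z \<in> Q"
      using Delta_P f.Delta_P by blast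
    have "closed_segment p q = closed_segment p z \<union> closed_segment z q"
      using Un_closed_segment[OF z(1)] by simp
    moreover have "closed_segment p z \<subseteq> P" "closed_segment z q \<subseteq> Q"
      using P(2) f.P(2) p q z closed_segment_subset by blast+
    ultimately show ?thesis by blast
  qed
  show ?thesis
    unfolding convex_contains_segment
  proof (intro ballI)
    fix x y assume "x \<in> P \<union> Q" "y \<in> P \<union> Q"
    then consider "x \<in> P" "y \<in> P" | "x \<in> Q" "y \<in> Q" | "x \<in> P" "y \<in> Q" | "x \<in> Q" "y \<in> P" by blast
    then show "closed_segment x y \<subseteq> P \<union> Q"
    proof cases
      case 1 then show ?thesis using P(2) closed_segment_subset by blast
    next
      case 2 then show ?thesis using f.P(2) closed_segment_subset by blast
    next
      case 3 then show ?thesis by (rule main)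
    next
      case 4 then show ?thesis using main[of y x] by (simp add: closed_segment_commute)
    qed
  qed
qed

lemma polytope_union: "polytope (P \<union> Q)"
proof -
  interpret f: corner_pair b0 "-\<sigma>" Q P by (rule flip)
  have "P \<union> Q \<subseteq> convex hull (verts P \<union> verts Q)"
    using convex_hull_verts[OF P(1)] convex_hull_verts[OF f.P(1)]
      hull_mono[of "verts P" "verts P \<union> verts Q" convex] hull_mono[of "verts Q" "verts P \<union> verts Q" convex]
    by auto
  moreover have "convex hull (verts P \<union> verts Q) \<subseteq> P \<union> Q"
    by (rule hull_minimal) (use verts_subset convex_union in blast)+
  ultimately have "P \<union> Q = convex hull (verts P \<union> verts Q)" by blast
  then show ?thesis
    unfolding polytope_def using finite_verts[OF P(1)] finite_verts[OF f.P(1)] by blast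
qed

lemma aff_dim_union: "aff_dim (P \<union> Q) = int DIM('a)"
  using aff_dim_subset[of P "P \<union> Q"] P(3) aff_dim_le_DIM[of "P \<union> Q"] by simp

lemma union_side: "\<lbrakk>x \<in> P \<union> Q; 0 \<le> \<sigma> * (x \<bullet> b0)\<rbrakk> \<Longrightarrow> x \<in> P"
proof -
  interpret f: corner_pair b0 "-\<sigma>" Q P by (rule flip)
  assume "x \<in> P \<union> Q" "0 \<le> \<sigma> * (x \<bullet> b0)"
  then show "x \<in> P"
    using f.Pineq(1)[of x] f.P_Delta[of x] Delta_P \<sigma> by auto
qed

text \<open>The b0-axis enters both pieces, so 0 is interior to a segment that leaves the base on
  both sides. Therefore 0 is no vertex, and the base no face, of the union.\<close>

lemma zero_between: "\<exists>x\<in>P. \<exists>y\<in>Q. 0 \<in> open_segment x y \<and> x \<notin> \<Delta> \<and> y \<notin> \<Delta>"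
proof -
  obtain s where s: "0 < \<sigma> * s" "s *\<^sub>R b0 \<in> P" using cP by (auto simp: corner_def)
  obtain t where t: "0 < - \<sigma> * t" "t *\<^sub>R b0 \<in> Q" using cQ by (auto simp: corner_def)
  have b1: "b0 \<bullet> b0 = 1" using b0 by simp
  have st: "s * t < 0" "s \<noteq> t" "t - s \<noteq> 0" using s(1) t(1) \<sigma> by (auto simp: mult_less_0_iff)
  let ?u = "s / (s - t)"
  have u: "0 < ?u" "?u < 1" using s(1) t(1) \<sigma> by (auto simp: field_simps)
  have "(1 - ?u) * s + ?u * t = 0" using st by (simp add: field_simps)
  then have "0 = (1 - ?u) *\<^sub>R (s *\<^sub>R b0) + ?u *\<^sub>R (t *\<^sub>R b0)"
    by (metis scaleR_left_distrib scaleR_scaleR scaleR_zero_left)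
  moreover have "s *\<^sub>R b0 \<noteq> t *\<^sub>R b0" using st b1 by auto
  ultimately have "0 \<in> open_segment (s *\<^sub>R b0) (t *\<^sub>R b0)"
    using u unfolding in_segment by blast
  moreover have "s *\<^sub>R b0 \<notin> \<Delta>" "t *\<^sub>R b0 \<notin> \<Delta>" using Delta_iff b1 s(1) t(1) by auto
  ultimately show ?thesis using s(2) t(2) by blast
qed

text \<open>Extremality is a local property: a segment through x can be shrunk towards x until it
  lies in P, where x is extreme.\<close>

lemma local_extreme:
  assumes x: "x \<in> verts P" "0 < \<sigma> * (x \<bullet> b0)"
  shows "x \<in> verts (P \<union> Q)"
proof -
  have xP: "x \<in> P" using x verts_subset by blast
  have "x \<notin> open_segment y z" if y: "y \<in> P \<union> Q" and z: "z \<in> P \<union> Q" for y z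
  proof
    assume seg: "x \<in> open_segment y z"
    then obtain u where u: "0 < u" "u < 1" "x = (1 - u) *\<^sub>R y + u *\<^sub>R z" and ne: "y \<noteq> z"
      by (auto simp: in_segment)
    \<comment> \<open>Moving from x by the fraction e towards y or z cannot carry the b0-coordinate
      past 0.\<close>
    define e where "e = \<sigma> * (x \<bullet> b0) / (\<sigma> * (x \<bullet> b0) + \<bar>y \<bullet> b0\<bar> + \<bar>z \<bullet> b0\<bar>)"
    have e: "0 < e" "e \<le> 1" using x(2) by (auto simp: e_def divide_le_eq)
    have em: "e * (\<sigma> * (x \<bullet> b0) + \<bar>y \<bullet> b0\<bar> + \<bar>z \<bullet> b0\<bar>) = \<sigma> * (x \<bullet> b0)"
      using x(2) by (simp add: e_def)
    have pos: "0 \<le> \<sigma> * (((1 - e) *\<^sub>R x + e *\<^sub>R v) \<bullet> b0)" if "v = y \<or> v = z" for v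
    proof -
      have "e * (- (\<sigma> * (v \<bullet> b0))) \<le> e * (\<bar>y \<bullet> b0\<bar> + \<bar>z \<bullet> b0\<bar>)"
        using e \<sigma> that by (intro mult_left_mono) auto
      then show ?thesis using em by (simp add: inner_add_left algebra_simps)
    qed
    have inP: "(1 - e) *\<^sub>R x + e *\<^sub>R v \<in> P" if "v = y \<or> v = z" for v
    proof (rule union_side[OF _ pos[OF that]])
      have "v \<in> P \<union> Q" "x \<in> P \<union> Q" using that y z xP by auto
      then show "(1 - e) *\<^sub>R x + e *\<^sub>R v \<in> P \<union> Q"
        using convexD[OF convex_union, of x v "1 - e" e] e by simp
    qed
    have "x = (1 - u) *\<^sub>R ((1 - e) *\<^sub>R x + e *\<^sub>R y) + u *\<^sub>R ((1 - e) *\<^sub>R x + e *\<^sub>R z)"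
    proof -
      have "(1 - u) *\<^sub>R ((1 - e) *\<^sub>R x + e *\<^sub>R y) + u *\<^sub>R ((1 - e) *\<^sub>R x + e *\<^sub>R z)
          = (1 - e) *\<^sub>R x + e *\<^sub>R ((1 - u) *\<^sub>R y + u *\<^sub>R z)"
        by (simp add: algebra_simps)
      also have "\<dots> = (1 - e) *\<^sub>R x + e *\<^sub>R x" using u(3) by simp
      finally show ?thesis by (simp add: algebra_simps)
    qed
    moreover have "(1 - e) *\<^sub>R x + e *\<^sub>R y \<noteq> (1 - e) *\<^sub>R x + e *\<^sub>R z" using e ne by simp
    ultimately have "x \<in> open_segment ((1 - e) *\<^sub>R x + e *\<^sub>R y) ((1 - e) *\<^sub>R x + e *\<^sub>R z)"
      using u unfolding in_segment by blast
    then show False using x(1) inP unfolding verts_def extreme_point_of_def by blast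
  qed
  then show ?thesis using xP by (auto simp: verts_def extreme_point_of_def)
qed

lemma facet_of_side: assumes "Y facet_of P" "0 \<notin> Y" shows "Y facet_of (P \<union> Q)"
proof -
  obtain c where c: "Y = P \<inter> {x. c \<bullet> x = 1}" "\<forall>x\<in>P. c \<bullet> x \<le> 1" "\<forall>x\<in>Q - \<Delta>. c \<bullet> x < 1"
    using PQ assms unfolding beneath_def by blast
  have "x \<in> P \<union> Q \<Longrightarrow> c \<bullet> x \<le> 1" for x using c(2,3) Delta_P by (meson DiffI UnE less_imp_le subsetD)
  then have "(P \<union> Q) \<inter> {x. c \<bullet> x = 1} face_of (P \<union> Q)"
    using convex_union by (intro face_of_Int_supporting_hyperplane_le) auto
  moreover have "(P \<union> Q) \<inter> {x. c \<bullet> x = 1} = Y"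
  proof (intro set_eqI iffI)
    fix x assume x: "x \<in> (P \<union> Q) \<inter> {x. c \<bullet> x = 1}"
    then have "x \<notin> Q - \<Delta>" using c(3) by force
    then show "x \<in> Y" using x c(1) Delta_P by blast
  qed (use c in blast)
  ultimately show ?thesis using assms P(3) aff_dim_union by (simp add: facet_of_def)
qed

lemma merged_facet: assumes b: "b \<in> Basis - {b0}" shows "(P \<union> Q) \<inter> {x. x \<bullet> b = 0} facet_of (P \<union> Q)"
proof -
  interpret f: corner_pair b0 "-\<sigma>" Q P by (rule flip)
  let ?K = "(P \<union> Q) \<inter> {x. b \<bullet> x = 0}"
  have "x \<in> P \<union> Q \<Longrightarrow> b \<bullet> x \<ge> 0" for x using Pineq(2)[OF _ b] f.Pineq(2)[OF _ b] by (auto simp: inner_commute[of b])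
  then have K: "?K face_of (P \<union> Q)"
    using convex_union by (intro face_of_Int_supporting_hyperplane_ge) auto
  have "b \<in> P" using b Delta_P hull_subset[of "insert 0 (Basis - {b0})" convex] by blast
  moreover have "b \<notin> ?K" using b by simp
  ultimately have "aff_dim ?K < aff_dim (P \<union> Q)"
    using face_of_aff_dim_lt[OF convex_union K] by blast
  moreover have "aff_dim (P \<inter> {x. x \<bullet> b = 0}) \<le> aff_dim ?K"
    by (rule aff_dim_subset) (auto simp: inner_commute)
  moreover have "aff_dim (P \<inter> {x. x \<bullet> b = 0}) = aff_dim P - 1" using FP(2)[OF b] by (simp add: facet_of_def)
  ultimately have "aff_dim ?K = aff_dim (P \<union> Q) - 1" "?K \<noteq> {}"
    using P(3) aff_dim_union FP(2)[OF b] by (auto simp: facet_of_def inner_commute)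
  then show ?thesis using K by (simp add: facet_of_def inner_commute)
qed

lemma facet_eqI:
  assumes "convex S" "Y facet_of S" "Z facet_of S" "A \<subseteq> Y \<inter> Z" "aff_dim A = aff_dim S - 1"
  shows "Y = Z"
proof -
  have I: "Y \<inter> Z face_of S" using assms by (meson face_of_Int facet_of_imp_face_of)
  have d: "aff_dim S - 1 \<le> aff_dim (Y \<inter> Z)" using aff_dim_subset[OF assms(4)] assms(5) by simp
  have "Y \<inter> Z = X" if "X facet_of S" "Y \<inter> Z \<subseteq> X" for X
  proof (rule ccontr)
    assume "Y \<inter> Z \<noteq> X"
    moreover have "Y \<inter> Z face_of X" using I that by (meson face_of_subset facet_of_imp_subset)
    moreover have "convex X" using that by (meson face_of_imp_convex facet_of_imp_face_of)
    ultimately have "aff_dim (Y \<inter> Z) < aff_dim X" using face_of_aff_dim_lt by blast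
    then show False using d that by (simp add: facet_of_def)
  qed
  then show ?thesis using assms(2,3) by (metis inf_le1 inf_le2)
qed

text \<open>The points strictly on the P side form a relatively open part of Z, so
  \<open>Z \<inter> P\<close> has the dimension of a facet of P. If it avoids 0, it is already a
  facet of the union; otherwise it is a coordinate facet, as it leaves the base, and Z is the merged
  facet containing it.\<close>

lemma facet_meets_side:
  assumes Z: "Z facet_of (P \<union> Q)" and x: "x \<in> Z" "0 < \<sigma> * (x \<bullet> b0)"
  shows "(Z facet_of P \<and> 0 \<notin> Z) \<or> (\<exists>b\<in>Basis - {b0}. Z = (P \<union> Q) \<inter> {x. x \<bullet> b = 0})"
proof -
  have cZ: "convex Z" using Z by (meson face_of_imp_convex facet_of_imp_face_of)
  have ZR: "Z \<subseteq> P \<union> Q" using Z by (rule facet_of_imp_subset)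
  let ?U = "{x. 0 < \<sigma> * (x \<bullet> b0)}"
  have "open ?U" by (intro open_Collect_less continuous_intros)
  then have "aff_dim (Z \<inter> ?U) = aff_dim Z"
    using x cZ by (intro aff_dim_convex_Int_open) auto
  then have dU: "aff_dim (Z \<inter> ?U) = int DIM('a) - 1"
    using Z aff_dim_union by (simp add: facet_of_def)
  have ZU: "Z \<inter> ?U \<subseteq> Z \<inter> P" using ZR union_side less_imp_le by blast
  have face: "Z \<inter> P face_of P"
    using face_of_slice[OF facet_of_imp_face_of[OF Z] P(2)] by (simp add: Int_absorb1)
  have le: "aff_dim (Z \<inter> P) \<le> int DIM('a) - 1"
    using aff_dim_subset[of "Z \<inter> P" Z] Z aff_dim_union by (simp add: facet_of_def)
  have dZ: "aff_dim (Z \<inter> P) = int DIM('a) - 1" using le aff_dim_subset[OF ZU] dU by linarith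
  have Y: "Z \<inter> P facet_of P"
    using face dZ P(3) x ZU by (auto simp: facet_of_def)
  show ?thesis
  proof (cases "0 \<in> Z \<inter> P")
    case False
    then have "Z \<inter> P facet_of P \<union> Q" using facet_of_side Y by blast
    then have "Z \<inter> P = Z"
      by (rule facet_eqI[OF convex_union _ Z]) (use dZ aff_dim_union in auto)
    moreover have "0 \<in> P" using Delta_P hull_subset[of "insert 0 (Basis - {b0})" convex] by blast
    ultimately show ?thesis using False Y by auto
  next
    case True
    moreover have "x \<in> P" "x \<notin> \<Delta>" using x ZU Delta_iff by auto
    ultimately obtain b where b: "b \<in> Basis - {b0}" "Z \<inter> P = P \<inter> {x. x \<bullet> b = 0}"
      using cP Y x(1) unfolding corner_def by blast
    have "Z = (P \<union> Q) \<inter> {x. x \<bullet> b = 0}"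
      by (rule facet_eqI[OF convex_union Z merged_facet[OF b(1)], of "Z \<inter> P"])
        (use b dZ aff_dim_union in auto)
    then show ?thesis using b(1) by blast
  qed
qed

text \<open>A facet inside the hyperplane of b0 would be the whole base, which is impossible since 0
  is interior to a segment leaving the base. Every other facet has a point strictly on one
  side.\<close>

lemma facets_union:
  "Z facet_of (P \<union> Q) \<longleftrightarrow> (Z facet_of P \<and> 0 \<notin> Z) \<or> (Z facet_of Q \<and> 0 \<notin> Z) \<or>
     (\<exists>b\<in>Basis - {b0}. Z = (P \<union> Q) \<inter> {x. x \<bullet> b = 0})"
proof -
  interpret f: corner_pair b0 "-\<sigma>" Q P by (rule flip)
  have "\<not> Z \<subseteq> {x. x \<bullet> b0 = 0}" if Z: "Z facet_of (P \<union> Q)"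
  proof
    assume sub: "Z \<subseteq> {x. x \<bullet> b0 = 0}"
    have ZR: "Z \<subseteq> P \<union> Q" using Z by (rule facet_of_imp_subset)
    have "Z \<subseteq> \<Delta>" using sub ZR P_Delta f.P_Delta by blast
    moreover then have "Z face_of \<Delta>"
      using Z Delta_P by (meson face_of_subset facet_of_imp_face_of le_supI1)
    moreover have "aff_dim Z = aff_dim \<Delta>"
      using Z FP(1) P(3) aff_dim_union by (simp add: facet_of_def)
    ultimately have "Z = \<Delta>" using face_of_aff_dim_lt[of \<Delta> Z] by fastforce
    then have "0 \<in> Z" using hull_subset[of "insert 0 (Basis - {b0})" convex] by blast
    moreover obtain x y where "x \<in> P" "y \<in> Q" "0 \<in> open_segment x y" "x \<notin> \<Delta>"
      using zero_between by blast
    ultimately show False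
      using Z \<open>Z = \<Delta>\<close> unfolding facet_of_def face_of_def by blast
  qed
  then have "\<exists>x\<in>Z. 0 < \<sigma> * (x \<bullet> b0) \<or> 0 < - \<sigma> * (x \<bullet> b0)" if "Z facet_of (P \<union> Q)"
    using that \<sigma> by (smt (verit) mem_Collect_eq mult_minus_left subsetI mult_cancel_right1)
  then show ?thesis
    using facet_meets_side f.facet_meets_side facet_of_side f.facet_of_side merged_facet
    by (metis Un_commute)
qed

text \<open>The delicate vertices are the shared unit vectors. Strictness puts the face
  \<open>One \<bullet> x = 1\<close> of the union inside Q, where they are vertices; a vertex of a
  face is a vertex of the whole.\<close>

lemma verts_union:
  assumes strict: "\<forall>x\<in>P - \<Delta>. x \<bullet> One < 1"
  shows "verts (P \<union> Q) = verts P \<union> verts Q - {0}"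
proof -
  interpret f: corner_pair b0 "-\<sigma>" Q P by (rule flip)
  have sub: "x \<in> verts S" if "x \<in> verts (P \<union> Q)" "x \<in> S" "S \<subseteq> P \<union> Q" for x S
    using that by (auto simp: verts_def extreme_point_of_def)
  have z: "0 \<notin> verts (P \<union> Q)"
    using zero_between unfolding verts_def extreme_point_of_def by blast
  have B: "b \<in> verts (P \<union> Q)" if b: "b \<in> Basis - {b0}" for b
  proof -
    have "x \<in> P \<union> Q \<Longrightarrow> One \<bullet> x \<le> 1" for x using Pineq(3) f.Pineq(3) by (auto simp: inner_commute)
    then have face: "(P \<union> Q) \<inter> {x. One \<bullet> x = 1} face_of (P \<union> Q)"
      using convex_union by (intro face_of_Int_supporting_hyperplane_le) auto
    have inQ: "(P \<union> Q) \<inter> {x. One \<bullet> x = 1} \<subseteq> Q"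
    proof
      fix x assume x: "x \<in> (P \<union> Q) \<inter> {x. One \<bullet> x = 1}"
      then have "x \<bullet> One = 1" by (simp only: inner_commute) simp
      then have "x \<notin> P - \<Delta>" using strict by force
      then show "x \<in> Q" using x f.Delta_P by blast
    qed
    have "b \<in> verts Q" using b f.verts_P_Delta by blast
    then have "b \<in> verts ((P \<union> Q) \<inter> {x. One \<bullet> x = 1})"
      using inQ b verts_subset[of Q] unfolding verts_def extreme_point_of_def by auto
    then show ?thesis using face by (simp add: verts_face)
  qed
  have side: "x \<in> verts (P \<union> Q)" if "x \<in> verts P" "x \<noteq> 0" for x
  proof (cases "x \<bullet> b0 = 0")
    case True
    then have "x \<in> verts P \<inter> \<Delta>" using that P_Delta verts_subset by blast
    then show ?thesis using verts_P_Delta that B by blast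
  next
    case False
    then have "0 < \<sigma> * (x \<bullet> b0)" using Pineq(1)[of x] that verts_subset[of P] \<sigma> by force
    then show ?thesis using local_extreme that by blast
  qed
  have side': "x \<in> verts (P \<union> Q)" if "x \<in> verts Q" "x \<noteq> 0" for x
  proof (cases "x \<bullet> b0 = 0")
    case True
    then have "x \<in> verts Q \<inter> \<Delta>" using that f.P_Delta verts_subset by blast
    then show ?thesis using f.verts_P_Delta that B by blast
  next
    case False
    then have "0 < - \<sigma> * (x \<bullet> b0)" using f.Pineq(1)[of x] that verts_subset[of Q] \<sigma> by force
    then show ?thesis using f.local_extreme that by (simp add: Un_commute)
  qed
  show ?thesis using sub[of _ P] sub[of _ Q] z side side' verts_subset[of "P \<union> Q"] by blast
qed

theorem facet_family_union:
  assumes strict: "\<forall>x\<in>P - \<Delta>. x \<bullet> One < 1"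
  shows "facet_family (P \<union> Q) = glued (facet_family P) (facet_family Q) 0 (Basis - {b0})
     (\<lambda>b. verts P \<inter> {x. x \<bullet> b = 0}) (\<lambda>b. verts Q \<inter> {x. x \<bullet> b = 0})"
proof -
  interpret f: corner_pair b0 "-\<sigma>" Q P by (rule flip)
  have v0: "0 \<in> verts P" "0 \<in> verts Q" using verts_P_Delta f.verts_P_Delta by auto
  have vP: "verts (P \<union> Q) \<inter> Y = verts P \<inter> Y" if "Y facet_of P" "0 \<notin> Y" for Y
    using verts_face[of Y P] verts_face[of Y "P \<union> Q"] that facet_of_side[OF that]
    by (simp add: facet_of_imp_face_of)
  have vQ: "verts (P \<union> Q) \<inter> Y = verts Q \<inter> Y" if "Y facet_of Q" "0 \<notin> Y" for Y
    using verts_face[of Y Q] verts_face[of Y "P \<union> Q"] that f.facet_of_side[OF that]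
    by (simp add: facet_of_imp_face_of Un_commute)
  have vK: "verts (P \<union> Q) \<inter> ((P \<union> Q) \<inter> {x. x \<bullet> b = 0}) =
      (verts P \<inter> {x. x \<bullet> b = 0} \<union> verts Q \<inter> {x. x \<bullet> b = 0}) - {0}" for b
    unfolding verts_union[OF strict] using verts_subset[of P] verts_subset[of Q] by blast
  have "{Y. Y facet_of (P \<union> Q)} = {Y. Y facet_of P \<and> 0 \<notin> Y} \<union> {Y. Y facet_of Q \<and> 0 \<notin> Y} \<union>
      (\<lambda>b. (P \<union> Q) \<inter> {x. x \<bullet> b = 0}) ` (Basis - {b0})"
    using facets_union by blast
  then have "facet_family (P \<union> Q) = (\<lambda>Y. verts P \<inter> Y) ` {Y. Y facet_of P \<and> 0 \<notin> Y} \<union>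
     (\<lambda>Y. verts Q \<inter> Y) ` {Y. Y facet_of Q \<and> 0 \<notin> Y} \<union>
      (\<lambda>b. (verts P \<inter> {x. x \<bullet> b = 0} \<union> verts Q \<inter> {x. x \<bullet> b = 0}) - {0}) ` (Basis - {b0})"
    unfolding facet_family_def by (simp add: image_Un image_image vK vP vQ cong: image_cong_simp)
  also have "(\<lambda>Y. verts P \<inter> Y) ` {Y. Y facet_of P \<and> 0 \<notin> Y} = {A \<in> facet_family P. 0 \<notin> A}"
    unfolding facet_family_def using v0 by auto
  also have "(\<lambda>Y. verts Q \<inter> Y) ` {Y. Y facet_of Q \<and> 0 \<notin> Y} = {A \<in> facet_family Q. 0 \<notin> A}"
    unfolding facet_family_def using v0 by auto
  finally show ?thesis unfolding glued_def .
qed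

end

subsection \<open>Gadgets and chains\<close>

lemma spread_image:
  assumes inj: "inj_on f S" and sub: "\<Union>\<F> \<subseteq> S" and sp: "spread d \<F>"
  shows "spread d ((\<lambda>A. f ` A) ` \<F>)"
  unfolding spread_def
proof (intro allI impI, elim conjE)
  fix \<G> assume \<G>: "\<G> \<subseteq> (\<lambda>A. f ` A) ` \<F>" "2 \<le> card \<G>" "card \<G> \<le> 4"
  obtain \<H> where H: "\<H> \<subseteq> \<F>" "\<G> = (\<lambda>A. f ` A) ` \<H>" "inj_on (\<lambda>A. f ` A) \<H>"
    using \<G>(1) unfolding subset_image_inj by blast
  then have c: "card \<G> = card \<H>" by (simp add: card_image)
  then obtain A where A: "A \<in> \<H>" using \<G>(2) by fastforce
  have "\<forall>A\<in>\<H>. A \<subseteq> S" using H(1) sub by blast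
  then have "\<Inter>\<G> = f ` (\<Inter>\<H>)"
    unfolding H(2) using image_INT[OF inj _ A, of "\<lambda>A. A"] by simp
  moreover have "\<Inter>\<H> \<subseteq> S" using A H(1) sub by blast
  ultimately have "card (\<Inter>\<G>) = card (\<Inter>\<H>)" using inj by (metis card_image inj_on_subset)
  then show "card (\<Inter>\<G>) + card \<G> \<le> d + 1" using spreadD[OF sp H(1)] \<G> c by simp
qed

lemma port_image:
  assumes inj: "inj_on f S" and sub: "\<Union>\<F> \<subseteq> S" and w: "w \<in> S" and p: "port \<F> B v w a H"
  shows "port ((\<lambda>A. f ` A) ` \<F>) B (f v) (f w) (f \<circ> a) (\<lambda>b. f ` H b)"
proof -
  have p': "v \<notin> a ` B" "inj_on a B" "w \<notin> insert v (a ` B)" "insert v (a ` B) \<in> \<F>"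
    "\<And>b. b \<in> B \<Longrightarrow> H b \<in> \<F> \<and> v \<in> H b \<and> w \<in> H b \<and> a ` (B - {b}) \<subseteq> H b \<and> a b \<notin> H b"
    "\<And>A. \<lbrakk>A \<in> \<F>; v \<in> A\<rbrakk> \<Longrightarrow> A = insert v (a ` B) \<or> A \<in> H ` B"
    using p unfolding port_def by simp_all
  have im: "(f \<circ> a) ` X = f ` (a ` X)" for X by (rule image_comp[symmetric])
  have aS: "insert v (a ` B) \<subseteq> S" using p'(4) sub by blast
  then have vS: "v \<in> S" and bS: "\<And>b. b \<in> B \<Longrightarrow> a b \<in> S" by auto
  have mem: "f x \<in> f ` A \<longleftrightarrow> x \<in> A" if "x \<in> S" "A \<subseteq> S" for x A
    by (rule inj_on_image_mem_iff[OF inj that])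
  have AS: "A \<subseteq> S" if "A \<in> \<F>" for A using that sub by blast
  show ?thesis
    unfolding port_def
  proof (intro conjI ballI impI)
    show "f v \<notin> (f \<circ> a) ` B" unfolding im using mem[OF vS, of "a ` B"] p'(1) aS by simp
    show "inj_on (f \<circ> a) B" using p'(2) aS inj by (intro comp_inj_on) (auto intro: inj_on_subset)
    have F: "insert (f v) ((f \<circ> a) ` B) = f ` insert v (a ` B)" unfolding im by simp
    show "f w \<notin> insert (f v) ((f \<circ> a) ` B)" unfolding F using mem[OF w aS] p'(3) by simp
    show "insert (f v) ((f \<circ> a) ` B) \<in> (\<lambda>A. f ` A) ` \<F>" unfolding F by (rule imageI[OF p'(4)])
  next
    fix b assume b: "b \<in> B"
    note H = p'(5)[OF b]
    then have HS: "H b \<subseteq> S" using AS by blast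
    show "f ` H b \<in> (\<lambda>A. f ` A) ` \<F>" using H by blast
    show "f v \<in> f ` H b" "f w \<in> f ` H b" using H by blast+
    show "(f \<circ> a) ` (B - {b}) \<subseteq> f ` H b" unfolding im using H by blast
    show "(f \<circ> a) b \<notin> f ` H b" using mem[OF bS[OF b] HS] H by simp
  next
    fix A assume "A \<in> (\<lambda>A. f ` A) ` \<F>" "f v \<in> A"
    then obtain C where C: "C \<in> \<F>" "A = f ` C" by blast
    have "v \<in> C" using \<open>f v \<in> A\<close> mem[OF vS AS[OF C(1)]] C(2) by simp
    then have "C = insert v (a ` B) \<or> C \<in> H ` B" by (rule p'(6)[OF C(1)])
    then show "A = insert (f v) ((f \<circ> a) ` B) \<or> A \<in> (\<lambda>b. f ` H b) ` B"
      unfolding C(2) im by blast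
  qed
qed

lemma port_cong:
  assumes p: "port \<F> B v w a H" and a': "\<And>b. b \<in> B \<Longrightarrow> a' b = a b" and H': "\<And>b. b \<in> B \<Longrightarrow> H' b = H b"
  shows "port \<F> B v w a' H'"
proof -
  have "a' ` B = a ` B" "H' ` B = H ` B" using a' H' by (simp_all cong: image_cong_simp)
  moreover have "a' ` (B - {b}) = a ` (B - {b})" for b using a' by (simp cong: image_cong_simp)
  moreover have "inj_on a' B \<longleftrightarrow> inj_on a B" by (rule inj_on_cong) (rule a')
  ultimately show ?thesis using p a' H' unfolding port_def by simp
qed

lemma state_image:
  assumes inj: "inj_on f S" and sub: "\<Union>\<F> \<subseteq> S" and s: "state \<F> B G Y r"
  shows "state ((\<lambda>A. f ` A) ` \<F>) B (f ` G) (f ` Y) (f \<circ> r)"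
proof -
  have s': "G \<in> \<F>" "Y \<in> \<F>" "G \<noteq> Y" "inj_on r B" "r ` B \<subseteq> G" "r ` B \<subseteq> Y" using s by (auto simp: state_def)
  have GY: "G \<subseteq> S" "Y \<subseteq> S" using s' sub by auto
  then have "f ` G \<noteq> f ` Y" using inj_on_image_eq_iff[OF inj] s'(3) by blast
  moreover have "inj_on (f \<circ> r) B"
    by (rule comp_inj_on[OF s'(4)]) (rule inj_on_subset[OF inj], use s'(5) GY(1) in blast)
  moreover have "(f \<circ> r) ` B \<subseteq> f ` G \<inter> f ` Y" using s'(5,6) by auto
  ultimately show ?thesis using s'(1,2) by (auto simp: state_def)
qed

lemma state_cong:
  assumes s: "state \<F> B G Y r" and r: "\<And>b. b \<in> B \<Longrightarrow> r' b = r b" shows "state \<F> B G Y r'"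
proof -
  have "r' ` B = r ` B" using r by (simp cong: image_cong_simp)
  moreover have "inj_on r' B \<longleftrightarrow> inj_on r B" by (rule inj_on_cong) (rule r)
  ultimately show ?thesis using s by (simp add: state_def)
qed

lemma inner_eq_single:
  fixes c :: "'a::euclidean_space"
  assumes "i \<in> Basis" "\<And>j. j \<in> Basis - {i} \<Longrightarrow> c \<bullet> j = 0"
  shows "c \<bullet> x = (c \<bullet> i) * (x \<bullet> i)"
proof -
  have "c \<bullet> x = (\<Sum>j\<in>Basis. (c \<bullet> j) * (x \<bullet> j))" by (rule euclidean_inner)
  also have "\<dots> = (c \<bullet> i) * (x \<bullet> i) + (\<Sum>j\<in>Basis - {i}. (c \<bullet> j) * (x \<bullet> j))"
    using assms(1) by (simp add: sum.remove)
  finally show ?thesis using assms(2) by simp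
qed

text \<open>A functional supporting P along a facet through 0 vanishes on the vertices of that
  facet. At a port these span all coordinate directions but one, so the functional is a multiple of
  a coordinate. Incidences thus force standard position, except for the bound on
  \<open>x \<bullet> One\<close>.\<close>

lemma port_corner:
  fixes P :: "'a::euclidean_space set"
  assumes b0: "b0 \<in> Basis" "Basis - {b0} \<noteq> {}" and P: "polytope P" "aff_dim P = int DIM('a)"
    and port: "port (facet_family P) (Basis - {b0}) 0 (t *\<^sub>R b0) id H" and \<sigma>: "0 < \<sigma> * t"
  shows "x \<in> P \<Longrightarrow> 0 \<le> \<sigma> * (x \<bullet> b0)" "\<lbrakk>x \<in> P; b \<in> Basis - {b0}\<rbrakk> \<Longrightarrow> 0 \<le> x \<bullet> b"
    "P \<inter> {x. x \<bullet> b0 = 0} = convex hull (insert 0 (Basis - {b0}))"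
    "b \<in> Basis - {b0} \<Longrightarrow> H b = verts P \<inter> {x. x \<bullet> b = 0}"
    "(\<forall>x\<in>P. x \<bullet> One \<le> 1) \<Longrightarrow> corner b0 \<sigma> P"
    "\<lbrakk>Y facet_of P; 0 \<notin> Y\<rbrakk> \<Longrightarrow> \<exists>c. Y = P \<inter> {x. c \<bullet> x = 1} \<and> (\<forall>x\<in>P. c \<bullet> x \<le> 1)"
proof -
  let ?B = "Basis - {b0}" and ?D = "convex hull (insert 0 (Basis - {b0}))"
  have ph: "polyhedron P" using P(1) by (rule polytope_imp_polyhedron)
  have mem: "A \<in> facet_family P \<Longrightarrow> \<exists>Y. Y facet_of P \<and> A = verts P \<inter> Y" for A
    by (auto simp: facet_family_def)
  have vP: "A \<in> facet_family P \<Longrightarrow> A \<subseteq> P" for A using facet_family_subset verts_subset by blast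
  have F: "insert 0 ?B \<in> facet_family P" using port by (auto simp: port_def)
  have t0: "t *\<^sub>R b0 \<notin> insert 0 ?B" using port by (simp add: port_def)
  have b00: "b0 \<bullet> b0 = 1" "t \<noteq> 0" using b0(1) \<sigma> by auto
  have inP: "0 \<in> P" "\<And>b. b \<in> ?B \<Longrightarrow> b \<in> P" using vP[OF F] by auto
  have H: "H b \<in> facet_family P" "0 \<in> H b" "t *\<^sub>R b0 \<in> H b" "?B - {b} \<subseteq> H b" "b \<notin> H b"
    if "b \<in> ?B" for b using port that by (auto simp: port_def)
  have F2: "?D facet_of P"
    using mem[OF F] face_eq_hull[OF P(1)] facet_of_imp_face_of by metis
  have vD: "verts P \<inter> ?D = insert 0 ?B"
  proof -
    obtain Y where "Y facet_of P" "insert 0 ?B = verts P \<inter> Y" using mem[OF F] by blast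
    then show ?thesis using face_eq_hull[OF P(1), of Y] facet_of_imp_face_of by metis
  qed
  obtain w where w: "w \<in> P" "w \<noteq> 0" "w = t *\<^sub>R b0" "w \<notin> ?D"
  proof -
    have "t *\<^sub>R b0 \<in> verts P"
    proof -
      obtain b where "b \<in> ?B" using b0(2) by blast
      then show ?thesis using H facet_family_subset by blast
    qed
    moreover have "t *\<^sub>R b0 \<notin> ?D" using vD t0 calculation by blast
    ultimately show ?thesis using that[of "t *\<^sub>R b0"] verts_subset[of P] b00 by force
  qed
  show bottom: "x \<in> P \<Longrightarrow> 0 \<le> \<sigma> * (x \<bullet> b0)" "P \<inter> {x. x \<bullet> b0 = 0} = ?D" for x
  proof -
    obtain c \<beta> where c: "P \<subseteq> {x. c \<bullet> x \<le> \<beta>}" "?D = P \<inter> {x. c \<bullet> x = \<beta>}"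
      using facet_of_polyhedron[OF ph F2] by metis
    have z: "0 \<in> ?D" and bD: "\<And>b. b \<in> ?B \<Longrightarrow> b \<in> ?D" by (auto intro: hull_inc)
    have "\<beta> = 0" using z c(2) by auto
    moreover have "c \<bullet> b = 0" if "b \<in> ?B" for b using bD[OF that] c(2) \<open>\<beta> = 0\<close> by blast
    ultimately have cx: "c \<bullet> x = (c \<bullet> b0) * (x \<bullet> b0)" for x by (intro inner_eq_single[OF b0(1)])
    have "c \<bullet> w \<noteq> 0" using w(1,4) \<open>\<beta> = 0\<close> unfolding c(2) by blast
    moreover have "c \<bullet> w \<le> 0" using w(1) c(1) \<open>\<beta> = 0\<close> by blast
    ultimately have "c \<bullet> w < 0" by simp
    then have neg: "(c \<bullet> b0) * t < 0" using w(3) by (simp add: mult.commute)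
    show "0 \<le> \<sigma> * (x \<bullet> b0)" if "x \<in> P"
    proof -
      have "(c \<bullet> b0) * (x \<bullet> b0) \<le> 0" using c(1) that cx[of x] \<open>\<beta> = 0\<close> by auto
      moreover have "0 < \<sigma> \<and> 0 < t \<or> \<sigma> < 0 \<and> t < 0" using \<sigma> by (simp add: zero_less_mult_iff)
      ultimately show ?thesis
        using neg by (elim disjE) (auto simp: mult_le_0_iff mult_less_0_iff zero_le_mult_iff)
    qed
    show "P \<inter> {x. x \<bullet> b0 = 0} = ?D" unfolding c(2)
    proof -
      have "c \<bullet> b0 \<noteq> 0" using neg by auto
      then have "c \<bullet> x = 0 \<longleftrightarrow> x \<bullet> b0 = 0" for x using cx[of x] by simp
      then show "P \<inter> {x. x \<bullet> b0 = 0} = P \<inter> {x. c \<bullet> x = \<beta>}" using \<open>\<beta> = 0\<close> by simp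
    qed
  qed
  have side: "(\<forall>x\<in>P. 0 \<le> x \<bullet> b) \<and> H b = verts P \<inter> {x. x \<bullet> b = 0} \<and> P \<inter> {x. x \<bullet> b = 0} facet_of P"
    if b: "b \<in> ?B" for b
  proof -
    obtain Y where Y: "Y facet_of P" "H b = verts P \<inter> Y" using mem[OF H(1)[OF b]] by blast
    obtain c \<beta> where c: "P \<subseteq> {x. c \<bullet> x \<le> \<beta>}" "Y = P \<inter> {x. c \<bullet> x = \<beta>}"
      using facet_of_polyhedron[OF ph Y(1)] by metis
    have HY: "H b \<subseteq> Y" using Y by blast
    have "\<beta> = 0" using H(2)[OF b] HY c(2) by auto
    have "c \<bullet> (t *\<^sub>R b0) = 0" using H(3)[OF b] HY c(2) \<open>\<beta> = 0\<close> by blast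
    then have "c \<bullet> b0 = 0" using b00 by simp
    moreover have "c \<bullet> b' = 0" if "b' \<in> ?B - {b}" for b' using H(4)[OF b] that HY c(2) \<open>\<beta> = 0\<close> by blast
    ultimately have cx: "c \<bullet> x = (c \<bullet> b) * (x \<bullet> b)" for x using b by (intro inner_eq_single) auto
    have "b \<in> verts P" using b vD by blast
    then have "b \<notin> Y" using H(5)[OF b] Y(2) by blast
    then have "c \<bullet> b \<noteq> 0" using inP(2)[OF b] \<open>\<beta> = 0\<close> unfolding c(2) by blast
    moreover have "c \<bullet> b \<le> 0" using inP(2)[OF b] c(1) \<open>\<beta> = 0\<close> by blast
    ultimately have neg: "c \<bullet> b < 0" by simp
    then have "c \<bullet> x = 0 \<longleftrightarrow> x \<bullet> b = 0" for x using cx[of x] by simp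
    then have "Y = P \<inter> {x. x \<bullet> b = 0}" unfolding c(2) using \<open>\<beta> = 0\<close> by simp
    moreover have "0 \<le> x \<bullet> b" if "x \<in> P" for x
    proof -
      have "(c \<bullet> b) * (x \<bullet> b) \<le> 0" using c(1) that cx[of x] \<open>\<beta> = 0\<close> by auto
      then show ?thesis using neg by (simp add: mult_le_0_iff)
    qed
    ultimately show ?thesis using Y verts_subset by blast
  qed
  then show "\<lbrakk>x \<in> P; b \<in> Basis - {b0}\<rbrakk> \<Longrightarrow> 0 \<le> x \<bullet> b" 
    and Hb: "b \<in> Basis - {b0} \<Longrightarrow> H b = verts P \<inter> {x. x \<bullet> b = 0}" for x b by blast+
  show "\<exists>c. Y = P \<inter> {x. c \<bullet> x = 1} \<and> (\<forall>x\<in>P. c \<bullet> x \<le> 1)" if Y: "Y facet_of P" "0 \<notin> Y"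
  proof -
    obtain c \<beta> where c: "P \<subseteq> {x. c \<bullet> x \<le> \<beta>}" "Y = P \<inter> {x. c \<bullet> x = \<beta>}"
      using facet_of_polyhedron[OF ph Y(1)] by metis
    have "0 \<le> \<beta>" "\<beta> \<noteq> 0" using c Y(2) inP(1) by auto
    then have "\<beta> > 0" by simp
    then have "Y = P \<inter> {x. (c /\<^sub>R \<beta>) \<bullet> x = 1}" "\<forall>x\<in>P. (c /\<^sub>R \<beta>) \<bullet> x \<le> 1"
      using c by (auto simp: field_simps)
    then show ?thesis by blast
  qed
  assume One: "\<forall>x\<in>P. x \<bullet> One \<le> 1"
  have through: "Y = ?D \<or> (\<exists>b\<in>?B. Y = P \<inter> {x. x \<bullet> b = 0})" if Y: "Y facet_of P" "0 \<in> Y" for Y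
  proof -
    have "verts P \<inter> Y \<in> facet_family P" using Y by (auto simp: facet_family_def)
    moreover have "0 \<in> verts P \<inter> Y" using Y vD by blast
    ultimately have "verts P \<inter> Y = insert 0 ?B \<or> verts P \<inter> Y \<in> H ` ?B"
      using port by (auto simp: port_def)
    then show ?thesis
    proof
      assume "verts P \<inter> Y = insert 0 ?B"
      then show ?thesis using face_eq_hull[OF P(1)] Y facet_of_imp_face_of by metis
    next
      assume "verts P \<inter> Y \<in> H ` ?B"
      then obtain b where b: "b \<in> ?B" "verts P \<inter> Y = H b" by blast
      then have "verts P \<inter> Y = verts P \<inter> (P \<inter> {x. x \<bullet> b = 0})" using Hb verts_subset by blast
      then have "Y = P \<inter> {x. x \<bullet> b = 0}"
        using inj_onD[OF inj_on_facets[OF P(1)]] Y side[OF b(1)] by blast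
      then show ?thesis using b by blast
    qed
  qed
  show "corner b0 \<sigma> P"
    unfolding corner_def using P bottom(1) side One F2 through w \<sigma> by blast
qed

text \<open>A polytope with low facets fits on every polytope below it that is stretched enough in
  the direction \<open>b0\<close>.\<close>

definition low_facets :: "'a::euclidean_space \<Rightarrow> 'a set \<Rightarrow> bool" where
  "low_facets b0 Q \<longleftrightarrow> (\<forall>Y. Y facet_of Q \<and> 0 \<notin> Y \<longrightarrow> (\<exists>c. Y = Q \<inter> {x. c \<bullet> x = 1} \<and> (\<forall>x\<in>Q. c \<bullet> x \<le> 1) \<and>
        (\<forall>x. x \<bullet> b0 < 0 \<and> (\<forall>b\<in>Basis - {b0}. 0 \<le> x \<bullet> b) \<and> x \<bullet> One < 1 \<longrightarrow> c \<bullet> x < 1)))"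

text \<open>Here z with B is the lower port, u with c the upper one, and G the lateral facet meeting
  both simplices. The walk has to arrive with every b labelled by itself, so that reading continues
  below with the right labels.\<close>

definition traversable :: "'v set set \<Rightarrow> 'v set \<Rightarrow> 'v \<Rightarrow> nat \<Rightarrow> 'v list \<Rightarrow> bool" where
  "traversable \<F> B z k bs \<longleftrightarrow> (\<exists>u w c H G. port \<F> B u w c H \<and> u \<notin> insert z B \<and> w \<noteq> z \<and>
        z \<notin> c ` B \<and> G \<in> \<F> \<and> z \<notin> G \<and> u \<notin> G \<and> card G = k \<and> B \<subseteq> G \<and>
        state \<F> B G (insert u (c ` B)) c \<and> (\<exists>r. walk \<F> B G bs (insert u (c ` B)) c (insert z B) r \<and> (\<forall>b\<in>B. r b = b)))"

text \<open>The count \<open>DIM('a) + 1 + net l\<close> is relative to the cost d + 1 of a gluing: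
  d base vertices are shared, and then 0 disappears.\<close>

definition gadget :: "'a::euclidean_space \<Rightarrow> ('l \<Rightarrow> nat) \<Rightarrow> ('l \<Rightarrow> 'a list) \<Rightarrow> ('l \<Rightarrow> nat) \<Rightarrow> 'l \<Rightarrow> 'a set \<Rightarrow> bool" where
  "gadget b0 sz bs net l Q \<longleftrightarrow> polytope Q \<and> aff_dim Q = int DIM('a) \<and> (\<forall>x\<in>Q. x \<bullet> One \<le> 1) \<and>
     spread DIM('a) (facet_family Q) \<and> card (verts Q) = DIM('a) + 1 + net l \<and>
     (\<exists>t H. 0 < t \<and> port (facet_family Q) (Basis - {b0}) 0 (t *\<^sub>R b0) id H) \<and>
     low_facets b0 Q \<and> traversable (facet_family Q) (Basis - {b0}) 0 (sz l) (bs l)"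

text \<open>Invariant of a chain: an open port at v, and a marked flag made of its simplex facet and
  a lateral facet G, from which the word is read without using v.\<close>

definition chained :: "'a::euclidean_space \<Rightarrow> ('l \<Rightarrow> nat) \<Rightarrow> ('l \<Rightarrow> 'a list) \<Rightarrow> 'l list \<Rightarrow> 'a set \<Rightarrow>
    'a \<Rightarrow> 'a \<Rightarrow> ('a \<Rightarrow> 'a) \<Rightarrow> ('a \<Rightarrow> 'a set) \<Rightarrow> 'a set \<Rightarrow> bool" where
  "chained b0 sz bs ws P v w a H G \<longleftrightarrow> polytope P \<and> aff_dim P = int DIM('a) \<and>
     spread DIM('a) (facet_family P) \<and> port (facet_family P) (Basis - {b0}) v w a H \<and>
     state (facet_family P) (Basis - {b0}) G (insert v (a ` (Basis - {b0}))) a \<and>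
     decodes (facet_family P) (Basis - {b0}) DIM('a) sz bs (verts P - {v}) ws G
       (insert v (a ` (Basis - {b0}))) a"

section \<open>Normalizing, stretching and attaching\<close>

lemma chained_image:
  fixes L :: "'a::euclidean_space \<Rightarrow> 'a" and c :: 'a
  assumes L: "linear L" "inj L" and ch: "chained b0 sz bs ws P v w a H G"
  defines "f \<equiv> \<lambda>x. c + L x"
  assumes a': "\<And>b. b \<in> Basis - {b0} \<Longrightarrow> f (a b) = a' b"
  shows "chained b0 sz bs ws (f ` P) (f v) (f w) a' (\<lambda>b. f ` H b) (f ` G)"
proof -
  have P: "polytope P" "aff_dim P = int DIM('a)" using ch by (auto simp: chained_def)
  note img = affine_image_polytope[OF L P(1), where c=c, folded f_def]
  have inj: "inj f" by (rule img(5))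
  have "f ` insert v (a ` (Basis - {b0})) = insert (f v) (a' ` (Basis - {b0}))"
    using a' unfolding image_insert image_comp by (simp cong: image_cong_simp)
  moreover have "state (facet_family (f ` P)) (Basis - {b0}) (f ` G) (f ` insert v (a ` (Basis - {b0}))) a'"
    unfolding img(4) by (rule state_cong[OF state_image[OF inj subset_UNIV]]) (use ch a' in \<open>auto simp: chained_def\<close>)
  moreover have "decodes (facet_family (f ` P)) (Basis - {b0}) DIM('a) sz bs (f ` (verts P - {v})) ws (f ` G)
       (f ` insert v (a ` (Basis - {b0}))) a'"
    unfolding img(4)
  proof (rule decodes_cong[OF decodes_image[OF inj subset_UNIV]])
    show "\<forall>b\<in>Basis - {b0}. a' b = (f \<circ> a) b" using a' by (simp del: Diff_iff)
  qed (use ch in \<open>simp_all add: chained_def\<close>)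
  moreover have "f ` (verts P - {v}) = verts (f ` P) - {f v}"
    unfolding img(3) using inj by (auto simp: inj_eq)
  moreover have "port (facet_family (f ` P)) (Basis - {b0}) (f v) (f w) a' (\<lambda>b. f ` H b)"
    unfolding img(4) by (rule port_cong[OF port_image[OF inj subset_UNIV UNIV_I]]) (use ch a' in \<open>auto simp: chained_def\<close>)
  moreover have "spread DIM('a) (facet_family (f ` P))"
    unfolding img(4) by (rule spread_image[OF inj subset_UNIV]) (use ch in \<open>simp add: chained_def\<close>)
  ultimately show ?thesis unfolding chained_def using img(1,2) P(2) by simp
qed

text \<open>The base spans a hyperplane and w is a vertex off it, so v, the base vertices and w form
  an affine basis. The choice of \<open>- b0\<close> for w places the polytope below the
  base.\<close>

lemma normalize_port:
  fixes P :: "'a::euclidean_space set"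
  assumes b0: "b0 \<in> Basis" "Basis - {b0} \<noteq> {}" and P: "polytope P" "aff_dim P = int DIM('a)"
    and port: "port (facet_family P) (Basis - {b0}) v w a H"
  obtains L :: "'a \<Rightarrow> 'a" and c where "linear L" "inj L" "c + L v = 0"
    "\<And>b. b \<in> Basis - {b0} \<Longrightarrow> c + L (a b) = b" "c + L w = - b0"
proof -
  let ?B = "Basis - {b0}" and ?S = "insert v (a ` (Basis - {b0}))"
  have F: "?S \<in> facet_family P" and vw: "v \<notin> a ` ?B" "w \<notin> ?S" using port by (simp_all add: port_def)
  obtain Y where Y: "Y facet_of P" "?S = verts P \<inter> Y" using F by (auto simp: facet_family_def)
  have hull: "convex hull ?S = Y"
    using face_eq_hull[OF P(1) facet_of_imp_face_of[OF Y(1)]] Y(2) by simp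
  obtain b where "b \<in> ?B" using b0(2) by blast
  then have "H b \<in> facet_family P" "w \<in> H b" using port unfolding port_def by blast+
  then have "w \<in> verts P" using facet_family_subset by blast
  then have "w \<notin> Y" using vw(2) Y(2) by blast
  then have "w \<notin> affine hull Y"
    using face_of_imp_eq_affine_Int[OF polytope_imp_convex[OF P(1)] facet_of_imp_face_of[OF Y(1)]]
      \<open>w \<in> verts P\<close> verts_subset[of P] by blast
  then have wS: "w \<notin> affine hull ?S" using hull by (metis affine_hull_convex_hull)
  have "aff_dim ?S = int DIM('a) - 1"
    using Y(1) P(2) hull by (metis aff_dim_convex_hull facet_of_def)
  then have "aff_dim (insert w ?S) = int DIM('a)" using wS by (simp add: aff_dim_insert)
  then have "affine hull (insert w ?S) = UNIV" using aff_dim_eq_full by blast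
  then have U: "affine hull (insert v (insert w (a ` ?B))) = UNIV" by (simp add: insert_commute)
  have "v \<notin> insert w (a ` ?B)" using vw by auto
  then have sp: "{v + x |x. x \<in> span {x - v |x. x \<in> insert w (a ` ?B)}} = UNIV"
    using affine_hull_insert_span[of v "insert w (a ` ?B)"] U by simp
  \<comment> \<open>Sends b to \<open>a b - v\<close> and \<open>- b0\<close> to
    \<open>w - v\<close>; the normalization is its inverse.\<close>
  define M where "M x = (\<Sum>b\<in>?B. (x \<bullet> b) *\<^sub>R (a b - v)) - (x \<bullet> b0) *\<^sub>R (w - v)" for x
  have lin: "linear M"
  proof -
    have l1: "linear (\<lambda>x. (x \<bullet> i) *\<^sub>R u)" for i u :: 'a
      by (rule linearI) (simp_all add: inner_add_left scaleR_add_left)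
    show ?thesis unfolding M_def by (intro linear_compose_sub linear_compose_sum ballI l1)
  qed
  have Mb: "M b = a b - v" if b: "b \<in> ?B" for b
  proof -
    have "(\<Sum>b'\<in>?B. (b \<bullet> b') *\<^sub>R (a b' - v)) = (\<Sum>b'\<in>?B. if b = b' then a b' - v else 0)"
      by (rule sum.cong) (use b in \<open>auto simp: inner_Basis\<close>)
    also have "\<dots> = a b - v" using b by simp
    finally show ?thesis using b b0(1) by (simp add: M_def inner_Basis)
  qed
  have "(\<Sum>b'\<in>?B. (b0 \<bullet> b') *\<^sub>R (a b' - v)) = 0"
    by (rule sum.neutral) (use b0(1) in \<open>auto simp: inner_Basis\<close>)
  then have M0: "M (- b0) = w - v" using b0(1) by (simp add: M_def sum_negf)
  have "{x - v |x. x \<in> insert w (a ` ?B)} \<subseteq> range M"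
  proof
    fix y assume "y \<in> {x - v |x. x \<in> insert w (a ` ?B)}"
    then consider "y = w - v" | b where "b \<in> ?B" "y = a b - v" by blast
    then show "y \<in> range M" by cases (metis M0 rangeI, metis Mb rangeI)
  qed
  then have "span {x - v |x. x \<in> insert w (a ` ?B)} \<subseteq> range M"
    by (rule span_minimal) (rule linear_subspace_image[OF lin subspace_UNIV])
  have "range M = UNIV"
  proof -
    have "y \<in> range M" for y
    proof -
      have "v + y \<in> {v + x |x. x \<in> span {x - v |x. x \<in> insert w (a ` ?B)}}" using sp by simp
      then show ?thesis using \<open>span {x - v |x. x \<in> insert w (a ` ?B)} \<subseteq> range M\<close> by auto
    qed
    then show ?thesis by blast
  qed
  then have injM: "inj M" using linear_surjective_imp_injective[OF lin] by simp
  obtain L where L: "linear L" "\<And>x. L (M x) = x" "\<And>x. M (L x) = x"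
    using linear_injective_isomorphism[OF lin injM] by blast
  have "inj L" by (metis L(3) injI)
  moreover have "- L v + L (a b) = b" if "b \<in> ?B" for b
    using L(2)[of b] Mb[OF that] linear_diff[OF L(1)] by simp
  moreover have "- L v + L w = - b0"
    using L(2)[of "- b0"] M0 linear_diff[OF L(1)] by simp
  ultimately show ?thesis using that[of L "- L v"] L(1) by simp
qed

lemma finite_bound:
  fixes f :: "'b \<Rightarrow> real" assumes "finite X" obtains K where "0 < K" "\<And>x. x \<in> X \<Longrightarrow> \<bar>f x\<bar> \<le> K"
proof
  show "0 < 1 + (\<Sum>x\<in>X. \<bar>f x\<bar>)" by (simp add: add_pos_nonneg sum_nonneg)
  show "\<bar>f x\<bar> \<le> 1 + (\<Sum>x\<in>X. \<bar>f x\<bar>)" if "x \<in> X" for x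
    using member_le_sum[OF that, of "\<lambda>x. \<bar>f x\<bar>"] assms by simp
qed

lemma inner_split:
  fixes c x :: "'a::euclidean_space"
  assumes "b0 \<in> Basis"
  shows "c \<bullet> x = (\<Sum>b\<in>Basis - {b0}. (c \<bullet> b) * (x \<bullet> b)) + (c \<bullet> b0) * (x \<bullet> b0)"
  using euclidean_inner[of c x] assms by (simp add: sum.remove)

text \<open>Scaling the b0-direction by a large factor fixes the base and pushes the rest down. This
  lowers \<open>x \<bullet> One\<close> off the base and divides the b0-component of every facet
  normal by the factor.\<close>

lemma stretch:
  fixes P :: "'a::euclidean_space set"
  assumes b0: "b0 \<in> Basis" "Basis - {b0} \<noteq> {}"
    and ch: "chained b0 sz bs ws P 0 (- b0) id H G"
  obtains P' H' G' t where "t < 0" "chained b0 sz bs ws P' 0 (t *\<^sub>R b0) id H' G'" "card (verts P') = card (verts P)"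
    "\<And>x. x \<in> P' \<Longrightarrow> x \<bullet> One \<le> 1" "\<And>x. \<lbrakk>x \<in> P'; x \<bullet> b0 \<noteq> 0\<rbrakk> \<Longrightarrow> x \<bullet> One < 1"
    "\<And>Y. \<lbrakk>Y facet_of P'; 0 \<notin> Y\<rbrakk> \<Longrightarrow> \<exists>c. Y = P' \<inter> {x. c \<bullet> x = 1} \<and> (\<forall>x\<in>P'. c \<bullet> x \<le> 1) \<and> \<bar>c \<bullet> b0\<bar> < 1"
proof -
  let ?B = "Basis - {b0}" and ?D = "convex hull (insert 0 (Basis - {b0}))"
  have P: "polytope P" "aff_dim P = int DIM('a)" and port: "port (facet_family P) ?B 0 ((-1) *\<^sub>R b0) id H"
    using ch by (auto simp: chained_def)
  note pc = port_corner[OF b0 P port, of "-1"]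
  have b00: "b0 \<bullet> b0 = 1" using b0 by simp
  have D_One: "x \<bullet> One \<le> 1" if "x \<in> ?D" for x
  proof -
    have "?D \<subseteq> {x. One \<bullet> x \<le> 1}"
    proof (rule hull_minimal)
      have "One \<bullet> b = 1" if "b \<in> Basis" for b :: 'a using that by (simp add: inner_sum_left inner_Basis)
      then show "insert 0 ?B \<subseteq> {x. One \<bullet> x \<le> 1}" by auto
    qed (rule convex_halfspace_le)
    then show ?thesis using that by (auto simp only: inner_commute[of x One])
  qed
  \<comment> \<open>With this K, \<open>x \<bullet> One + K * (x \<bullet> b0) \<le> 1\<close> holds
    at all vertices. On base vertices the quotient is 0 by convention, and the bound comes from the
    base.\<close>
  obtain K where K: "0 < K" "\<And>p. p \<in> verts P \<Longrightarrow> \<bar>(p \<bullet> One - 1) / (p \<bullet> b0)\<bar> \<le> K"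
    using finite_bound[OF finite_verts[OF P(1)], of "\<lambda>p. (p \<bullet> One - 1) / (p \<bullet> b0)"] by metis
  have "P \<subseteq> {x. (One + K *\<^sub>R b0) \<bullet> x \<le> 1}"
  proof -
    have "p \<bullet> One + K * (p \<bullet> b0) \<le> 1" if p: "p \<in> verts P" for p
    proof (cases "p \<bullet> b0 = 0")
      case True
      then have "p \<in> ?D" using pc(3) p verts_subset[of P] by auto
      then show ?thesis using D_One True by simp
    next
      case False
      then have neg: "p \<bullet> b0 < 0" using pc(1)[of p] p verts_subset by fastforce
      have "- K \<le> (p \<bullet> One - 1) / (p \<bullet> b0)" using K(2)[OF p] by linarith
      then show ?thesis using neg by (simp add: field_simps)
    qed
    then have "verts P \<subseteq> {x. (One + K *\<^sub>R b0) \<bullet> x \<le> 1}"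
      by (auto simp only: inner_add_left inner_scaleR_left inner_commute[of One] inner_commute[of b0])
    then have "convex hull (verts P) \<subseteq> {x. (One + K *\<^sub>R b0) \<bullet> x \<le> 1}"
      by (rule hull_minimal) (rule convex_halfspace_le)
    then show ?thesis using convex_hull_verts[OF P(1)] by simp
  qed
  then have PK: "x \<bullet> One + K * (x \<bullet> b0) \<le> 1" if "x \<in> P" for x
    using that by (auto simp only: inner_add_left inner_scaleR_left inner_commute[of One] inner_commute[of b0])
  have "\<forall>Y. \<exists>c. Y facet_of P \<and> 0 \<notin> Y \<longrightarrow> Y = P \<inter> {x. c \<bullet> x = 1} \<and> (\<forall>x\<in>P. c \<bullet> x \<le> 1)"
    using pc(6) by (simp only: mult_minus1 minus_minus zero_less_one) blast
  then obtain cc where cc: "\<And>Y. \<lbrakk>Y facet_of P; 0 \<notin> Y\<rbrakk> \<Longrightarrow> Y = P \<inter> {x. cc Y \<bullet> x = 1} \<and> (\<forall>x\<in>P. cc Y \<bullet> x \<le> 1)"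
    by metis
  obtain K' where K': "0 < K'" "\<And>Y. Y \<in> {Y. Y facet_of P} \<Longrightarrow> \<bar>cc Y \<bullet> b0\<bar> \<le> K'"
    using finite_bound[OF finite_polyhedron_facets[OF polytope_imp_polyhedron[OF P(1)]], of "\<lambda>Y. cc Y \<bullet> b0"] by metis
  \<comment> \<open>Beyond K + 1 for strictness off the base, and beyond K' for the facet
    normals.\<close>
  define l where "l = K + K' + 1"
  have l: "1 < l" "K' < l" "K + 1 < l" using K(1) K'(1) by (auto simp: l_def)
  define S where "S x = x + ((l - 1) * (x \<bullet> b0)) *\<^sub>R b0" for x
  have linS: "linear S"
    unfolding S_def by (rule linearI) (simp_all add: inner_add_left algebra_simps)
  have S0: "S x \<bullet> b0 = l * (x \<bullet> b0)" for x using b00 by (simp add: S_def inner_add_left algebra_simps)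
  have injS: "inj S"
  proof (rule injI)
    fix x y assume e: "S x = S y"
    then have "l * (x \<bullet> b0) = l * (y \<bullet> b0)" using S0 by metis
    then have "x \<bullet> b0 = y \<bullet> b0" using l by simp
    then show "x = y" using e by (simp add: S_def)
  qed
  have ch': "chained b0 sz bs ws (S ` P) (S 0) (S (- b0)) id (\<lambda>b. S ` H b) (S ` G)"
    using chained_image[OF linS injS ch, of 0 id] b0(1)
    by (simp add: S_def inner_Basis cong: image_cong_simp)
  have S00: "S 0 = 0" "S (- b0) = (- l) *\<^sub>R b0" using b00 by (simp_all add: S_def algebra_simps)
  note img = affine_image_polytope[OF linS injS P(1), where c = 0, simplified]
  have One_b0: "b0 \<bullet> One = 1" using b0(1) by (simp add: inner_sum_right inner_Basis)
  have SOne: "S x \<bullet> One = x \<bullet> One + (l - 1) * (x \<bullet> b0)" for x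
    using One_b0 by (simp only: S_def inner_add_left inner_scaleR_left)
  have neg: "x \<bullet> b0 \<le> 0" if "x \<in> P" for x using pc(1)[OF _ that] by simp
  show ?thesis
  proof (rule that[of "- l" "S ` P" "\<lambda>b. S ` H b" "S ` G"])
    show "- l < 0" using l by simp
    show "chained b0 sz bs ws (S ` P) 0 ((- l) *\<^sub>R b0) id (\<lambda>b. S ` H b) (S ` G)" using ch' S00 by simp
    show "card (verts (S ` P)) = card (verts P)"
      unfolding img(3) using injS by (simp add: card_image inj_on_subset)
    have gap: "S x \<bullet> One \<le> 1 + (l - 1 - K) * (x \<bullet> b0)" if "x \<in> P" for x
      using PK[OF that] unfolding SOne by (simp add: algebra_simps)
    show "x \<bullet> One \<le> 1" if "x \<in> S ` P" for x
    proof -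
      obtain y where y: "x = S y" "y \<in> P" using \<open>x \<in> S ` P\<close> by blast
      have "(l - 1 - K) * (y \<bullet> b0) \<le> 0" using l neg[OF y(2)] by (simp add: mult_nonneg_nonpos)
      then show ?thesis using gap[OF y(2)] y(1) by simp
    qed
    show "x \<bullet> One < 1" if x: "x \<in> S ` P" "x \<bullet> b0 \<noteq> 0" for x
    proof -
      obtain y where y: "x = S y" "y \<in> P" using x by blast
      have "y \<bullet> b0 < 0" using x(2) y(1) S0[of y] neg[OF y(2)] by (cases "y \<bullet> b0 = 0") auto
      then have "(l - 1 - K) * (y \<bullet> b0) < 0" using l by (simp add: mult_pos_neg)
      then show ?thesis using gap[OF y(2)] y(1) by simp
    qed
    fix Z assume Z: "Z facet_of S ` P" "0 \<notin> Z"
    then obtain Y where Y: "Y facet_of P" "Z = S ` Y" using img(6)[THEN iffD1, OF Z(1)] by blast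
    have "0 \<notin> Y" using Z(2) Y(2) S00(1) by force
    note c = cc[OF Y(1) this]
    \<comment> \<open>Normals transform by the inverse of the symmetric map S: only the b0-component
      changes, by the factor 1/l.\<close>
    define c where "c = cc Y + ((1 / l - 1) * (cc Y \<bullet> b0)) *\<^sub>R b0"
    have cS: "c \<bullet> S x = cc Y \<bullet> x" for x
    proof -
      have "c \<bullet> S x = cc Y \<bullet> x + ((l - 1) * (x \<bullet> b0)) * (cc Y \<bullet> b0)
          + ((1 / l - 1) * (cc Y \<bullet> b0)) * ((b0 \<bullet> x) + (l - 1) * (x \<bullet> b0) * (b0 \<bullet> b0))"
        unfolding c_def S_def inner_add_left inner_add_right inner_scaleR_left inner_scaleR_right
        by (simp add: distrib_left)
      also have "\<dots> = cc Y \<bullet> x + (cc Y \<bullet> b0) * (x \<bullet> b0) * ((l - 1) + (1 / l - 1) + (1 / l - 1) * (l - 1))"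
        unfolding b00 inner_commute[of b0 x] by algebra
      also have "(l - 1) + (1 / l - 1) + (1 / l - 1) * (l - 1) = 0" using l by (simp add: field_simps)
      finally show ?thesis by simp
    qed
    have "c \<bullet> b0 = (cc Y \<bullet> b0) / l" using b00 by (simp add: c_def inner_add_left algebra_simps)
    moreover have "\<bar>cc Y \<bullet> b0\<bar> < l" using K'(2) Y(1) l by fastforce
    ultimately have "\<bar>c \<bullet> b0\<bar> < 1" using l by (simp add: abs_divide)
    moreover have "Z = S ` P \<inter> {x. c \<bullet> x = 1}" "\<forall>x\<in>S ` P. c \<bullet> x \<le> 1"
      using c cS Y(2) by auto
    ultimately show "\<exists>c. Z = S ` P \<inter> {x. c \<bullet> x = 1} \<and> (\<forall>x\<in>S ` P. c \<bullet> x \<le> 1) \<and> \<bar>c \<bullet> b0\<bar> < 1" by blast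
  qed
qed

text \<open>The stretched chain R lies below the base and the gadget Q above it. In the union the
  base facet of Q is replaced by the marked facet \<open>GR\<close>, and the base facet of R by the
  lateral facet \<open>G'\<close>. So the walk of the gadget ends precisely at the flag, with roles
  exchanged, from which the old word is read.\<close>

theorem attach_gadget:
  fixes P :: "'a::euclidean_space set"
  assumes b0: "b0 \<in> Basis" and d4: "4 \<le> DIM('a)" and sz: "\<And>l. DIM('a) \<le> sz l"
    and ch: "chained b0 sz bs ws P v w a H G" and gad: "gadget b0 sz bs net l Q"
  obtains P' v' w' a' H' G' where "chained b0 sz bs (l # ws) P' v' w' a' H' G'"
    "card (verts P') = card (verts P) + net l"
proof -
  let ?B = "Basis - {b0}" and ?D = "convex hull (insert 0 (Basis - {b0}))"
  have cardB: "card ?B + 1 = DIM('a)" using b0 d4 by simp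
  have Bne: "?B \<noteq> {}"
  proof
    assume "?B = {}"
    then show False using cardB d4 by (simp only: card.empty)
  qed
  have P: "polytope P" "aff_dim P = int DIM('a)" and portP: "port (facet_family P) ?B v w a H"
    using ch by (auto simp: chained_def)
  obtain L c where L: "linear L" "inj L" "c + L v = 0" "\<And>b. b \<in> ?B \<Longrightarrow> c + L (a b) = b" "c + L w = - b0"
    using normalize_port[OF b0 Bne P portP] by metis
  have ch1: "chained b0 sz bs ws ((\<lambda>x. c + L x) ` P) 0 (- b0) id (\<lambda>b. (\<lambda>x. c + L x) ` H b) ((\<lambda>x. c + L x) ` G)"
    using chained_image[OF L(1,2) ch, where c = c and a' = id] L(3-5) by simp
  have cv: "card (verts ((\<lambda>x. c + L x) ` P)) = card (verts P)"
    unfolding affine_image_polytope(3)[OF L(1,2) P(1)]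
    by (rule card_image) (use L(2) in \<open>auto simp: inj_on_def\<close>)
  obtain R HR GR t where t: "t < 0" and R: "chained b0 sz bs ws R 0 (t *\<^sub>R b0) id HR GR"
    and cR: "card (verts R) = card (verts P)" and ROne: "\<And>x. x \<in> R \<Longrightarrow> x \<bullet> One \<le> 1"
    "\<And>x. \<lbrakk>x \<in> R; x \<bullet> b0 \<noteq> 0\<rbrakk> \<Longrightarrow> x \<bullet> One < 1"
    and Rfac: "\<And>Y. \<lbrakk>Y facet_of R; 0 \<notin> Y\<rbrakk> \<Longrightarrow> \<exists>c. Y = R \<inter> {x. c \<bullet> x = 1} \<and> (\<forall>x\<in>R. c \<bullet> x \<le> 1) \<and> \<bar>c \<bullet> b0\<bar> < 1"
    by (rule stretch[OF b0 Bne ch1]) (use cv in auto)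
  have Rp: "polytope R" "aff_dim R = int DIM('a)" and portR: "port (facet_family R) ?B 0 (t *\<^sub>R b0) id HR"
    and spR: "spread DIM('a) (facet_family R)" and stR: "state (facet_family R) ?B GR (insert 0 (id ` ?B)) id"
    and decR: "decodes (facet_family R) ?B DIM('a) sz bs (verts R - {0}) ws GR (insert 0 (id ` ?B)) id"
    using R by (auto simp: chained_def)
  have Q: "polytope Q" "aff_dim Q = int DIM('a)" "\<forall>x\<in>Q. x \<bullet> One \<le> 1" "spread DIM('a) (facet_family Q)"
    "card (verts Q) = DIM('a) + 1 + net l"
    using gad by (simp_all add: gadget_def)
  obtain s HQ where s: "0 < s" and portQ: "port (facet_family Q) ?B 0 (s *\<^sub>R b0) id HQ"
    using gad unfolding gadget_def by blast
  obtain u w' c' Ht G' r where top: "port (facet_family Q) ?B u w' c' Ht" and u: "u \<notin> insert 0 ?B" "w' \<noteq> 0" "0 \<notin> c' ` ?B"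
    and G': "G' \<in> facet_family Q" "0 \<notin> G'" "u \<notin> G'" "card G' = sz l" "?B \<subseteq> G'"
    and stQ: "state (facet_family Q) ?B G' (insert u (c' ` ?B)) c'"
    and wk: "walk (facet_family Q) ?B G' (bs l) (insert u (c' ` ?B)) c' (insert 0 ?B) r" and r: "\<forall>b\<in>?B. r b = b"
    using gad unfolding gadget_def traversable_def by (elim conjE exE) (rule that)
  note pR = port_corner[OF b0 Bne Rp portR, of "-1"] and pQ = port_corner[OF b0 Bne Q(1,2) portQ, of 1]
  have cRc: "corner b0 (-1) R" using pR(5) t ROne(1) by simp
  have cQc: "corner b0 1 Q" using pQ(5) s Q(3) by simp
  have inD: "b \<in> ?D" if "b \<in> ?B" for b using that by (auto intro: hull_inc)
  have D_R: "?D \<subseteq> R" and D_Q: "?D \<subseteq> Q" using pR(3) pQ(3) t s by auto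
  have RQ: "beneath b0 R Q"
    unfolding beneath_def
  proof (intro allI impI)
    fix Y assume "Y facet_of R \<and> 0 \<notin> Y"
    then obtain c where c: "Y = R \<inter> {x. c \<bullet> x = 1}" "\<forall>x\<in>R. c \<bullet> x \<le> 1" "\<bar>c \<bullet> b0\<bar> < 1" using Rfac by blast
    \<comment> \<open>Coordinatewise: \<open>c \<bullet> b \<le> 1\<close> as b lies in R, and the
      b0-component of c is below 1 while \<open>x \<bullet> b0\<close> is positive. So
      \<open>c \<bullet> x < x \<bullet> One \<le> 1\<close>.\<close>
    have "c \<bullet> x < 1" if x: "x \<in> Q - ?D" for x
    proof -
      have "x \<bullet> b0 \<noteq> 0" using pQ(3) x s by auto
      moreover have "0 \<le> x \<bullet> b0" using pQ(1)[of x] x s by auto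
      ultimately have pos: "0 < x \<bullet> b0" by simp
      have "(c \<bullet> b) * (x \<bullet> b) \<le> x \<bullet> b" if b: "b \<in> ?B" for b
      proof -
        have "c \<bullet> b \<le> 1" using c(2) inD[OF b] D_R by blast
        moreover have "0 \<le> x \<bullet> b" using pQ(2)[OF _ _ b] x s by auto
        ultimately show ?thesis using mult_right_mono by fastforce
      qed
      then have "(\<Sum>b\<in>?B. (c \<bullet> b) * (x \<bullet> b)) \<le> (\<Sum>b\<in>?B. x \<bullet> b)" by (rule sum_mono)
      moreover have "(c \<bullet> b0) * (x \<bullet> b0) < x \<bullet> b0" using c(3) pos by (simp add: mult_less_cancel_right1 abs_less_iff)
      moreover have "x \<bullet> One = (\<Sum>b\<in>?B. x \<bullet> b) + x \<bullet> b0"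
        using b0 by (simp only: inner_sum_right) (simp add: sum.remove)
      moreover have "x \<bullet> One \<le> 1" using Q(3) x by blast
      ultimately show ?thesis unfolding inner_split[OF b0, of c x] by linarith
    qed
    then show "\<exists>c. Y = R \<inter> {x. c \<bullet> x = 1} \<and> (\<forall>x\<in>R. c \<bullet> x \<le> 1) \<and> (\<forall>x\<in>Q - ?D. c \<bullet> x < 1)"
      using c by blast
  qed
  have QR: "beneath b0 Q R"
    unfolding beneath_def
  proof (intro allI impI)
    fix Y assume "Y facet_of Q \<and> 0 \<notin> Y"
    then obtain c where c: "Y = Q \<inter> {x. c \<bullet> x = 1}" "\<forall>x\<in>Q. c \<bullet> x \<le> 1"
        "\<And>x. \<lbrakk>x \<bullet> b0 < 0; \<forall>b\<in>?B. 0 \<le> x \<bullet> b; x \<bullet> One < 1\<rbrakk> \<Longrightarrow> c \<bullet> x < 1"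
      using gad unfolding gadget_def low_facets_def by metis
    have "c \<bullet> x < 1" if x: "x \<in> R - ?D" for x
    proof -
      have nz: "x \<bullet> b0 \<noteq> 0" using pR(3) x t by auto
      moreover have "x \<bullet> b0 \<le> 0" using pR(1)[of x] x t by auto
      ultimately show ?thesis using c(3)[of x] pR(2)[of x] x t ROne(2)[of x] by auto
    qed
    then show "\<exists>c. Y = Q \<inter> {x. c \<bullet> x = 1} \<and> (\<forall>x\<in>Q. c \<bullet> x \<le> 1) \<and> (\<forall>x\<in>R - ?D. c \<bullet> x < 1)"
      using c by blast
  qed
  interpret cp: corner_pair b0 "-1" R Q
    by unfold_locales (use b0 cRc cQc RQ QR in auto)
  interpret cpf: corner_pair b0 1 Q R using cp.flip by simp
  have strict: "\<forall>x\<in>R - ?D. x \<bullet> One < 1" using ROne(2) pR(3) t by auto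
  define HR' HQ' where "HR' b = verts R \<inter> {x. x \<bullet> b = 0}" and "HQ' b = verts Q \<inter> {x. x \<bullet> b = 0}" for b
  have HR: "b \<in> ?B \<Longrightarrow> HR b = HR' b" and HQ: "b \<in> ?B \<Longrightarrow> HQ b = HQ' b" for b
    using pR(4) pQ(4) t s by (auto simp: HR'_def HQ'_def)
  have portR': "port (facet_family R) ?B 0 (t *\<^sub>R b0) id HR'" by (rule port_cong[OF portR]) (use HR in auto)
  have portQ': "port (facet_family Q) ?B 0 (s *\<^sub>R b0) id HQ'" by (rule port_cong[OF portQ]) (use HQ in auto)
  have UR: "\<Union>(facet_family R) \<subseteq> verts R" and UQ: "\<Union>(facet_family Q) \<subseteq> verts Q"
    using facet_family_subset by blast+
  have vRQ: "verts R \<inter> verts Q = insert 0 ?B"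
  proof
    show "verts R \<inter> verts Q \<subseteq> insert 0 ?B"
    proof
      fix x assume x: "x \<in> verts R \<inter> verts Q"
      then have "x \<in> R" "x \<in> Q" using verts_subset by blast+
      then have "x \<bullet> b0 = 0" using pR(1)[of x] pQ(1)[of x] t s by auto
      then have "x \<in> verts R \<inter> ?D" using cp.P_Delta \<open>x \<in> R\<close> x by blast
      then show "x \<in> insert 0 ?B" using cp.verts_P_Delta by blast
    qed
    show "insert 0 ?B \<subseteq> verts R \<inter> verts Q" using cp.verts_P_Delta cpf.verts_P_Delta by blast
  qed
  interpret g: gluing "DIM('a)" "facet_family R" "facet_family Q" 0 ?B "t *\<^sub>R b0" "s *\<^sub>R b0" HR' HQ'
  proof unfold_locales
    show "finite (\<Union>(facet_family R))" "finite (\<Union>(facet_family Q))"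
      using UR UQ finite_verts Rp Q finite_subset by blast+
    show "\<Union>(facet_family R) \<inter> \<Union>(facet_family Q) \<subseteq> insert 0 ?B" using UR UQ vRQ by blast
  qed (use cardB d4 spR Q(4) portR' portQ' in auto)
  interpret s: gluing "DIM('a)" "facet_family Q" "facet_family R" 0 ?B "s *\<^sub>R b0" "t *\<^sub>R b0" HQ' HR'
    by (rule g.sym)
  have sr: "s.repl = g.repl"
    unfolding fun_eq_iff s.repl_def g.repl_def by (auto simp: Un_commute Let_def)
  have fam: "facet_family (R \<union> Q) = glued (facet_family R) (facet_family Q) 0 ?B HR' HQ'"
    using cp.facet_family_union[OF strict] unfolding HR'_def HQ'_def .
  have fam': "glued (facet_family Q) (facet_family R) 0 ?B HQ' HR' = facet_family (R \<union> Q)"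
    unfolding fam by (auto simp: glued_def Un_commute)
  have vert: "verts (R \<union> Q) = verts R \<union> verts Q - {0}" by (rule cp.verts_union[OF strict])
  have GR: "GR \<in> facet_family R" "0 \<notin> GR" "?B \<subseteq> GR" "\<not> GR \<subseteq> ?B"
  proof -
    show "GR \<in> facet_family R" "?B \<subseteq> GR" using stR by (auto simp: state_def)
    show "0 \<notin> GR" using decodes_subset[OF decR] by blast
    have "DIM('a) \<le> card GR" using decR sz by (cases rule: decodes.cases) auto
    then show "\<not> GR \<subseteq> ?B" using card_mono[of ?B GR] cardB by auto
  qed
  have nG': "\<not> G' \<subseteq> ?B" using G'(4) sz[of l] card_mono[of ?B G'] cardB by auto
  have uR: "u \<notin> \<Union>(facet_family R)"
  proof
    assume "u \<in> \<Union>(facet_family R)"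
    moreover have "u \<in> verts Q" using top UQ by (auto simp: port_def)
    ultimately show False using UR vRQ u(1) by blast
  qed
  have port': "port (facet_family (R \<union> Q)) ?B u w' c' (g.repl GR \<circ> Ht)"
    unfolding fam by (rule g.glued_port[OF top uR u(2,3) GR(1,2)])
  have sp': "spread DIM('a) (facet_family (R \<union> Q))" unfolding fam by (rule g.spread_glued)
  have M: "insert u (c' ` ?B) \<in> facet_family Q" "0 \<notin> insert u (c' ` ?B)"
    using top u by (auto simp: port_def)
  have injs: "inj_on (g.repl GR) (facet_family Q)" using s.repl_inj[OF GR(1,2,4)] sr by simp
  have wk': "walk (facet_family (R \<union> Q)) ?B G' (bs l) (insert u (c' ` ?B)) c' GR r"
  proof -
    have "walk (facet_family (R \<union> Q)) ?B G' (bs l) (g.repl GR (insert u (c' ` ?B))) c' (g.repl GR (insert 0 ?B)) r"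
      by (rule walk_transfer[OF injs _ _ G'(2) g.repl_simps(1)[OF G'(2)] wk stQ])
        (use s.repl_supset[OF _ GR(3)] s.repl_glued[OF _ GR(1,2)] fam' sr in auto)
    then show ?thesis using g.repl_simps(1)[OF M(2)] g.repl_simps(2) by simp
  qed
  have dec1: "decodes (facet_family (R \<union> Q)) ?B DIM('a) sz bs (verts R - {0}) ws GR (g.repl G' (insert 0 (id ` ?B))) id"
    by (rule decodes_transfer[OF g.repl_inj[OF G'(1,2) nG'] _ _ g.repl_simps(1) _ decR stR])
      (use g.repl_supset[OF _ G'(5)] g.repl_glued[OF _ G'(1,2)] fam in auto)
  have dec2: "decodes (facet_family (R \<union> Q)) ?B DIM('a) sz bs (verts (R \<union> Q) - {u}) ws GR G' r"
  proof (rule decodes_cong)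
    show "\<forall>b\<in>?B. r b = id b" using r by simp
    have "verts R - {0} \<subseteq> verts (R \<union> Q) - {u}"
      unfolding vert using u(1) top UQ vRQ by (auto simp: port_def)
    then show "decodes (facet_family (R \<union> Q)) ?B DIM('a) sz bs (verts (R \<union> Q) - {u}) ws GR G' id"
      using decodes_mono[OF dec1] by (simp add: g.repl_simps)
  qed
  have GU: "G' \<subseteq> verts (R \<union> Q) - {u}" unfolding vert using G' UQ by blast
  have dec: "decodes (facet_family (R \<union> Q)) ?B DIM('a) sz bs (verts (R \<union> Q) - {u}) (l # ws) G' (insert u (c' ` ?B)) c'"
    by (rule dec_Cons[OF GU G'(4) wk' dec2])
  have st: "state (facet_family (R \<union> Q)) ?B G' (insert u (c' ` ?B)) c'"
    using stQ M G' unfolding state_def fam by (auto simp: glued_def)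
  have ch': "chained b0 sz bs (l # ws) (R \<union> Q) u w' c' (g.repl GR \<circ> Ht) G'"
    unfolding chained_def using cp.polytope_union cp.aff_dim_union sp' port' st dec by blast
  have "card (verts (R \<union> Q)) = card (verts P) + net l"
  proof -
    have "card (verts R \<union> verts Q) + card (insert 0 ?B) = card (verts R) + card (verts Q)"
      using card_Un_Int[OF finite_verts[OF Rp(1)] finite_verts[OF Q(1)]] vRQ by simp
    moreover have "card (insert 0 ?B) = DIM('a)" using cardB g.zB g.finB by simp
    moreover have "0 \<in> verts R \<union> verts Q" using vRQ by blast
    ultimately show ?thesis unfolding vert using cR Q(5) finite_verts[OF Rp(1)] finite_verts[OF Q(1)] by simp
  qed
  with ch' show ?thesis using that by blast
qed

subsection \<open>Polytopes from incidence data\<close>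

text \<open>A polytope given by homogeneous inequalities \<open>lf i \<ge> 0\<close> in barycentric coordinates \<open>(x, e)\<close>,
  where \<open>e = 1 - x \<bullet> One\<close>; the vectors \<open>h j\<close> span its vertex rays.\<close>

locale incidence_polytope =
  fixes I :: "'i set" and J :: "'j set" and lf :: "'i \<Rightarrow> 'a::euclidean_space \<times> real \<Rightarrow> real"
    and h :: "'j \<Rightarrow> 'a \<times> real" and b0 :: 'a and F0 :: 'i and Hf :: "'a \<Rightarrow> 'i" and Ge :: 'i
  assumes finI: "finite I" and finJ: "finite J" and b0: "b0 \<in> Basis"
    and lin: "\<And>i. i \<in> I \<Longrightarrow> linear (lf i)"
    and nonneg: "\<And>i j. \<lbrakk>i \<in> I; j \<in> J\<rbrakk> \<Longrightarrow> 0 \<le> lf i (h j)"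
    and F0: "F0 \<in> I" "\<And>x e. lf F0 (x, e) = x \<bullet> b0"
    and Hf: "\<And>b. b \<in> Basis - {b0} \<Longrightarrow> Hf b \<in> I \<and> (\<forall>x e. lf (Hf b) (x, e) = x \<bullet> b)"
    and Ge: "Ge \<in> I" "\<And>x e. lf Ge (x, e) = e"
    and sepI: "\<And>i i'. \<lbrakk>i \<in> I; i' \<in> I; i \<noteq> i'\<rbrakk> \<Longrightarrow> \<exists>j\<in>J. lf i (h j) = 0 \<and> lf i' (h j) \<noteq> 0"
    and sepJ: "\<And>j j'. \<lbrakk>j \<in> J; j' \<in> J; j \<noteq> j'\<rbrakk> \<Longrightarrow> \<exists>i\<in>I. lf i (h j) = 0 \<and> lf i (h j') \<noteq> 0"
    and hne: "\<And>j. j \<in> J \<Longrightarrow> h j \<noteq> 0"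
    and rays: "\<And>k. \<lbrakk>k \<noteq> 0; \<forall>i\<in>I. 0 \<le> lf i k;
        \<And>k'. (\<forall>i\<in>I. lf i k = 0 \<longrightarrow> lf i k' = 0) \<Longrightarrow> \<exists>t. k' = t *\<^sub>R k\<rbrakk> \<Longrightarrow> \<exists>j\<in>J. \<exists>t. h j = t *\<^sub>R k"
    and origin: "\<exists>j\<in>J. h j = (0, 1)"
    and low: "\<And>i b. \<lbrakk>i \<in> I; b \<in> Basis - {b0}\<rbrakk> \<Longrightarrow> 0 \<le> lf i (b, 0)"
      "\<And>i. \<lbrakk>i \<in> I; i \<noteq> F0\<rbrakk> \<Longrightarrow> lf i (b0, 0) \<le> 0"
begin

definition hom :: "'a \<Rightarrow> 'a \<times> real" where "hom x = (x, 1 - x \<bullet> One)"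

definition deg :: "'a \<times> real \<Rightarrow> real" where "deg k = snd k + fst k \<bullet> One"

definition pt :: "'j \<Rightarrow> 'a" where "pt j = fst (h j) /\<^sub>R deg (h j)"

definition Q :: "'a set" where "Q = {x. \<forall>i\<in>I. 0 \<le> lf i (hom x)}"

lemma deg_hom: "deg (hom x) = 1" by (simp add: deg_def hom_def)

lemma hom_ne: "hom x \<noteq> 0" using deg_hom[of x] by (auto simp: deg_def)

text \<open>The barycentric coordinates are themselves among the defining forms. Hence their sum is
  positive on the nonzero vectors of the cone, and every ray can be scaled to a point.\<close>

lemma deg_eq: "deg k = lf Ge k + (lf F0 k + (\<Sum>b\<in>Basis - {b0}. lf (Hf b) k))"
proof -
  have "fst k \<bullet> One = fst k \<bullet> b0 + (\<Sum>b\<in>Basis - {b0}. fst k \<bullet> b)"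
    using b0 by (simp only: inner_sum_right) (simp add: sum.remove)
  moreover have "(\<Sum>b\<in>Basis - {b0}. lf (Hf b) k) = (\<Sum>b\<in>Basis - {b0}. fst k \<bullet> b)"
    using Hf by (intro sum.cong) (auto simp: split_paired_all intro: prod.exhaust[of k])
  ultimately show ?thesis using Ge(2)[of "fst k" "snd k"] F0(2)[of "fst k" "snd k"] by (simp add: deg_def)
qed

lemma deg_pos: assumes "\<forall>i\<in>I. 0 \<le> lf i k" "k \<noteq> 0" shows "0 < deg k"
proof -
  have nn: "0 \<le> lf Ge k" "0 \<le> lf F0 k" "\<And>b. b \<in> Basis - {b0} \<Longrightarrow> 0 \<le> lf (Hf b) k"
    using assms(1) Ge F0 Hf by auto
  then have s: "0 \<le> (\<Sum>b\<in>Basis - {b0}. lf (Hf b) k)" by (intro sum_nonneg) auto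
  have "deg k \<noteq> 0"
  proof
    assume "deg k = 0"
    then have z: "lf Ge k = 0" "lf F0 k = 0" "(\<Sum>b\<in>Basis - {b0}. lf (Hf b) k) = 0"
      using nn s unfolding deg_eq by linarith+
    then have "\<forall>b\<in>Basis - {b0}. lf (Hf b) k = 0"
      using nn(3) by (subst (asm) sum_nonneg_eq_0_iff) auto
    then have "fst k \<bullet> b = 0" if "b \<in> Basis" for b
    proof (cases "b = b0")
      case True then show ?thesis using z(2) F0(2)[of "fst k" "snd k"] by simp
    next
      case False
      then have b: "b \<in> Basis - {b0}" using that by simp
      then have "lf (Hf b) (fst k, snd k) = fst k \<bullet> b" using Hf by blast
      then show ?thesis using \<open>\<forall>b\<in>Basis - {b0}. lf (Hf b) k = 0\<close> b by simp
    qed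
    then have "fst k = 0" by (rule euclidean_all_zero_iff[THEN iffD1, rule_format, rotated]) auto
    moreover have "snd k = 0" using z(1) Ge(2)[of "fst k" "snd k"] by simp
    ultimately show False using assms(2) by (simp add: prod_eq_iff)
  qed
  moreover have "0 \<le> deg k" unfolding deg_eq using nn s by simp
  ultimately show ?thesis by simp
qed

lemma deg_h: "j \<in> J \<Longrightarrow> 0 < deg (h j)"
  using deg_pos nonneg hne by blast

lemma hom_pt: "j \<in> J \<Longrightarrow> hom (pt j) = h j /\<^sub>R deg (h j)"
proof -
  assume j: "j \<in> J"
  have "1 - fst (h j) \<bullet> One / deg (h j) = snd (h j) / deg (h j)"
    using deg_h[OF j] by (simp add: deg_def field_simps)
  then show ?thesis by (simp add: hom_def pt_def prod_eq_iff divide_inverse mult.commute)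
qed

lemma l_pt: "\<lbrakk>i \<in> I; j \<in> J\<rbrakk> \<Longrightarrow> lf i (hom (pt j)) = lf i (h j) / deg (h j)"
  by (simp add: hom_pt linear_cmul[OF lin] divide_inverse mult.commute)

lemma l_pt0: "\<lbrakk>i \<in> I; j \<in> J\<rbrakk> \<Longrightarrow> lf i (hom (pt j)) = 0 \<longleftrightarrow> lf i (h j) = 0"
  using l_pt deg_h[of j] by fastforce

lemma pt_Q: "j \<in> J \<Longrightarrow> pt j \<in> Q"
  using l_pt nonneg deg_h[of j] by (auto simp: Q_def intro!: divide_nonneg_pos)

lemma inj_pt: "inj_on pt J"
  by (rule inj_onI) (metis sepJ l_pt0)

lemma l_affine: assumes "i \<in> I" obtains c \<beta> where "\<And>x. lf i (hom x) = \<beta> - c \<bullet> x"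
proof -
  define g where "g x = lf i (x, - (x \<bullet> One))" for x :: 'a
  have "linear (\<lambda>x::'a. (x, - (x \<bullet> One)))"
    by (rule linearI) (simp_all add: inner_add_left)
  then have lg: "linear g"
    unfolding g_def using linear_compose[OF _ lin[OF assms], of "\<lambda>x. (x, - (x \<bullet> One))"] by (simp add: comp_def)
  have gc: "g x = (\<Sum>b\<in>Basis. g b *\<^sub>R b) \<bullet> x" for x
  proof -
    have "g x = g (\<Sum>b\<in>Basis. (x \<bullet> b) *\<^sub>R b)" by (simp add: euclidean_representation)
    also have "\<dots> = (\<Sum>b\<in>Basis. (x \<bullet> b) * g b)" by (simp add: linear_sum[OF lg] linear_cmul[OF lg])
    finally show ?thesis by (simp add: inner_sum_left inner_sum_right inner_commute[of _ x] mult.commute)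
  qed
  have "lf i (hom x) = lf i (0, 1) - (- (\<Sum>b\<in>Basis. g b *\<^sub>R b)) \<bullet> x" for x
  proof -
    have "hom x = (0, 1) + (x, - (x \<bullet> One))" by (simp add: hom_def)
    then have "lf i (hom x) = lf i (0, 1) + g x"
      unfolding g_def using linear_add[OF lin[OF assms], of "(0, 1)" "(x, - (x \<bullet> One))"] by metis
    then show ?thesis unfolding gc[of x] inner_minus_left by linarith
  qed
  then show ?thesis using that by blast
qed

lemma polyhedron_Q: "polyhedron Q"
proof -
  have "polyhedron {x. 0 \<le> lf i (hom x)}" if i: "i \<in> I" for i
  proof -
    obtain c \<beta> where "\<And>x. lf i (hom x) = \<beta> - c \<bullet> x" using l_affine[OF i] by metis
    then have "{x. 0 \<le> lf i (hom x)} = {x. c \<bullet> x \<le> \<beta>}" by auto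
    then show ?thesis using polyhedron_halfspace_le by metis
  qed
  moreover have "Q = \<Inter>((\<lambda>i. {x. 0 \<le> lf i (hom x)}) ` I)" by (auto simp: Q_def)
  ultimately show ?thesis using finI by (auto intro!: polyhedron_Inter)
qed

lemma Q_ineq: "x \<in> Q \<Longrightarrow> 0 \<le> x \<bullet> b0" "\<lbrakk>x \<in> Q; b \<in> Basis - {b0}\<rbrakk> \<Longrightarrow> 0 \<le> x \<bullet> b" "x \<in> Q \<Longrightarrow> x \<bullet> One \<le> 1"
proof -
  have *: "0 \<le> lf i (x, 1 - x \<bullet> One)" if "x \<in> Q" "i \<in> I" for i x using that by (simp add: Q_def hom_def)
  show "0 \<le> x \<bullet> b0" if "x \<in> Q" using *[OF that F0(1)] by (simp only: F0(2))
  show "x \<bullet> One \<le> 1" if "x \<in> Q" using *[OF that Ge(1)] by (simp only: Ge(2))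
  show "0 \<le> x \<bullet> b" if "x \<in> Q" "b \<in> Basis - {b0}" using *[OF that(1), of "Hf b"] Hf[OF that(2)] by simp
qed

lemma polytope_Q: "polytope Q"
proof -
  have "x \<bullet> b \<le> 1 \<and> 0 \<le> x \<bullet> b" if x: "x \<in> Q" and b: "b \<in> Basis" for x b
  proof -
    have nn: "0 \<le> x \<bullet> i" if "i \<in> Basis" for i using Q_ineq[OF x] that by (cases "i = b0") auto
    then have "x \<bullet> b \<le> (\<Sum>i\<in>Basis. x \<bullet> i)" using b by (intro member_le_sum) auto
    also have "\<dots> = x \<bullet> One" by (simp only: inner_sum_right)
    finally show ?thesis using Q_ineq(3)[OF x] nn[OF b] by simp
  qed
  then have "Q \<subseteq> cbox 0 One" by (auto simp: mem_box inner_sum_left_Basis)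
  then have "bounded Q" using bounded_cbox bounded_subset by blast
  then show ?thesis using polyhedron_Q polytope_eq_bounded_polyhedron by blast
qed

text \<open>An average lies on a bounding hyperplane only if all averaged points do. Averaging all
  of J gives an interior point, averaging the vertices of one facet a point on no other
  facet.\<close>

lemma mean_point:
  assumes K: "K \<subseteq> J" "K \<noteq> {}"
  obtains x where "x \<in> Q" "\<And>i. i \<in> I \<Longrightarrow> lf i (hom x) = 0 \<longleftrightarrow> (\<forall>j\<in>K. lf i (h j) = 0)"
proof -
  define x where "x = (\<Sum>j\<in>K. (1 / card K) *\<^sub>R pt j)"
  have finK: "finite K" using K finJ finite_subset by blast
  have c: "card K > 0" using K finK by (simp add: card_gt_0_iff)
  have val: "lf i (hom x) = (\<Sum>j\<in>K. (1 / card K) * lf i (hom (pt j)))" if i: "i \<in> I" for i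
  proof -
    obtain cc \<beta> where g: "\<And>x. lf i (hom x) = \<beta> - cc \<bullet> x" using l_affine[OF i] by metis
    have "(\<Sum>j\<in>K. (1 / card K) * (\<beta> - cc \<bullet> pt j)) = \<beta> - (\<Sum>j\<in>K. (1 / card K) * (cc \<bullet> pt j))"
      using c by (simp add: right_diff_distrib sum_subtractf)
    then show ?thesis unfolding g by (simp add: x_def inner_sum_right)
  qed
  have nn: "0 \<le> (1 / card K) * lf i (hom (pt j))" if "i \<in> I" "j \<in> K" for i j
    using pt_Q[of j] that K by (auto simp: Q_def)
  show ?thesis
  proof (rule that[of x])
    show "x \<in> Q" unfolding Q_def using val nn by (auto intro!: sum_nonneg)
    fix i assume i: "i \<in> I"
    have "lf i (hom x) = 0 \<longleftrightarrow> (\<forall>j\<in>K. (1 / card K) * lf i (hom (pt j)) = 0)"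
      unfolding val[OF i] by (rule sum_nonneg_eq_0_iff[OF finK]) (use nn i in auto)
    also have "\<dots> \<longleftrightarrow> (\<forall>j\<in>K. lf i (h j) = 0)"
      using c l_pt0[OF i] K by auto
    finally show "lf i (hom x) = 0 \<longleftrightarrow> (\<forall>j\<in>K. lf i (h j) = 0)" .
  qed
qed

lemma open_pos: assumes "K \<subseteq> I" shows "open {x. \<forall>i\<in>K. 0 < lf i (hom x)}"
proof -
  have "open {x. 0 < lf i (hom x)}" if i: "i \<in> I" for i
  proof -
    obtain c \<beta> where "\<And>x. lf i (hom x) = \<beta> - c \<bullet> x" using l_affine[OF i] by metis
    then have "{x. 0 < lf i (hom x)} = {x. c \<bullet> x < \<beta>}" by auto
    then show ?thesis using open_halfspace_lt by metis
  qed
  then have "open (\<Inter>i\<in>K. {x. 0 < lf i (hom x)})"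
    using assms finI by (intro open_INT) (auto intro: finite_subset)
  moreover have "(\<Inter>i\<in>K. {x. 0 < lf i (hom x)}) = {x. \<forall>i\<in>K. 0 < lf i (hom x)}" by auto
  ultimately show ?thesis by simp
qed

lemma some_not_on: assumes "i \<in> I" obtains j where "j \<in> J" "lf i (h j) \<noteq> 0"
proof -
  have "F0 \<noteq> Ge" using F0(2)[of 0 1] Ge(2)[of 0 1] by auto
  then obtain i' where "i' \<in> I" "i' \<noteq> i" using F0 Ge by metis
  then show ?thesis using sepI[of i' i] assms that by blast
qed

lemma aff_dim_Q: "aff_dim Q = int DIM('a)" and interior_point: "\<exists>x\<in>Q. \<forall>i\<in>I. 0 < lf i (hom x)"
proof -
  have "J \<noteq> {}" using some_not_on[OF F0(1)] by blast
  then obtain x where x: "x \<in> Q" "\<And>i. i \<in> I \<Longrightarrow> lf i (hom x) = 0 \<longleftrightarrow> (\<forall>j\<in>J. lf i (h j) = 0)"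
    using mean_point[of J] by blast
  have "0 < lf i (hom x)" if i: "i \<in> I" for i
    using x some_not_on[OF i] i unfolding Q_def by (metis (mono_tags, lifting) mem_Collect_eq order_le_less)
  then show ip: "\<exists>x\<in>Q. \<forall>i\<in>I. 0 < lf i (hom x)" using x(1) by blast
  have "open {x. \<forall>i\<in>I. 0 < lf i (hom x)}" by (rule open_pos) simp
  moreover have "{x. \<forall>i\<in>I. 0 < lf i (hom x)} \<subseteq> Q" by (auto simp: Q_def less_imp_le)
  ultimately have "{x. \<forall>i\<in>I. 0 < lf i (hom x)} \<subseteq> interior Q" by (intro interior_maximal)
  then have "interior Q \<noteq> {}" using ip by blast
  then show "aff_dim Q = int DIM('a)" using aff_dim_nonempty_interior by blast
qed

definition Phi where "Phi i = Q \<inter> {x. lf i (hom x) = 0}"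

lemma Phi_face: assumes "i \<in> I" shows "Phi i face_of Q"
proof -
  obtain c \<beta> where g: "\<And>x. lf i (hom x) = \<beta> - c \<bullet> x" using l_affine[OF assms] by metis
  have "Phi i = Q \<inter> {x. c \<bullet> x = \<beta>}" using g by (auto simp: Phi_def)
  moreover have "x \<in> Q \<Longrightarrow> c \<bullet> x \<le> \<beta>" for x using g assms by (force simp: Q_def)
  ultimately show ?thesis
    using face_of_Int_supporting_hyperplane_le[OF polytope_imp_convex[OF polytope_Q]] by simp
qed

text \<open>By \<open>sepI\<close> the average of the vertices on i satisfies all other inequalities
  strictly, so a neighbourhood of it in the hyperplane of i belongs to Q.\<close>

lemma Phi_facet: assumes i: "i \<in> I" shows "Phi i facet_of Q"
proof -
  obtain c \<beta> where g: "\<And>x. lf i (hom x) = \<beta> - c \<bullet> x" using l_affine[OF i] by metis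
  have "\<exists>i'\<in>I. i' \<noteq> i" using F0 Ge by (metis zero_neq_one inner_zero_left)
  then have "{j \<in> J. lf i (h j) = 0} \<noteq> {}" using sepI[OF i] by blast
  then obtain x where x: "x \<in> Q" "\<And>k. k \<in> I \<Longrightarrow> lf k (hom x) = 0 \<longleftrightarrow> (\<forall>j\<in>{j \<in> J. lf i (h j) = 0}. lf k (h j) = 0)"
    using mean_point[of "{j \<in> J. lf i (h j) = 0}"] by blast
  let ?U = "{x. \<forall>k\<in>I - {i}. 0 < lf k (hom x)}"
  have xU: "x \<in> ?U"
  proof (intro CollectI ballI)
    fix k assume k: "k \<in> I - {i}"
    have "lf k (hom x) \<noteq> 0" using x(2)[of k] sepI[OF i, of k] k by blast
    moreover have "0 \<le> lf k (hom x)" using x(1) k by (simp add: Q_def)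
    ultimately show "0 < lf k (hom x)" by simp
  qed
  have x0: "c \<bullet> x = \<beta>" using x(2)[OF i] g[of x] by simp
  obtain y where "y \<in> Q" "0 < lf i (hom y)" using interior_point i by blast
  then have "c \<bullet> y < \<beta>" using g[of y] by simp
  then have c0: "c \<noteq> 0" using x0 by auto
  have "aff_dim ({x. c \<bullet> x = \<beta>} \<inter> ?U) = aff_dim {x. c \<bullet> x = \<beta>}"
    by (rule aff_dim_convex_Int_open) (use open_pos[of "I - {i}"] xU x0 in \<open>auto simp: convex_hyperplane\<close>)
  then have dU: "aff_dim ({x. c \<bullet> x = \<beta>} \<inter> ?U) = int DIM('a) - 1" using c0 by simp
  have "{x. c \<bullet> x = \<beta>} \<inter> ?U \<subseteq> Phi i"
  proof
    fix z assume z: "z \<in> {x. c \<bullet> x = \<beta>} \<inter> ?U"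
    then have "lf i (hom z) = 0" using g[of z] by simp
    moreover have "0 \<le> lf k (hom z)" if "k \<in> I" for k
      using z that \<open>lf i (hom z) = 0\<close> by (cases "k = i") (auto simp: less_imp_le)
    ultimately show "z \<in> Phi i" by (simp add: Phi_def Q_def)
  qed
  then have ge: "int DIM('a) - 1 \<le> aff_dim (Phi i)" unfolding dU[symmetric] by (rule aff_dim_subset)
  have "y \<notin> Phi i" using \<open>0 < lf i (hom y)\<close> by (simp add: Phi_def)
  then have "aff_dim (Phi i) < aff_dim Q"
    using face_of_aff_dim_lt[OF polytope_imp_convex[OF polytope_Q] Phi_face[OF i]] \<open>y \<in> Q\<close> by blast
  then have "aff_dim (Phi i) = aff_dim Q - 1" using ge aff_dim_Q by simp
  moreover have "x \<in> Phi i" using x(1) x0 g[of x] by (simp add: Phi_def)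
  ultimately show ?thesis using Phi_face[OF i] by (auto simp: facet_of_def)
qed

lemma facets_Q: "Y facet_of Q \<longleftrightarrow> (\<exists>i\<in>I. Y = Phi i)"
proof
  assume Y: "Y facet_of Q"
  have cY: "convex Y" by (rule face_of_imp_convex[OF facet_of_imp_face_of[OF Y]])
  have YQ: "Y \<subseteq> Q" by (rule facet_of_imp_subset[OF Y])
  have "Y \<noteq> {}" using Y by (simp add: facet_of_def)
  then obtain x where x: "x \<in> rel_interior Y" using rel_interior_eq_empty[OF cY] by blast
  then have xQ: "x \<in> Q" using rel_interior_subset YQ by blast
  have "\<exists>i\<in>I. lf i (hom x) = 0"
  proof (rule ccontr)
    assume "\<not> ?thesis"
    then have "x \<in> {x. \<forall>i\<in>I. 0 < lf i (hom x)}" using xQ by (auto simp: Q_def order_less_le)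
    moreover have "{x. \<forall>i\<in>I. 0 < lf i (hom x)} \<subseteq> interior Q"
      by (rule interior_maximal) (use open_pos[of I] in \<open>auto simp: Q_def less_imp_le\<close>)
    moreover have "Y \<noteq> Q" using Y by auto
    ultimately show False
      using face_of_disjoint_interior[OF facet_of_imp_face_of[OF Y]] x rel_interior_subset by blast
  qed
  then obtain i where i: "i \<in> I" "lf i (hom x) = 0" by blast
  then have "Phi i \<inter> rel_interior Y \<noteq> {}" using x xQ by (auto simp: Phi_def)
  then have sub: "Y \<subseteq> Phi i" using subset_of_face_of[OF Phi_face[OF i(1)] YQ] by blast
  have "Y face_of Phi i"
    using face_of_subset[OF facet_of_imp_face_of[OF Y] sub] Phi_face[OF i(1)] face_of_imp_subset by blast
  moreover have "aff_dim Y = aff_dim (Phi i)" using Y Phi_facet[OF i(1)] by (simp add: facet_of_def)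
  ultimately have "Y = Phi i"
    using face_of_aff_dim_lt[of "Phi i" Y] face_of_imp_convex[OF Phi_face[OF i(1)]] by fastforce
  then show "\<exists>i\<in>I. Y = Phi i" using i(1) by blast
qed (use Phi_facet in blast)

text \<open>Let k be annihilated by the forms active at x. Its component of total weight zero can be
  added to and subtracted from x in small multiples, so extremality makes it vanish. Thus
  \<open>hom x\<close> spans an extreme ray, and \<open>rays\<close> applies.\<close>

lemma verts_sub: assumes x: "x \<in> verts Q" shows "x \<in> pt ` J"
proof -
  have xQ: "x \<in> Q" using x verts_subset by blast
  have "\<exists>t. k = t *\<^sub>R hom x" if k: "\<forall>i\<in>I. lf i (hom x) = 0 \<longrightarrow> lf i k = 0" for k
  proof -
    define u where "u = fst k - deg k *\<^sub>R x"
    have ku: "k - deg k *\<^sub>R hom x = (u, - (u \<bullet> One))"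
      by (simp add: prod_eq_iff u_def hom_def deg_def inner_diff_left algebra_simps)
    have act: "lf i (u, - (u \<bullet> One)) = 0" if "i \<in> I" "lf i (hom x) = 0" for i
      unfolding ku[symmetric] using that k linear_diff[OF lin[OF that(1)]] linear_cmul[OF lin[OF that(1)]] by simp
    \<comment> \<open>The step length 1/K keeps all inactive inequalities valid.\<close>
    obtain K where K: "0 < K" "\<And>i. i \<in> I \<Longrightarrow> \<bar>lf i (u, - (u \<bullet> One)) / lf i (hom x)\<bar> \<le> K"
      using finite_bound[OF finI, of "\<lambda>i. lf i (u, - (u \<bullet> One)) / lf i (hom x)"] by metis
    have inQ: "x + s *\<^sub>R u \<in> Q" if s: "\<bar>s\<bar> = 1 / K" for s
      unfolding Q_def
    proof (intro CollectI ballI)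
      fix i assume i: "i \<in> I"
      have "hom (x + s *\<^sub>R u) = hom x + s *\<^sub>R (u, - (u \<bullet> One))" by (simp add: hom_def inner_add_left)
      then have e: "lf i (hom (x + s *\<^sub>R u)) = lf i (hom x) + s * lf i (u, - (u \<bullet> One))"
        using linear_add[OF lin[OF i], of "hom x" "s *\<^sub>R (u, - (u \<bullet> One))"]
          linear_cmul[OF lin[OF i], of s "(u, - (u \<bullet> One))"] by (simp only: real_scaleR_def)
      show "0 \<le> lf i (hom (x + s *\<^sub>R u))"
      proof (cases "lf i (hom x) = 0")
        case True then show ?thesis using e act[OF i] by simp
      next
        case False
        then have pos: "0 < lf i (hom x)" using xQ i by (simp add: Q_def order_less_le)
        have "\<bar>lf i (u, - (u \<bullet> One))\<bar> \<le> K * lf i (hom x)"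
          using K(2)[OF i] pos by (simp add: abs_divide pos_divide_le_eq)
        then have "\<bar>s * lf i (u, - (u \<bullet> One))\<bar> \<le> lf i (hom x)"
          unfolding abs_mult s using K(1) by (simp add: pos_divide_le_eq mult.commute)
        then show ?thesis using e by linarith
      qed
    qed
    have "u = 0"
    proof (rule ccontr)
      assume u: "u \<noteq> 0"
      have "x \<in> open_segment (x + (1 / K) *\<^sub>R u) (x + (- 1 / K) *\<^sub>R u)"
        unfolding in_segment using u K(1) by (auto intro!: exI[of _ "1/2"] simp: algebra_simps) (simp flip: scaleR_left_distrib)
      moreover have "x + (1 / K) *\<^sub>R u \<in> Q" "x + (- 1 / K) *\<^sub>R u \<in> Q"
        using inQ[of "1 / K"] inQ[of "- 1 / K"] K(1) by (simp_all del: scaleR_minus_left)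
      ultimately show False using x unfolding verts_def extreme_point_of_def by blast
    qed
    then have "k - deg k *\<^sub>R hom x = 0" using ku by (simp add: zero_prod_def)
    then have "k = deg k *\<^sub>R hom x" by simp
    then show ?thesis by blast
  qed
  moreover have "\<forall>i\<in>I. 0 \<le> lf i (hom x)" using xQ by (simp add: Q_def)
  ultimately obtain j t where j: "j \<in> J" "h j = t *\<^sub>R hom x" using rays[OF hom_ne] by metis
  have "deg (h j) = t * deg (hom x)" using j(2) by (simp add: deg_def distrib_left)
  then have "deg (h j) = t" using deg_hom by simp
  then have "pt j = x" using j deg_h[OF j(1)] by (simp add: pt_def hom_def)
  then show ?thesis using j(1) by blast
qed

text \<open>If \<open>pt j\<close> were not extreme, some other \<open>pt j'\<close> would have
  positive weight in a convex combination giving it. The form that separates j from j' vanishes at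
  the former and is positive at the latter.\<close>

lemma verts_Q: "verts Q = pt ` J"
proof
  show "verts Q \<subseteq> pt ` J" using verts_sub by blast
  show "pt ` J \<subseteq> verts Q"
  proof
    fix x assume "x \<in> pt ` J"
    then obtain j where j: "j \<in> J" "x = pt j" by blast
    show "x \<in> verts Q"
    proof (rule ccontr)
      assume nv: "x \<notin> verts Q"
      have "x \<in> convex hull (verts Q)" using convex_hull_verts[OF polytope_Q] pt_Q[OF j(1)] j(2) by simp
      then obtain w where w: "\<forall>v\<in>verts Q. 0 \<le> w v" "sum w (verts Q) = 1" "(\<Sum>v\<in>verts Q. w v *\<^sub>R v) = x"
        unfolding convex_hull_finite[OF finite_verts[OF polytope_Q]] by blast
      obtain v where v: "v \<in> verts Q" "0 < w v"
      proof -
        have "\<exists>v\<in>verts Q. w v \<noteq> 0" 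
        proof (rule ccontr)
          assume "\<not> ?thesis"
          then have "sum w (verts Q) = 0" by (intro sum.neutral) blast
          then show False using w(2) by simp
        qed
        then show ?thesis using w(1) that by force
      qed
      then obtain j' where j': "j' \<in> J" "v = pt j'" using verts_sub by blast
      then have "j \<noteq> j'" using v(1) nv j(2) by blast
      then obtain i where i: "i \<in> I" "lf i (h j) = 0" "lf i (h j') \<noteq> 0" using sepJ j(1) j'(1) by blast
      obtain c \<beta> where g: "\<And>x. lf i (hom x) = \<beta> - c \<bullet> x" using l_affine[OF i(1)] by metis
      have "lf i (hom x) = (\<Sum>v\<in>verts Q. w v * lf i (hom v))"
      proof -
        have "(\<Sum>v\<in>verts Q. w v * (\<beta> - c \<bullet> v)) = \<beta> * sum w (verts Q) - (\<Sum>v\<in>verts Q. w v * (c \<bullet> v))"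
          by (simp add: right_diff_distrib sum_subtractf sum_distrib_left mult.commute)
        also have "(\<Sum>v\<in>verts Q. w v * (c \<bullet> v)) = c \<bullet> (\<Sum>v\<in>verts Q. w v *\<^sub>R v)" by (simp add: inner_sum_right)
        finally show ?thesis unfolding g using w by simp
      qed
      moreover have "0 \<le> w v' * lf i (hom v')" if "v' \<in> verts Q" for v'
        using w(1) that verts_subset[of Q] i(1) by (auto simp: Q_def)
      ultimately have "w v * lf i (hom v) \<le> lf i (hom x)"
        using member_le_sum[OF v(1), of "\<lambda>v. w v * lf i (hom v)"] finite_verts[OF polytope_Q] by simp
      moreover have "lf i (hom x) = 0" using l_pt0[OF i(1) j(1)] i(2) j(2) by simp
      moreover have "0 < lf i (hom v)"
        using l_pt0[OF i(1) j'(1)] i(3) j'(2) pt_Q[OF j'(1)] i(1) by (auto simp: Q_def order_less_le)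
      ultimately show False using v(2) by (simp add: mult_le_0_iff)
    qed
  qed
qed

lemma facet_family_Q: "facet_family Q = (\<lambda>A. pt ` A) ` ((\<lambda>i. {j\<in>J. lf i (h j) = 0}) ` I)"
proof -
  have "verts Q \<inter> Phi i = pt ` {j\<in>J. lf i (h j) = 0}" if "i \<in> I" for i
    using l_pt0[OF that] pt_Q by (auto simp: verts_Q Phi_def)
  moreover have "{Y. Y facet_of Q} = Phi ` I" using facets_Q by auto
  ultimately show ?thesis unfolding facet_family_def by (simp add: image_image cong: image_cong_simp)
qed

lemma card_verts_Q: "card (verts Q) = card J"
  unfolding verts_Q by (rule card_image[OF inj_pt])

text \<open>In the expansion of \<open>hom x\<close> along (0, 1), the (b, 0) and (b0, 0), the first
  coefficient is positive, the next are nonnegative and the last is negative. By \<open>low\<close>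
  no term of the form is then negative, and the first one is positive.\<close>

lemma low_facets_Q: "low_facets b0 Q"
  unfolding low_facets_def
proof (intro allI impI, elim conjE)
  fix Y assume Y: "Y facet_of Q" "0 \<notin> Y"
  then obtain i where i: "i \<in> I" "Y = Phi i" using facets_Q by blast
  obtain c \<beta> where g: "\<And>x. lf i (hom x) = \<beta> - c \<bullet> x" using l_affine[OF i(1)] by metis
  obtain j where "j \<in> J" "h j = (0, 1)" using origin by blast
  then have zQ: "0 \<in> Q" using pt_Q[of j] by (simp add: pt_def)
  have \<beta>: "lf i (0, 1) = \<beta>" using g[of 0] by (simp add: hom_def)
  have "0 \<le> \<beta>" using zQ i(1) g[of 0] by (auto simp: Q_def)
  moreover have "\<beta> \<noteq> 0" using Y(2) i zQ g[of 0] by (auto simp: Phi_def)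
  ultimately have pos: "0 < \<beta>" by simp
  have iF: "i \<noteq> F0" using \<beta> pos F0(2)[of 0 1] by auto
  have eq: "(c /\<^sub>R \<beta>) \<bullet> x = 1 - lf i (hom x) / \<beta>" for x using g[of x] pos by (simp add: field_simps)
  have "Y = Q \<inter> {x. (c /\<^sub>R \<beta>) \<bullet> x = 1}" unfolding eq i(2) Phi_def using pos by auto
  moreover have "\<forall>x\<in>Q. (c /\<^sub>R \<beta>) \<bullet> x \<le> 1" unfolding eq using pos i(1) by (auto simp: Q_def)
  moreover have "(c /\<^sub>R \<beta>) \<bullet> x < 1" if x: "x \<bullet> b0 < 0" "\<forall>b\<in>Basis - {b0}. 0 \<le> x \<bullet> b" "x \<bullet> One < 1" for x
  proof -
    have "hom x = (1 - x \<bullet> One) *\<^sub>R (0, 1) + ((\<Sum>b\<in>Basis - {b0}. (x \<bullet> b) *\<^sub>R (b, 0)) + (x \<bullet> b0) *\<^sub>R (b0, 0))"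
    proof -
      have "(\<Sum>b\<in>Basis - {b0}. (x \<bullet> b) *\<^sub>R b) + (x \<bullet> b0) *\<^sub>R b0 = x"
        using euclidean_representation[of x] b0 by (simp add: sum.remove[of Basis b0] add.commute)
      moreover have "(\<Sum>b\<in>Basis - {b0}. (x \<bullet> b) *\<^sub>R (b, 0::real)) = (\<Sum>b\<in>Basis - {b0}. (x \<bullet> b) *\<^sub>R b, 0)"
        by (simp add: prod_eq_iff fst_sum snd_sum)
      ultimately show ?thesis by (simp add: hom_def)
    qed
    then have "lf i (hom x) = (1 - x \<bullet> One) * \<beta> + ((\<Sum>b\<in>Basis - {b0}. (x \<bullet> b) * lf i (b, 0)) + (x \<bullet> b0) * lf i (b0, 0))"
      unfolding \<beta>[symmetric] using lin[OF i(1)] by (simp add: linear_add linear_cmul linear_sum del: add_Pair scaleR_Pair)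
    moreover have "0 < (1 - x \<bullet> One) * \<beta>" using x(3) pos by simp
    moreover have "0 \<le> (\<Sum>b\<in>Basis - {b0}. (x \<bullet> b) * lf i (b, 0))"
      using x(2) low(1)[OF i(1)] by (intro sum_nonneg) auto
    moreover have "0 \<le> (x \<bullet> b0) * lf i (b0, 0)"
      using x(1) low(2)[OF i(1) iF] by (simp add: mult_nonpos_nonpos)
    ultimately have "0 < lf i (hom x)" by linarith
    then show ?thesis unfolding eq using pos by simp
  qed
  ultimately show "\<exists>c. Y = Q \<inter> {x. c \<bullet> x = 1} \<and> (\<forall>x\<in>Q. c \<bullet> x \<le> 1) \<and>
      (\<forall>x. x \<bullet> b0 < 0 \<and> (\<forall>b\<in>Basis - {b0}. 0 \<le> x \<bullet> b) \<and> x \<bullet> One < 1 \<longrightarrow> c \<bullet> x < 1)" by blast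
qed

end

subsection \<open>Differences in small set families\<close>

text \<open>Removing the common part loses no information, so the family can be counted among the
  subsets of D.\<close>

lemma trace_inj:
  assumes "finite (\<Union>\<S>)"
  defines "X \<equiv> \<Inter>\<S>" and "D \<equiv> \<Union>\<S> - \<Inter>\<S>"
  assumes ne: "\<S> \<noteq> {}"
  shows "inj_on (\<lambda>S. S - X) \<S>" "(\<lambda>S. S - X) ` \<S> \<subseteq> Pow D" "finite D"
    "S \<in> \<S> \<Longrightarrow> card (S - X) = card S - card X" "S \<in> \<S> \<Longrightarrow> card X \<le> card S"
proof -
  have sub: "X \<subseteq> S" "finite S" if "S \<in> \<S>" for S
    using that assms(1) by (auto simp: X_def intro: finite_subset)
  show "inj_on (\<lambda>S. S - X) \<S>" by (rule inj_onI) (use sub in blast)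
  show "(\<lambda>S. S - X) ` \<S> \<subseteq> Pow D" "finite D" using assms(1) by (auto simp: X_def D_def)
  show "card (S - X) = card S - card X" "card X \<le> card S" if "S \<in> \<S>"
    using sub[OF that] by (auto intro!: card_Diff_subset card_mono intro: finite_subset)
qed

text \<open>This fails from m = 4 on, but with four points of difference a family of at most four
  sets is small enough anyway.\<close>

lemma small_binomial: assumes "1 \<le> m" "m \<le> (3::nat)" shows "m choose l \<le> m"
proof (cases "l \<le> m")
  case True
  have "m \<in> {1,2,3}" using assms by auto
  moreover have "l \<in> {0,1,2,3}" using True assms by auto
  ultimately show ?thesis by (auto simp: numeral_eq_Suc)
qed (simp add: binomial_eq_0)

text \<open>Otherwise the difference set has at most three points, and the traces lie in a single
  level of its power set, which is too small.\<close>

lemma diff_same_card: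
  assumes fin: "finite (\<Union>\<S>)" and l: "\<And>S. S \<in> \<S> \<Longrightarrow> card S = l" and k: "2 \<le> card \<S>" "card \<S> \<le> 4"
  shows "card \<S> \<le> card (\<Union>\<S> - \<Inter>\<S>)"
proof (rule ccontr)
  let ?D = "\<Union>\<S> - \<Inter>\<S>"
  assume "\<not> ?thesis"
  then have m: "card ?D \<le> 3" "card ?D < card \<S>" using k by auto
  have ne: "\<S> \<noteq> {}" using k by auto
  note t = trace_inj[OF fin ne]
  have "(\<lambda>S. S - \<Inter>\<S>) ` \<S> \<subseteq> {Z. Z \<subseteq> ?D \<and> card Z = l - card (\<Inter>\<S>)}" using t(2,4) l by auto
  then have "card ((\<lambda>S. S - \<Inter>\<S>) ` \<S>) \<le> card {Z. Z \<subseteq> ?D \<and> card Z = l - card (\<Inter>\<S>)}"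
    by (rule card_mono[rotated]) (use t(3) in auto)
  then have le: "card \<S> \<le> card ?D choose (l - card (\<Inter>\<S>))"
    using card_image[OF t(1)] n_subsets[OF t(3)] by simp
  then show False
  proof (cases "card ?D = 0")
    case True
    then show ?thesis using le k by (cases "l - card (\<Inter>\<S>)") simp_all
  next
    case False
    then show ?thesis using le m small_binomial[of "card ?D" "l - card (\<Inter>\<S>)"] by simp
  qed
qed

text \<open>The traces lie in two adjacent levels; by Pascal's rule these have together the size of
  one level over one more point.\<close>

lemma diff_two_cards:
  assumes fin: "finite (\<Union>\<S>)" and l: "\<And>S. S \<in> \<S> \<Longrightarrow> card S = l \<or> card S = Suc l" and k: "1 \<le> card \<S>" "card \<S> \<le> 4"
  shows "card \<S> \<le> card (\<Union>\<S> - \<Inter>\<S>) + 1"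
proof (rule ccontr)
  let ?D = "\<Union>\<S> - \<Inter>\<S>" and ?x = "card (\<Inter>\<S>)"
  assume "\<not> ?thesis"
  then have m: "card ?D + 1 \<le> 3" "card ?D + 1 < card \<S>" using k by auto
  have ne: "\<S> \<noteq> {}" using k by auto
  note t = trace_inj[OF fin ne]
  define q where "q = (if ?x \<le> l then l - ?x else 0)"
  let ?Z = "{Z. Z \<subseteq> ?D \<and> card Z = q} \<union> {Z. Z \<subseteq> ?D \<and> card Z = Suc q}"
  have "(\<lambda>S. S - \<Inter>\<S>) ` \<S> \<subseteq> ?Z"
  proof
    fix Z assume "Z \<in> (\<lambda>S. S - \<Inter>\<S>) ` \<S>"
    then obtain S where S: "S \<in> \<S>" "Z = S - \<Inter>\<S>" by blast
    then have "Z \<subseteq> ?D" "card Z = card S - ?x" "?x \<le> card S" using t by auto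
    then show "Z \<in> ?Z" using l[OF S(1)] by (auto simp: q_def)
  qed
  then have "card ((\<lambda>S. S - \<Inter>\<S>) ` \<S>) \<le> card ?Z"
    by (rule card_mono[rotated]) (use t(3) in auto)
  also have "\<dots> \<le> (card ?D choose q) + (card ?D choose Suc q)"
    using card_Un_le[of "{Z. Z \<subseteq> ?D \<and> card Z = q}" "{Z. Z \<subseteq> ?D \<and> card Z = Suc q}"] n_subsets[OF t(3)] by simp
  also have "\<dots> = (card ?D + 1) choose Suc q" by simp
  also have "\<dots> \<le> card ?D + 1" using small_binomial[of "card ?D + 1" "Suc q"] m by simp
  finally show False using m card_image[OF t(1)] by simp
qed

lemma diff_pow:
  assumes fin: "finite (\<Union>\<S>)" and k: "1 \<le> card \<S>"
  shows "card \<S> \<le> 2 ^ card (\<Union>\<S> - \<Inter>\<S>)"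
proof -
  have ne: "\<S> \<noteq> {}" using k by auto
  note t = trace_inj[OF fin ne]
  have "card ((\<lambda>S. S - \<Inter>\<S>) ` \<S>) \<le> card (Pow (\<Union>\<S> - \<Inter>\<S>))"
    by (rule card_mono) (use t in auto)
  then show ?thesis using card_image[OF t(1)] t(3) by (simp add: card_Pow)
qed

lemma diff_general:
  assumes fin: "finite (\<Union>\<S>)" and k: "1 \<le> card \<S>" "card \<S> \<le> 4"
  shows "card \<S> \<le> card (\<Union>\<S> - \<Inter>\<S>) + 2" "card \<S> \<le> 3 \<Longrightarrow> card \<S> \<le> card (\<Union>\<S> - \<Inter>\<S>) + 1"
proof -
  note p = diff_pow[OF fin k(1)]
  show "card \<S> \<le> card (\<Union>\<S> - \<Inter>\<S>) + 2"
  proof (cases "card (\<Union>\<S> - \<Inter>\<S>) \<le> 1")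
    case True
    then have "card (\<Union>\<S> - \<Inter>\<S>) = 0 \<or> card (\<Union>\<S> - \<Inter>\<S>) = 1" by linarith
    then show ?thesis using p by (elim disjE) simp_all
  qed (use k in linarith)
  assume "card \<S> \<le> 3"
  show "card \<S> \<le> card (\<Union>\<S> - \<Inter>\<S>) + 1"
  proof (cases "card (\<Union>\<S> - \<Inter>\<S>) \<le> 1")
    case True
    then have "card (\<Union>\<S> - \<Inter>\<S>) = 0 \<or> card (\<Union>\<S> - \<Inter>\<S>) = 1" by linarith
    then show ?thesis using p by (elim disjE) simp_all
  qed (use \<open>card \<S> \<le> 3\<close> in linarith)
qed

subsection \<open>The incidence structures of the two gadgets\<close>

datatype 'a gvert = Pv nat | Av 'a | Cv 'a | Tv 'a | Tip
datatype 'a gfacet = Far | Lev "'a set" | Cut 'a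

text \<open>Apart from the facet \<open>Far\<close>, the facets are indexed by the vertices of a cube with ground set
  \<open>B\<close> (variant \<open>v = False\<close>), or of a cube truncated at the vertex \<open>B\<close> (variant \<open>v = True\<close>, with
  the new vertices \<open>Cut b\<close>). Conversely \<open>Av b\<close>, \<open>Cv b\<close>, \<open>Tip\<close> are the facets of the (truncated)
  cube, and \<open>Pv s\<close>, \<open>Tv b\<close> are the cells of a subdivision of it.\<close>

fun inc :: "nat \<Rightarrow> 'a gfacet \<Rightarrow> 'a gvert \<Rightarrow> bool" where
  "inc n Far (Pv s) = False"
| "inc n Far (Av b) = True"
| "inc n Far (Cv b) = True"
| "inc n Far (Tv b) = False"
| "inc n Far Tip = True"
| "inc n (Lev S) (Pv s) = (card S = s \<or> card S = Suc s)"
| "inc n (Lev S) (Av b) = (b \<notin> S)"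
| "inc n (Lev S) (Cv b) = (b \<in> S)"
| "inc n (Lev S) (Tv b) = (b \<notin> S \<and> n \<le> card S + 2)"
| "inc n (Lev S) Tip = False"
| "inc n (Cut b) (Pv s) = (n = s + 3)"
| "inc n (Cut b) (Av c) = False"
| "inc n (Cut b) (Cv c) = (c \<noteq> b)"
| "inc n (Cut b) (Tv c) = (c = b)"
| "inc n (Cut b) Tip = True"

text \<open>\<open>Pv s\<close> is the slab between the coordinate sums s and s + 1. Truncation
  leaves two slabs fewer: with n = \<open>card B\<close>, the slab \<open>Pv (n - 3)\<close> reaches
  up to the cut and the simplices \<open>Tv b\<close> fill the rest.\<close>

definition gverts :: "bool \<Rightarrow> 'a set \<Rightarrow> 'a gvert set" where
  "gverts v B = Pv ` {..<(if v then card B - 2 else card B)} \<union> Av ` B \<union> Cv ` B \<union> (if v then insert Tip (Tv ` B) else {})"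

definition gfacets :: "bool \<Rightarrow> 'a set \<Rightarrow> 'a gfacet set" where
  "gfacets v B = insert Far (Lev ` (if v then {S. S \<subset> B} else Pow B)) \<union> (if v then Cut ` B else {})"

definition on :: "bool \<Rightarrow> 'a set \<Rightarrow> 'a gfacet \<Rightarrow> 'a gvert set" where
  "on v B i = {j \<in> gverts v B. inc (card B) i j}"

lemma finite_gverts: "finite B \<Longrightarrow> finite (gverts v B)" by (simp add: gverts_def)

lemma finite_gfacets: "finite B \<Longrightarrow> finite (gfacets v B)"
  unfolding gfacets_def by (auto intro!: finite_imageI finite_subset[of "{S. S \<subset> B}" "Pow B"])

lemma gverts_simps [simp]:
  "Pv s \<in> gverts v B \<longleftrightarrow> s < (if v then card B - 2 else card B)"
  "Av b \<in> gverts v B \<longleftrightarrow> b \<in> B" "Cv b \<in> gverts v B \<longleftrightarrow> b \<in> B"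
  "Tv b \<in> gverts v B \<longleftrightarrow> v \<and> b \<in> B" "Tip \<in> gverts v B \<longleftrightarrow> v"
  by (auto simp: gverts_def)

lemma gfacets_simps [simp]:
  "Far \<in> gfacets v B" "Lev S \<in> gfacets v B \<longleftrightarrow> S \<subseteq> B \<and> (v \<longrightarrow> S \<noteq> B)" "Cut b \<in> gfacets v B \<longleftrightarrow> v \<and> b \<in> B"
  by (auto simp: gfacets_def)

lemma card_gverts:
  assumes "finite B" "3 \<le> card B"
  shows "card (gverts False B) = 3 * card B" "card (gverts True B) + 1 = 4 * card B"
proof -
  let ?n = "card B"
  have A: "card (Av ` B) = ?n" "card (Cv ` B) = ?n" "card (Tv ` B) = ?n" "card (Pv ` {..<k} :: 'a gvert set) = k" for k
    by (simp_all add: card_image inj_on_def)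
  have AC: "card (Av ` B \<union> Cv ` B) = 2 * ?n"
    using assms A by (subst card_Un_disjoint) auto
  have P: "card (Pv ` {..<k} \<union> (Av ` B \<union> Cv ` B)) = k + 2 * ?n" for k
    using assms A AC by (subst card_Un_disjoint) auto
  have "gverts False B = Pv ` {..<?n} \<union> (Av ` B \<union> Cv ` B)" by (auto simp: gverts_def)
  then show "card (gverts False B) = 3 * card B" using P by simp
  have T: "card (insert Tip (Tv ` B)) = ?n + 1" using assms A by (subst card_insert_disjoint) auto
  have "gverts True B = (Pv ` {..<?n - 2} \<union> (Av ` B \<union> Cv ` B)) \<union> insert Tip (Tv ` B)" by (auto simp: gverts_def)
  moreover have "card ((Pv ` {..<?n - 2} \<union> (Av ` B \<union> Cv ` B)) \<union> insert Tip (Tv ` B)) = (?n - 2 + 2 * ?n) + (?n + 1)"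
    using assms P T by (subst card_Un_disjoint) auto
  ultimately show "card (gverts True B) + 1 = 4 * card B" using assms(2) by simp
qed

lemma card_gvert_set_le:
  fixes C :: "'a gvert set"
  assumes "finite C"
  shows "card C \<le> card {s. Pv s \<in> C} + (card {b. Av b \<in> C} + card {b. Cv b \<in> C}) + card {b. Tv b \<in> C} + (if Tip \<in> C then 1 else 0)"
proof -
  let ?P = "Pv ` {s. Pv s \<in> C} :: 'a gvert set" and ?A = "Av ` {b. Av b \<in> C}" and ?D = "Cv ` {b. Cv b \<in> C}" and ?T = "Tv ` {b. Tv b \<in> C}"
  have "C = ?P \<union> (?A \<union> ?D) \<union> ?T \<union> (if Tip \<in> C then {Tip} else {})"
  proof (intro set_eqI iffI)
    fix x assume "x \<in> C" then show "x \<in> ?P \<union> (?A \<union> ?D) \<union> ?T \<union> (if Tip \<in> C then {Tip} else {})"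
      by (cases x) auto
  qed (auto split: if_splits)
  then have "card C = card (?P \<union> (?A \<union> ?D) \<union> ?T \<union> (if Tip \<in> C then {Tip} else {}))" by simp
  also have "\<dots> \<le> card (?P \<union> (?A \<union> ?D) \<union> ?T) + card (if Tip \<in> C then {Tip} else {} :: 'a gvert set)" by (rule card_Un_le)
  also have "card (?P \<union> (?A \<union> ?D) \<union> ?T) \<le> card (?P \<union> (?A \<union> ?D)) + card ?T" by (rule card_Un_le)
  also have "card (?P \<union> (?A \<union> ?D)) \<le> card ?P + (card ?A + card ?D)"
    using card_Un_le[of ?P "?A \<union> ?D"] card_Un_le[of ?A ?D] by linarith
  finally show ?thesis by (simp add: card_image inj_on_def split: if_splits)
qed

text \<open>Common vertices are counted by type. The \<open>Av\<close> lie outside the union of the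
  level sets and the \<open>Cv\<close> inside their intersection, so what remains of B, the
  difference set or with cuts the union of the complements, has to pay for common cells and for the
  number of facets. Common cells in turn restrict the sizes of the level sets.\<close>

lemma common_on_bound:
  fixes B :: "'a set"
  assumes fin: "finite B" and n3: "3 \<le> card B"
    and K: "K \<subseteq> gfacets v B" "2 \<le> card K" "card K \<le> 4"
  shows "card (\<Inter>(on v B ` K)) + card K \<le> card B + 2"
proof -
  define n where "n = card B"
  define C where "C = \<Inter>(on v B ` K)"
  define \<S> where "\<S> = {S. Lev S \<in> K}"
  define T where "T = {b. Cut b \<in> K}"
  define f :: nat where "f = (if Far \<in> K then 1 else 0)"
  have Kne: "K \<noteq> {}" and finK: "finite K" using K(2) by (auto intro: card_ge_0_finite)
  then obtain i where "i \<in> K" by blast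
  then have Csub: "C \<subseteq> gverts v B" by (auto simp: C_def on_def)
  then have finC: "finite C" using finite_gverts[OF fin] finite_subset by blast
  have Ci: "inc n i j" if "i \<in> K" "j \<in> C" for i j using that by (auto simp: C_def on_def n_def)
  have Cv: "j \<in> gverts v B" if "j \<in> C" for j using that Csub by blast
  have Keq: "K = Lev ` \<S> \<union> Cut ` T \<union> (if Far \<in> K then {Far} else {})"
  proof (intro set_eqI iffI)
    fix x assume "x \<in> K" then show "x \<in> Lev ` \<S> \<union> Cut ` T \<union> (if Far \<in> K then {Far} else {})"
      by (cases x) (auto simp: \<S>_def T_def)
  qed (auto simp: \<S>_def T_def split: if_splits)
  have SB: "S \<subseteq> B" "v \<Longrightarrow> S \<subset> B" if "S \<in> \<S>" for S
  proof -
    have "Lev S \<in> gfacets v B" using that K(1) unfolding \<S>_def by blast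
    then show "S \<subseteq> B" "v \<Longrightarrow> S \<subset> B" by (simp_all add: psubset_eq)
  qed
  have TB: "T \<subseteq> B" "T \<noteq> {} \<Longrightarrow> v" using K(1) by (auto simp: T_def)
  have finS: "finite \<S>" "finite T" "finite (\<Union>\<S>)" 
    using fin SB(1) TB(1) by (auto intro: finite_subset[of _ "Pow B"] finite_subset[of _ B])
  have cK: "card K = card \<S> + card T + f"
  proof -
    have "card K = card (Lev ` \<S> \<union> Cut ` T \<union> (if Far \<in> K then {Far} else {}))" using Keq by simp
    also have "\<dots> = card (Lev ` \<S> \<union> Cut ` T) + f"
      using finS by (subst card_Un_disjoint) (auto simp: f_def)
    also have "card (Lev ` \<S> \<union> Cut ` T) = card (Lev ` \<S>) + card (Cut ` T)"
      using finS by (intro card_Un_disjoint) auto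
    finally show ?thesis by (simp add: card_image inj_on_def)
  qed
  let ?P = "{s. Pv s \<in> C}" and ?A = "{b. Av b \<in> C}" and ?D = "{b. Cv b \<in> C}" and ?T = "{b. Tv b \<in> C}"
  let ?X = "\<Inter>\<S>" and ?Y = "\<Union>\<S>"
  have cC: "card C \<le> card ?P + (card ?A + card ?D) + card ?T + (if Tip \<in> C then 1 else 0)"
    by (rule card_gvert_set_le[OF finC])
  have finPT: "finite ?P" "finite ?T"
    using finite_vimageI[OF finC, of Pv] finite_vimageI[OF finC, of Tv] by (auto simp: vimage_def inj_def)
  have farPT: "?P = {}" "?T = {}" if "f = 1"
    using that Ci[of Far "Pv s" for s] Ci[of Far "Tv b" for b] by (auto simp: f_def split: if_splits)
  have levP: "card S = s \<or> card S = Suc s" if "S \<in> \<S>" "s \<in> ?P" for S s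
    using Ci[of "Lev S" "Pv s"] that by (auto simp: \<S>_def)
  have levT: "b \<notin> S" "n \<le> card S + 2" "b \<in> B" "v" "card S < n" if "S \<in> \<S>" "b \<in> ?T" for S b
    using Ci[of "Lev S" "Tv b"] Cv[of "Tv b"] that psubset_card_mono[OF fin SB(2)[OF that(1)]]
    by (auto simp: \<S>_def n_def)
  show ?thesis
  proof (cases "T = {}")
    case True
    have cS: "card K = card \<S> + f" using cK True by simp
    have S1: "1 \<le> card \<S>" using cS K(2) by (auto simp: f_def split: if_splits)
    then obtain S0 where S0: "S0 \<in> \<S>" by fastforce
    have XY: "?X \<subseteq> ?Y" "?Y \<subseteq> B" using S0 SB(1) by auto
    have finX: "finite ?X" using XY finS(3) finite_subset by blast
    have "card ?A \<le> card (B - ?Y)"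
    proof (rule card_mono)
      show "?A \<subseteq> B - ?Y" using Ci[of "Lev S" "Av b" for S b] Cv[of "Av b" for b] by (auto simp: \<S>_def)
    qed (use fin in auto)
    moreover have "card ?D \<le> card ?X"
    proof (rule card_mono)
      show "?D \<subseteq> ?X" using Ci[of "Lev S" "Cv b" for S b] by (auto simp: \<S>_def)
    qed (use finX in auto)
    moreover have "card (B - ?Y) = n - card ?Y" "card (?Y - ?X) = card ?Y - card ?X" "card ?X \<le> card ?Y" "card ?Y \<le> n"
      using XY finX finS(3) fin by (auto simp: n_def card_Diff_subset intro: card_mono)
    ultimately have AD: "card ?A + card ?D + card (?Y - ?X) \<le> n" by linarith
    have tip: "Tip \<notin> C" using Ci[of "Lev S0" Tip] S0 by (auto simp: \<S>_def)
    \<comment> \<open>Each common slab is paid for by a sharper estimate: without one, sizes are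
      arbitrary; one slab leaves two consecutive sizes; two slabs leave a single size.\<close>
    have "card ?P + card ?T + card \<S> + f \<le> card (?Y - ?X) + 2"
    proof (cases "f = 1")
      case True
      then show ?thesis using farPT diff_general(2)[OF finS(3) S1] cS K(3) by simp
    next
      case False
      then have f0: "f = 0" by (auto simp: f_def split: if_splits)
      then have S2: "2 \<le> card \<S>" "card \<S> \<le> 4" using cS K by auto
      have Psub: "?P \<subseteq> {card S0, card S0 - 1}" using levP[OF S0] by fastforce
      have P2: "card ?P \<le> 2" using card_mono[OF _ Psub] card_insert_le_m1[of 2 "{card S0 - 1}" "card S0"] by (auto simp: card_insert_if split: if_splits)
      \<comment> \<open>Two common corner cells b, c leave only \<open>B - {b, c}\<close> as a
        possible level set.\<close>
      have Tle: "card ?T \<le> 1"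
      proof (rule ccontr)
        assume "\<not> card ?T \<le> 1"
        then have "2 \<le> card ?T" by simp
        then obtain b c where bc: "b \<in> ?T" "c \<in> ?T" "b \<noteq> c" by (rule obtain_two)
        have "S = B - {b,c}" if S: "S \<in> \<S>" for S
        proof (rule card_subset_eq)
          show "S \<subseteq> B - {b,c}" using levT(1)[OF S] bc SB(1)[OF S] by blast
          then have "card S \<le> card (B - {b,c})" using fin by (intro card_mono) auto
          moreover have "card (B - {b,c}) = n - 2" using bc levT(3)[OF S] fin by (simp add: n_def card_Diff_subset)
          ultimately show "card S = card (B - {b,c})" using levT(2)[OF S bc(1)] by linarith
        qed (use fin in auto)
        then have "\<S> \<subseteq> {B - {b,c}}" by blast
        then have "card \<S> \<le> 1" using card_mono[of "{B - {b,c}}" \<S>] by simp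
        then show False using S2 by simp
      qed
      show ?thesis
      proof (cases "?T = {}")
        case True
        consider "card ?P = 0" | "card ?P = 1" | "card ?P = 2" using P2 by linarith
        then show ?thesis
        proof cases
          case 1 then show ?thesis using True diff_general(1)[OF finS(3) S1 S2(2)] f0 by simp
        next
          case 2
          then obtain s where "s \<in> ?P" by fastforce
          then show ?thesis using 2 True diff_two_cards[OF finS(3) _ S1 S2(2), of s] levP f0 by simp
        next
          case 3
          then obtain s t where st: "s \<in> ?P" "t \<in> ?P" "s \<noteq> t" using obtain_two[of ?P] by (metis order_refl)
          have "card S = max s t" if "S \<in> \<S>" for S using levP[OF that st(1)] levP[OF that st(2)] st(3) by auto
          then show ?thesis using 3 True diff_same_card[OF finS(3) _ S2, of "max s t"] f0 by simp
        qed
      next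
        case False
        then obtain b where b: "b \<in> ?T" by blast
        \<comment> \<open>A common corner cell leaves only the sizes n - 2 and n - 1. The only
          compatible slab is then \<open>Pv (n - 3)\<close>, and if it is common, all sizes equal n
          - 2.\<close>
        have lv: "card S = n - 2 \<or> card S = Suc (n - 2)" if "S \<in> \<S>" for S using levT[OF that b] n3 by (auto simp: n_def)
        have vv: v using levT(4)[OF S0 b] .
        have P3: "s = n - 3" if "s \<in> ?P" for s
          using Cv[of "Pv s"] that vv lv[OF S0] levP[OF S0 that] n3 by (auto simp: n_def)
        show ?thesis
        proof (cases "?P = {}")
          case True
          then have "card ?P = 0" by (simp only: card.empty)
          then show ?thesis using Tle diff_two_cards[OF finS(3) lv S1 S2(2)] f0 by simp
        next
          case False
          then obtain s where s: "s \<in> ?P" by blast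
          have "?P \<subseteq> {n - 3}" using P3 by blast
          then have "card ?P \<le> 1" using card_mono[of "{n - 3}" ?P] by simp
          moreover have "card S = n - 2" if "S \<in> \<S>" for S
            using levP[OF that s] P3[OF s] lv[OF that] n3 by (auto simp: n_def)
          ultimately show ?thesis using Tle diff_same_card[OF finS(3) _ S2, of "n - 2"] f0 by simp
        qed
      qed
    qed
    then show ?thesis using cC AD tip cS unfolding C_def[symmetric] n_def[symmetric] by simp
  next
    case False
    then obtain b0 where b0: "b0 \<in> T" by blast
    have vv: v using TB False by blast
    have t1: "1 \<le> card T" using b0 finS(2) by (metis One_nat_def Suc_leI card_gt_0_iff empty_iff)
    have cutC: "inc n (Cut b) j" if "b \<in> T" "j \<in> C" for b j using Ci[of "Cut b" j] that by (simp add: T_def)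
    have A0: "?A = {}" using cutC[OF b0, of "Av b" for b] by auto
    have Psub: "?P \<subseteq> {n - 3}" using cutC[OF b0, of "Pv s" for s] by auto
    then have P1: "card ?P \<le> 1" using card_mono[of "{n - 3}" ?P] by simp
    have cutCv: "c \<notin> T" if "Cv c \<in> C" for c using cutC[of c "Cv c"] that by auto
    have Pn: "n = s + 3" if "s \<in> ?P" for s using cutC[OF b0, of "Pv s"] that by simp
    have Tsub: "?T \<subseteq> {b}" if "b \<in> T" for b using cutC[OF that, of "Tv c" for c] by auto
    then have T1: "card ?T \<le> 1" using b0 card_mono[of "{b0}" ?T] by simp
    have Tsing: "T = {b}" if "b \<in> ?T" for b using Tsub that b0 by blast
    have Pf: "card ?P + f \<le> 1" using P1 farPT(1) by (cases "f = 1") (auto simp: f_def split: if_splits)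
    show ?thesis
    proof (cases "\<S> = {}")
      case True
      have ck: "card K = card T + f" using cK True by simp
      have "card ?D \<le> card (B - T)"
      proof (rule card_mono)
        show "?D \<subseteq> B - T" using cutCv Cv[of "Cv b" for b] by auto
      qed (use fin in auto)
      then have D: "card ?D + card T \<le> n" using TB fin finS card_mono[OF fin TB(1)] by (simp add: card_Diff_subset n_def)
      have "?T = {}"
      proof (rule ccontr)
        assume "?T \<noteq> {}"
        then obtain b where "b \<in> ?T" by blast
        then have "card T = 1" using Tsing by simp
        then have "f = 1" using ck K(2) by (auto simp: f_def split: if_splits)
        then show False using farPT(2) \<open>?T \<noteq> {}\<close> by blast
      qed
      then have "card ?T = 0" by (simp only: card.empty)
      then show ?thesis using cC A0 D Pf ck unfolding C_def[symmetric] n_def[symmetric] by (simp split: if_splits)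
    next
      case False
      then obtain S0 where S0: "S0 \<in> \<S>" by blast
      \<comment> \<open>With a cut present no \<open>Av\<close> is common, and the union of the
        complements of the level sets takes over the role of the difference set.\<close>
      define U where "U = (\<Union>S\<in>\<S>. B - S)"
      have UB: "U \<subseteq> B" "finite U" using fin by (auto simp: U_def intro: finite_subset)
      have tip: "Tip \<notin> C" using Ci[of "Lev S0" Tip] S0 by (auto simp: \<S>_def)
      have XB: "?X \<subseteq> B" using S0 SB by blast
      have "card ?D \<le> card (?X - T)"
      proof (rule card_mono)
        show "finite (?X - T)" using XB fin finite_subset by blast
        show "?D \<subseteq> ?X - T" using Ci[of "Lev S" "Cv b" for S b] cutCv by (auto simp: \<S>_def)
      qed
      moreover have "card (?X - T) + card T + card (U - T) = n"
      proof -
        have "B = (?X - T) \<union> T \<union> (U - T)" using XB TB UB S0 by (auto simp: U_def)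
        moreover have "card ((?X - T) \<union> T \<union> (U - T)) = card (?X - T) + card T + card (U - T)"
        proof -
          have "finite (?X - T)" using XB fin finite_subset by blast
          then have "card ((?X - T) \<union> T) = card (?X - T) + card T" using finS by (intro card_Un_disjoint) auto
          moreover have "card (((?X - T) \<union> T) \<union> (U - T)) = card ((?X - T) \<union> T) + card (U - T)"
            using finS UB \<open>finite (?X - T)\<close> by (intro card_Un_disjoint) (auto simp: U_def)
          ultimately show ?thesis by simp
        qed
        ultimately show ?thesis unfolding n_def by metis
      qed
      ultimately have D: "card ?D + card T + card (U - T) \<le> n" by linarith
      have r1: "1 \<le> card \<S>" using S0 finS(1) by (metis One_nat_def Suc_leI card_gt_0_iff empty_iff)
      have rt: "card \<S> + card T + f \<le> 4" using cK K(3) by simp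
      have cB: "card (B - S) = n - card S" if "S \<in> \<S>" for S
        using SB(1)[OF that] finite_subset[OF SB(1)[OF that] fin] by (simp add: card_Diff_subset n_def)
      have Usub: "B - S \<subseteq> U" if "S \<in> \<S>" for S using that by (auto simp: U_def)
      have "card ?P + card ?T + card \<S> + f \<le> card (U - T) + 2"
      proof (cases "?T = {}")
        case False
        then obtain b where b: "b \<in> ?T" by blast
        have T: "T = {b}" by (rule Tsing[OF b])
        have f0: "f = 0" using farPT(2) False by (auto simp: f_def split: if_splits)
        \<comment> \<open>Apart from b the complements are distinct subsets of \<open>U - T\<close>
          with at most one element; a common slab rules out the empty one.\<close>
        let ?N = "\<lambda>S. B - S - {b}"
        have inj: "inj_on ?N \<S>"
        proof (rule inj_onI)
          fix S S' assume S: "S \<in> \<S>" "S' \<in> \<S>" "?N S = ?N S'"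
          have "b \<notin> S" "b \<notin> S'" using levT(1)[OF _ b] S by blast+
          then show "S = S'" using S SB(1)[OF S(1)] SB(1)[OF S(2)] by blast
        qed
        have cN: "card (?N S) = n - card S - 1" if "S \<in> \<S>" for S
          using cB[OF that] levT(1,3)[OF that b] fin by simp
        have NU: "?N S \<subseteq> U - T" if "S \<in> \<S>" for S using Usub[OF that] T by blast
        have sing: "card {{x} |x. x \<in> U - T} = card (U - T)"
        proof -
          have "{{x} |x. x \<in> U - T} = (\<lambda>x. {x}) ` (U - T)" by blast
          then show ?thesis by (simp add: card_image)
        qed
        have fs: "finite {{x} |x. x \<in> U - T}" using UB by (auto simp: setcompr_eq_image)
        show ?thesis
        proof (cases "?P = {}")
          case True
          have "?N ` \<S> \<subseteq> insert {} {{x} |x. x \<in> U - T}"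
          proof
            fix Z assume "Z \<in> ?N ` \<S>"
            then obtain S where S: "S \<in> \<S>" "Z = ?N S" by blast
            have "card Z \<le> 1" using cN[OF S(1)] levT(2)[OF S(1) b] S(2) by simp
            then consider "Z = {}" | x where "Z = {x}" using fin S(2) by (metis card_1_singletonE card_0_eq finite_Diff le_Suc_eq le_zero_eq One_nat_def)
            then show "Z \<in> insert {} {{x} |x. x \<in> U - T}" using NU[OF S(1)] S(2) by cases auto
          qed
          then have "card (?N ` \<S>) \<le> card (insert {} {{x} |x. x \<in> U - T})" using fs by (intro card_mono) auto
          also have "\<dots> \<le> card (U - T) + 1" using fs sing by (simp add: card_insert_if)
          finally have "card \<S> \<le> card (U - T) + 1" using card_image[OF inj] by simp
          moreover have "card ?P = 0" using True by (simp only: card.empty)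
          ultimately show ?thesis using T1 f0 by simp
        next
          case False
          then obtain s where s: "s \<in> ?P" by blast
          have "?N ` \<S> \<subseteq> {{x} |x. x \<in> U - T}"
          proof
            fix Z assume "Z \<in> ?N ` \<S>"
            then obtain S where S: "S \<in> \<S>" "Z = ?N S" by blast
            have "card Z = 1" using cN[OF S(1)] levT(2)[OF S(1) b] levP[OF S(1) s] Pn[OF s] S(2) by auto
            then obtain x where "Z = {x}" using card_1_singletonE by blast
            then show "Z \<in> {{x} |x. x \<in> U - T}" using NU[OF S(1)] S(2) by auto
          qed
          then have "card (?N ` \<S>) \<le> card {{x} |x. x \<in> U - T}" using fs by (intro card_mono) auto
          then have "card \<S> \<le> card (U - T)" using card_image[OF inj] sing by simp
          then show ?thesis using T1 P1 f0 by simp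
        qed
      next
        case True
        then have T0: "card ?T = 0" by (simp only: card.empty)
        have cUT: "card U \<le> card (U - T) + card T"
          using card_mono[of "(U - T) \<union> T" U] card_Un_le[of "U - T" T] UB finS by fastforce
        have Ubig: "m + 1 \<le> card U" if two: "2 \<le> card \<S>" and le: "\<And>S. S \<in> \<S> \<Longrightarrow> m \<le> n - card S" for m
        proof (rule ccontr)
          assume "\<not> m + 1 \<le> card U"
          then have cU: "card U \<le> m" by simp
          have "S = B - U" if S: "S \<in> \<S>" for S
          proof -
            have "B - S = U" by (rule card_seteq[OF UB(2) Usub[OF S]]) (use le[OF S] cB[OF S] cU in simp)
            then show ?thesis using SB(1)[OF S] by blast
          qed
          then have "\<S> \<subseteq> {B - U}" by blast
          then have "card \<S> \<le> 1" using card_mono[of "{B - U}" \<S>] by simp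
          then show False using two by simp
        qed
        have m1: "1 \<le> n - card S" if "S \<in> \<S>" for S
          using psubset_card_mono[OF fin SB(2)[OF that vv]] by (simp add: n_def)
        consider "card \<S> = 1" | "card \<S> = 2" | "card \<S> = 3" using r1 rt t1 by linarith
        then show ?thesis
        proof cases
          case 1 then show ?thesis using Pf T0 by simp
        next
          case 2
          show ?thesis
          proof (cases "?P = {}")
            case True
            then have "card ?P = 0" by (simp only: card.empty)
            moreover have "f = 1 \<Longrightarrow> card T = 1" using rt 2 t1 by simp
            ultimately show ?thesis using T0 2 Ubig[of 1] m1 cUT by (auto simp: f_def split: if_splits)
          next
            case False
            then obtain s where s: "s \<in> ?P" by blast
            have "2 \<le> n - card S" if "S \<in> \<S>" for S using levP[OF that s] Pn[OF s] by auto
            then have "2 + 1 \<le> card U" using Ubig[of 2] 2 by simp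
            moreover have "1 \<le> card ?P" using s finPT(1) by (metis One_nat_def Suc_leI card_gt_0_iff empty_iff)
            ultimately show ?thesis using T0 2 cUT rt Pf by simp
          qed
        next
          case 3
          then have f0: "f = 0" "card T = 1" using rt t1 by auto
          show ?thesis
          proof (cases "?P = {}")
            case True
            then have "card ?P = 0" by (simp only: card.empty)
            moreover have "1 + 1 \<le> card U" using Ubig[of 1] m1 3 by simp
            ultimately show ?thesis using T0 3 cUT f0 by simp
          next
            case False
            then obtain s where s: "s \<in> ?P" by blast
            have "2 \<le> n - card S" if "S \<in> \<S>" for S using levP[OF that s] Pn[OF s] by auto
            then have "2 + 1 \<le> card U" using Ubig[of 2] 3 by simp
            then show ?thesis using T0 3 cUT f0 P1 by simp
          qed
        qed
      qed
      then show ?thesis using cC A0 D tip cK unfolding C_def[symmetric] n_def[symmetric] by simp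
    qed
  qed
qed

lemma gfacet_cases:
  assumes "i \<in> gfacets v B"
  obtains "i = Far" | S where "i = Lev S" "S \<subseteq> B" "v \<Longrightarrow> S \<noteq> B" | b where "i = Cut b" "v" "b \<in> B"
  using assms by (cases i) auto

lemma mem_on: "j \<in> on v B i \<longleftrightarrow> j \<in> gverts v B \<and> inc (card B) i j" by (simp add: on_def)

lemma spread_on:
  assumes "finite B" "3 \<le> card B"
  shows "spread (card B + 1) (on v B ` gfacets v B)"
  unfolding spread_def
proof (intro allI impI, elim conjE)
  fix \<G> assume \<G>: "\<G> \<subseteq> on v B ` gfacets v B" "2 \<le> card \<G>" "card \<G> \<le> 4"
  obtain K where K: "K \<subseteq> gfacets v B" "inj_on (on v B) K" "\<G> = on v B ` K"
    using \<G>(1) unfolding subset_image_inj by blast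
  then have "card \<G> = card K" by (simp add: card_image)
  then show "card (\<Inter>\<G>) + card \<G> \<le> card B + 1 + 1"
    using common_on_bound[OF assms K(1)] \<G> unfolding K(3) by simp
qed

text \<open>The \<open>Av\<close> and \<open>Cv\<close> detect membership in a level set, the cells
  \<open>Pv\<close> and \<open>Tv\<close> avoid \<open>Far\<close>, and \<open>Tip\<close> avoids
  all level sets. Separation is what makes every inequality define a facet of its own.\<close>

lemma facet_separation:
  assumes n3: "3 \<le> card B" and i: "i \<in> gfacets v B" "i' \<in> gfacets v B" "i \<noteq> i'"
  shows "\<exists>j\<in>gverts v B. inc (card B) i j \<and> \<not> inc (card B) i' j"
proof -
  have fB: "finite B" using n3 card.infinite by force
  have Bne: "B \<noteq> {}" using n3 by auto
  have two: "\<exists>c\<in>B. c \<noteq> b" for b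
  proof (rule ccontr)
    assume "\<not> ?thesis"
    then have "B \<subseteq> {b}" by blast
    then have "card B \<le> 1" using card_mono[of "{b}" B] by simp
    then show False using n3 by simp
  qed
  show ?thesis
    using i(1)
  proof (cases rule: gfacet_cases)
    case 1
    show ?thesis using i(2)
    proof (cases rule: gfacet_cases)
      case 1 then show ?thesis using \<open>i = Far\<close> i(3) by simp
    next
      case (2 S)
      then have "\<exists>b\<in>B. inc (card B) (Lev S) (if b \<in> S then Cv b else Av b)" using Bne by auto
      obtain b where "b \<in> B" using Bne by blast
      then show ?thesis using 1 2
        by (intro bexI[of _ "if b \<in> S then Av b else Cv b"]) auto
    next
      case (3 b) then show ?thesis using 1 by (intro bexI[of _ "Av b"]) auto
    qed
  next
    case (2 S)
    show ?thesis using i(2)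
    proof (cases rule: gfacet_cases)
      case 1
      have cS: "card S \<le> card B" using 2 fB by (simp add: card_mono)
      show ?thesis
      proof (cases "v \<and> card B \<le> card S + 2")
        case True
        then obtain b where "b \<in> B" "b \<notin> S" using 2 by blast
        then show ?thesis using True 1 2 by (intro bexI[of _ "Tv b"]) auto
      next
        case False
        then show ?thesis using 1 2 cS n3
          by (intro bexI[of _ "Pv (if card S = 0 then 0 else card S - 1)"]) auto
      qed
    next
      case (2 S')
      then have "S \<noteq> S'" using i(3) \<open>i = Lev S\<close> by simp
      then obtain b where "b \<in> S \<longleftrightarrow> b \<notin> S'" by blast
      then show ?thesis using 2 \<open>i = Lev S\<close> \<open>S \<subseteq> B\<close>
        by (intro bexI[of _ "if b \<in> S then Cv b else Av b"]) auto
    next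
      case (3 b)
      then obtain c where "c \<in> B" "c \<notin> S" using 2 by blast
      then show ?thesis using 2 3 by (intro bexI[of _ "Av c"]) auto
    qed
  next
    case (3 b)
    show ?thesis using i(2)
    proof (cases rule: gfacet_cases)
      case 1 then show ?thesis using 3 by (intro bexI[of _ "Tv b"]) auto
    next
      case (2 S) then show ?thesis using 3 by (intro bexI[of _ Tip]) auto
    next
      case (3 c) then show ?thesis using \<open>i = Cut b\<close> i(3) by (intro bexI[of _ "Cv c"]) auto
    qed
  qed
qed

lemma vertex_separation:
  assumes n3: "3 \<le> card B" and j: "j \<in> gverts v B" "j' \<in> gverts v B" "j \<noteq> j'"
  shows "\<exists>i\<in>gfacets v B. inc (card B) i j \<and> \<not> inc (card B) i j'"
proof -
  have fB: "finite B" using n3 card.infinite by force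
  have sub: "\<exists>S\<subseteq>B. card S = s" if "s \<le> card B" for s using obtain_subset_with_card_n[OF that] by metis
  have sub1: "\<exists>S\<subseteq>B. b \<in> S \<and> card S = s" if "s \<le> card B" "1 \<le> s" "b \<in> B" for s b
  proof -
    have "s - 1 \<le> card (B - {b})" using that fB by simp
    then obtain S where S: "S \<subseteq> B - {b}" "card S = s - 1" using obtain_subset_with_card_n by metis
    moreover have "finite S" "b \<notin> S" using S(1) fB finite_subset by auto
    ultimately show ?thesis using that by (intro exI[of _ "insert b S"]) auto
  qed
  have sub0: "\<exists>S\<subseteq>B. b \<notin> S \<and> card S = s" if "s < card B" "b \<in> B" for s b
  proof -
    have "s \<le> card (B - {b})" using that fB by simp
    then obtain S where "S \<subseteq> B - {b}" "card S = s" using obtain_subset_with_card_n by metis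
    then show ?thesis by blast
  qed
  have two: "\<exists>c\<in>B. c \<noteq> b" for b
  proof (rule ccontr)
    assume "\<not> ?thesis"
    then have "B \<subseteq> {b}" by blast
    then have "card B \<le> 1" using card_mono[of "{b}" B] by simp
    then show False using n3 by simp
  qed
  have card1: "card (B - {b}) = card B - 1" if "b \<in> B" for b using that fB by simp
  have card2: "card (B - {b, c}) = card B - 2" if "b \<in> B" "c \<in> B" "b \<noteq> c" for b c
    using that fB by (simp add: card_Diff_subset)
  show ?thesis
  proof (cases j)
    case (Pv s)
    have s: "Suc s \<le> card B" "v \<Longrightarrow> s + 3 \<le> card B" using Pv j(1) n3 by (auto split: if_splits)
    show ?thesis
    proof (cases j')
      case (Pv t)
      have "s \<noteq> t" using Pv \<open>j = Pv s\<close> j(3) by simp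
      then have "\<exists>k. (k = s \<or> k = Suc s) \<and> k \<noteq> t \<and> k \<noteq> Suc t" by presburger
      then obtain k where k: "k = s \<or> k = Suc s" "k \<noteq> t" "k \<noteq> Suc t" by blast
      then obtain S where "S \<subseteq> B" "card S = k" using sub[of k] s by auto
      then show ?thesis using k Pv \<open>j = Pv s\<close> s by (intro bexI[of _ "Lev S"]) auto
    next
      case (Av b)
      then have "b \<in> B" using j(2) by simp
      then obtain S where "S \<subseteq> B" "b \<in> S" "card S = Suc s" using sub1[of "Suc s" b] s by auto
      then show ?thesis using Av Pv s by (intro bexI[of _ "Lev S"]) auto
    next
      case (Cv b)
      then have "b \<in> B" using j(2) by simp
      then obtain S where "S \<subseteq> B" "b \<notin> S" "card S = s" using sub0[of s b] s by auto
      then show ?thesis using Cv Pv s by (intro bexI[of _ "Lev S"]) auto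
    next
      case (Tv b)
      then have b: "b \<in> B" v using j(2) by auto
      then obtain S where "S \<subseteq> B" "b \<in> S" "card S = Suc s" using sub1[of "Suc s" b] s by auto
      then show ?thesis using Tv Pv s b by (intro bexI[of _ "Lev S"]) auto
    next
      case Tip
      then have v using j(2) by simp
      obtain S where "S \<subseteq> B" "card S = s" using sub[of s] s by auto
      then show ?thesis using Tip Pv s \<open>v\<close> by (intro bexI[of _ "Lev S"]) auto
    qed
  next
    case (Av b)
    then have b: "b \<in> B" using j(1) by simp
    show ?thesis
    proof (cases "(\<exists>s. j' = Pv s) \<or> (\<exists>c. j' = Tv c)")
      case True then show ?thesis using Av by (intro bexI[of _ Far]) auto
    next
      case False
      show ?thesis
      proof (cases j')
        case (Av c)
        then show ?thesis using \<open>j = Av b\<close> j b by (intro bexI[of _ "Lev {c}"]) (use n3 in auto)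
      next
        case (Cv c)
        then show ?thesis using \<open>j = Av b\<close> j b by (intro bexI[of _ "Lev {}"]) (use n3 in auto)
      next
        case Tip
        then show ?thesis using \<open>j = Av b\<close> j b by (intro bexI[of _ "Lev {}"]) (use n3 in auto)
      qed (use False in auto)
    qed
  next
    case (Cv b)
    then have b: "b \<in> B" using j(1) by simp
    show ?thesis
    proof (cases "(\<exists>s. j' = Pv s) \<or> (\<exists>c. j' = Tv c)")
      case True then show ?thesis using Cv by (intro bexI[of _ Far]) auto
    next
      case False
      have one: "{b} \<noteq> B" using two[of b] by blast
      show ?thesis
      proof (cases j')
        case (Av c)
        show ?thesis
        proof (cases "c = b")
          case True
          then show ?thesis using Av \<open>j = Cv b\<close> j b one by (intro bexI[of _ "Lev {b}"]) auto
        next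
          case False
          then have "card {b, c} = 2" by simp
          then have "{b, c} \<noteq> B" using n3 by auto
          then show ?thesis using Av \<open>j = Cv b\<close> j b by (intro bexI[of _ "Lev {b, c}"]) auto
        qed
      next
        case (Cv c)
        then show ?thesis using \<open>j = Cv b\<close> j b one by (intro bexI[of _ "Lev {b}"]) auto
      next
        case Tip
        then show ?thesis using \<open>j = Cv b\<close> j b one by (intro bexI[of _ "Lev {b}"]) auto
      qed (use False in auto)
    qed
  next
    case (Tv b)
    then have b: "b \<in> B" v using j(1) by auto
    show ?thesis
    proof (cases j')
      case (Pv s)
      then have "s + 3 \<le> card B" using j(2) b n3 by auto
      then show ?thesis using Tv Pv b card1[OF b(1)] n3 by (intro bexI[of _ "Lev (B - {b})"]) auto
    next
      case (Av c)
      then show ?thesis using Tv b by (intro bexI[of _ "Cut b"]) auto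
    next
      case (Cv c)
      then have c: "c \<in> B" using j(2) by simp
      show ?thesis
      proof (cases "c = b")
        case True then show ?thesis using Tv Cv b by (intro bexI[of _ "Cut b"]) auto
      next
        case False
        then show ?thesis using Tv Cv b c card2[OF b(1) c] by (intro bexI[of _ "Lev (B - {b, c})"]) auto
      qed
    next
      case (Tv c)
      then show ?thesis using \<open>j = Tv b\<close> b j(3) by (intro bexI[of _ "Cut b"]) auto
    next
      case Tip
      then show ?thesis using Tv b card1[OF b(1)] by (intro bexI[of _ "Lev (B - {b})"]) auto
    qed
  next
    case Tip
    then have v using j(1) by simp
    show ?thesis
    proof (cases "(\<exists>s. j' = Pv s) \<or> (\<exists>c. j' = Tv c)")
      case True then show ?thesis using Tip by (intro bexI[of _ Far]) auto
    next
      case False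
      show ?thesis
      proof (cases j')
        case (Av c)
        then show ?thesis using Tip j \<open>v\<close> by (intro bexI[of _ "Cut c"]) auto
      next
        case (Cv c)
        then show ?thesis using Tip j \<open>v\<close> by (intro bexI[of _ "Cut c"]) auto
      qed (use False Tip j in auto)
    qed
  qed
qed

subsection \<open>Ports and walks of the gadgets\<close>

context
  fixes B :: "'a set" assumes n3: "3 \<le> card B"
begin

lemma finite_ground: "finite B" using n3 card.infinite by force

lemma card_minus1: "b \<in> B \<Longrightarrow> card (B - {b}) = card B - 1" using finite_ground by simp

lemma card_minus2: "\<lbrakk>b \<in> B; c \<in> B; b \<noteq> c\<rbrakk> \<Longrightarrow> card (B - {b, c}) = card B - 2"
  using finite_ground by (simp add: card_Diff_subset)

text \<open>The last slab is the simplex on the cube vertex B and its n neighbours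
  \<open>B - {b}\<close>. Dually it is a simple vertex, and B, which lies on the n cube facets
  \<open>Cv b\<close> and on this slab only, gives the simplex facet.\<close>

lemma cube_bottom:
  "port (on False B ` gfacets False B) B (Pv (card B - 1)) (Pv (card B - 2)) Cv (\<lambda>b. on False B (Lev (B - {b})))"
  "on False B (Lev B) = insert (Pv (card B - 1)) (Cv ` B)"
proof -
  show F: "on False B (Lev B) = insert (Pv (card B - 1)) (Cv ` B)"
    using n3 by (intro set_eqI, case_tac x) (auto simp: mem_on)
  show "port (on False B ` gfacets False B) B (Pv (card B - 1)) (Pv (card B - 2)) Cv (\<lambda>b. on False B (Lev (B - {b})))"
    unfolding port_def
  proof (intro conjI ballI impI)
    show "insert (Pv (card B - 1)) (Cv ` B) \<in> on False B ` gfacets False B" unfolding F[symmetric] by (rule imageI) simp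
    fix b assume b: "b \<in> B"
    show "on False B (Lev (B - {b})) \<in> on False B ` gfacets False B" by (rule imageI) auto
    show "Pv (card B - 1) \<in> on False B (Lev (B - {b}))" "Pv (card B - 2) \<in> on False B (Lev (B - {b}))"
      "Cv ` (B - {b}) \<subseteq> on False B (Lev (B - {b}))" "Cv b \<notin> on False B (Lev (B - {b}))"
      using card_minus1[OF b] n3 by (auto simp: mem_on)
  next
    fix A assume "A \<in> on False B ` gfacets False B" "Pv (card B - 1) \<in> A"
    then obtain S where S: "A = on False B (Lev S)" "S \<subseteq> B" "card S = card B - 1 \<or> card S = card B"
      using n3 by (auto simp: gfacets_def mem_on)
    show "A = insert (Pv (card B - 1)) (Cv ` B) \<or> A \<in> (\<lambda>b. on False B (Lev (B - {b}))) ` B"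
    proof (cases "card S = card B")
      case True
      then have "S = B" using card_subset_eq[OF finite_ground S(2)] by simp
      then show ?thesis using S(1) F by simp
    next
      case False
      then have "card (B - S) = 1"
        using S n3 finite_subset[OF S(2) finite_ground] by (simp add: card_Diff_subset)
      then obtain b where "B - S = {b}" using card_1_singletonE by blast
      then have "b \<in> B" "S = B - {b}" using S(2) by auto
      then show ?thesis using S(1) by blast
    qed
  qed (use n3 in \<open>auto simp: inj_on_def\<close>)
qed

lemma cube_top:
  "port (on False B ` gfacets False B) B (Pv 0) (Pv 1) Av (\<lambda>b. on False B (Lev {b}))"
  "on False B (Lev {}) = insert (Pv 0) (Av ` B)"
proof -
  show F: "on False B (Lev {}) = insert (Pv 0) (Av ` B)"
    using n3 by (intro set_eqI, case_tac x) (auto simp: mem_on)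
  show "port (on False B ` gfacets False B) B (Pv 0) (Pv 1) Av (\<lambda>b. on False B (Lev {b}))"
    unfolding port_def
  proof (intro conjI ballI impI)
    show "insert (Pv 0) (Av ` B) \<in> on False B ` gfacets False B" unfolding F[symmetric] by (rule imageI) simp
    fix b assume b: "b \<in> B"
    show "on False B (Lev {b}) \<in> on False B ` gfacets False B" using b by (intro imageI) auto
    show "Pv 0 \<in> on False B (Lev {b})" "Pv 1 \<in> on False B (Lev {b})"
      "Av ` (B - {b}) \<subseteq> on False B (Lev {b})" "Av b \<notin> on False B (Lev {b})"
      using b n3 by (auto simp: mem_on)
  next
    fix A assume "A \<in> on False B ` gfacets False B" "Pv 0 \<in> A"
    then obtain S where S: "A = on False B (Lev S)" "S \<subseteq> B" "card S = 0 \<or> card S = 1"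
      using n3 by (auto simp: gfacets_def mem_on)
    then consider "S = {}" | b where "S = {b}"
      using finite_subset[OF S(2) finite_ground] by (metis card_0_eq card_1_singletonE)
    then show "A = insert (Pv 0) (Av ` B) \<or> A \<in> (\<lambda>b. on False B (Lev {b})) ` B"
      using S F by cases auto
  qed (use n3 in \<open>auto simp: inj_on_def\<close>)
qed

text \<open>A step follows an edge of the cube from S to \<open>insert b S\<close>, exchanging the
  cube facet \<open>Av b\<close> for \<open>Cv b\<close> with \<open>Far\<close> fixed. When every
  label has been flipped once, B is reached.\<close>

lemma cube_walk_aux:
  assumes "distinct bs" "set bs \<inter> S = {}" "set bs \<union> S = B"
  shows "walk (on False B ` gfacets False B) B (on False B Far) bs
    (on False B (Lev S)) (\<lambda>b. if b \<in> S then Cv b else Av b) (on False B (Lev B)) (\<lambda>b. if b \<in> B then Cv b else Av b)"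
  using assms
proof (induction bs arbitrary: S)
  case Nil then show ?case by (auto intro: walk.intros)
next
  case (Cons b bs)
  have b: "b \<in> B" "b \<notin> S" "S \<subseteq> B" using Cons.prems by auto
  have finS: "finite S" using b(3) finite_ground finite_subset by blast
  have "card (insert b S) \<le> card B" using b finite_ground by (intro card_mono) auto
  then have cS: "card S < card B" using b finS by simp
  show ?case
  proof (rule walk_Cons)
    show "on False B (Lev (insert b S)) \<in> on False B ` gfacets False B" using b by (intro imageI) auto
    have "Pv (card S) \<in> on False B (Lev (insert b S))" using b finS cS by (simp add: mem_on)
    moreover have "Pv (card S) \<notin> on False B Far" by (simp add: mem_on)
    ultimately show "on False B (Lev (insert b S)) \<noteq> on False B Far" by blast
    have "Cv b \<in> on False B (Lev (insert b S))" "Cv b \<notin> on False B (Lev S)" using b by (auto simp: mem_on)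
    then show "on False B (Lev (insert b S)) \<noteq> on False B (Lev S)" by blast
    show "(\<lambda>b. if b \<in> S then Cv b else Av b) ` (B - {b}) \<subseteq> on False B (Lev (insert b S))"
      by (auto simp: mem_on)
    show "Cv b \<in> on False B (Lev (insert b S)) \<inter> on False B Far" using b by (auto simp: mem_on)
    show "Cv b \<notin> (\<lambda>b. if b \<in> S then Cv b else Av b) ` (B - {b})" by (auto split: if_splits)
    have "(\<lambda>b'. if b' \<in> S then Cv b' else Av b')(b := Cv b) = (\<lambda>b'. if b' \<in> insert b S then Cv b' else Av b')"
      by auto
    then show "walk (on False B ` gfacets False B) B (on False B Far) bs (on False B (Lev (insert b S)))
        ((\<lambda>b. if b \<in> S then Cv b else Av b)(b := Cv b)) (on False B (Lev B)) (\<lambda>b. if b \<in> B then Cv b else Av b)"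
      using Cons.IH[of "insert b S"] Cons.prems by auto
  qed (use b in auto)
qed

lemma cube_walk:
  assumes "distinct bs" "set bs = B"
  shows "walk (on False B ` gfacets False B) B (on False B Far) bs
    (insert (Pv 0) (Av ` B)) Av (insert (Pv (card B - 1)) (Cv ` B)) (\<lambda>b. if b \<in> B then Cv b else Av b)"
  using cube_walk_aux[of bs "{}"] assms unfolding cube_bottom(2) cube_top(2) by simp

abbreviation tlab :: "'a \<Rightarrow> 'a \<Rightarrow> 'a gvert" where "tlab e \<equiv> (\<lambda>b. if b = e then Av e else Cv b)"

text \<open>\<open>Tv e\<close> is the simplex on \<open>Cut e\<close>, \<open>B - {e}\<close> and
  the \<open>B - {e, b}\<close>. The labels list the cube facets at the vertex
  \<open>B - {e}\<close>: \<open>Av e\<close>, and \<open>Cv b\<close> for the other b.\<close>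

lemma trunc_port:
  assumes e: "e \<in> B"
  shows "port (on True B ` gfacets True B) B (Tv e) (Pv (card B - 3)) (tlab e)
      (\<lambda>b. on True B (if b = e then Cut e else Lev (B - {e, b})))"
    "on True B (Lev (B - {e})) = insert (Tv e) (tlab e ` B)"
proof -
  have c1: "card (B - {e}) = card B - 1" by (rule card_minus1[OF e])
  show F: "on True B (Lev (B - {e})) = insert (Tv e) (tlab e ` B)"
    using n3 e c1 by (intro set_eqI, case_tac x) (auto simp: mem_on image_iff split: if_splits)
  show "port (on True B ` gfacets True B) B (Tv e) (Pv (card B - 3)) (tlab e)
      (\<lambda>b. on True B (if b = e then Cut e else Lev (B - {e, b})))"
    unfolding port_def
  proof (intro conjI ballI impI)
    show "insert (Tv e) (tlab e ` B) \<in> on True B ` gfacets True B"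
      unfolding F[symmetric] using e by (intro imageI) auto
    fix b assume b: "b \<in> B"
    let ?H = "on True B (if b = e then Cut e else Lev (B - {e, b}))"
    show "?H \<in> on True B ` gfacets True B" using b e by (intro imageI) auto
    show "Tv e \<in> ?H" "Pv (card B - 3) \<in> ?H" "tlab e ` (B - {b}) \<subseteq> ?H" "tlab e b \<notin> ?H"
      using b e n3 card_minus2[of e b] by (auto simp: mem_on)
  next
    fix A assume A: "A \<in> on True B ` gfacets True B" "Tv e \<in> A"
    then obtain i where i: "i \<in> gfacets True B" "A = on True B i" by blast
    from i(1) show "A = insert (Tv e) (tlab e ` B) \<or> A \<in> (\<lambda>b. on True B (if b = e then Cut e else Lev (B - {e, b}))) ` B"
    proof (cases rule: gfacet_cases)
      case 1 then show ?thesis using A(2) i(2) by (simp add: mem_on)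
    next
      case (2 S)
      then have S: "e \<notin> S" "card B \<le> card S + 2" "S \<subseteq> B" using A(2) i(2) by (auto simp: mem_on)
      have fS: "finite S" using S(3) finite_ground finite_subset by blast
      have "card ((B - {e}) - S) \<le> 1"
        using S e c1 fS finite_ground by (subst card_Diff_subset) auto
      then consider "(B - {e}) - S = {}" | b where "(B - {e}) - S = {b}"
        using finite_ground by (metis card_0_eq card_1_singletonE finite_Diff le_Suc_eq le_zero_eq One_nat_def)
      then show ?thesis
      proof cases
        case 1
        then have "S = B - {e}" using S by blast
        then show ?thesis using F i(2) 2(1) by simp
      next
        case (2 b)
        then have "b \<in> B" "b \<noteq> e" "S = B - {e, b}" using S by blast+
        then show ?thesis using i(2) \<open>i = Lev S\<close> by (intro disjI2 image_eqI[of _ _ b]) auto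
      qed
    next
      case (3 b)
      then have "b = e" using A(2) i(2) by (simp add: mem_on)
      then show ?thesis using i(2) 3 by (intro disjI2 image_eqI[of _ _ e]) auto
    qed
  qed (use n3 in \<open>auto simp: inj_on_def split: if_splits\<close>)
qed

text \<open>Both ports of this gadget sit at the truncated corner, in different simplices. Two flips
  suffice: from \<open>B - {e'}\<close> through \<open>B - {e, e'}\<close> to
  \<open>B - {e}\<close>.\<close>

lemma trunc_walk:
  assumes e: "e \<in> B" "e' \<in> B" "e \<noteq> e'"
  shows "walk (on True B ` gfacets True B) B (on True B Far) [e, e']
    (insert (Tv e') (tlab e' ` B)) (tlab e') (insert (Tv e) (tlab e ` B)) (tlab e)"
proof -
  let ?G = "on True B Far" and ?Y = "on True B (Lev (B - {e, e'}))"
  have c2: "card (B - {e, e'}) = card B - 2" by (rule card_minus2[OF e])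
  let ?L = "on True B (Lev (B - {e}))" and ?L' = "on True B (Lev (B - {e'}))"
  have mems: "?Y \<in> on True B ` gfacets True B" "?L \<in> on True B ` gfacets True B"
    using e by (auto intro!: imageI)
  have "Tv e \<in> ?Y" "Tv e \<in> ?L" "Tv e \<notin> ?G" using e c2 card_minus1[OF e(1)] by (auto simp: mem_on)
  then have ne1: "?Y \<noteq> ?G" "?L \<noteq> ?G" by blast+
  have "Av e \<in> ?Y" "Av e \<notin> ?L'" "Cv e' \<in> ?L" "Cv e' \<notin> ?Y" using e by (auto simp: mem_on)
  then have ne2: "?Y \<noteq> ?L'" "?L \<noteq> ?Y" by blast+
  note F = trunc_port(2)[OF e(1)] and F' = trunc_port(2)[OF e(2)]
  have upd: "((tlab e')(e := Av e))(e' := Cv e') = tlab e" using e(3) by auto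
  have w: "walk (on True B ` gfacets True B) B ?G [e'] ?Y ((tlab e')(e := Av e)) ?L (tlab e)"
    by (rule walk_Cons[OF e(2) mems(2) ne1(2) ne2(2), of _ "Cv e'"])
      (use e upd in \<open>auto simp: mem_on walk_Nil split: if_splits\<close>)
  show ?thesis
    unfolding F[symmetric] F'[symmetric]
    by (rule walk_Cons[OF e(1) mems(1) ne1(1) ne2(1) _ _ _ w])
      (use e in \<open>auto simp: mem_on split: if_splits\<close>)
qed

text \<open>The facets of the cube and of the truncated cube; the truncation facet
  \<open>Tip\<close> is the one vertex that tells the two letters apart.\<close>

lemma far_facet:
  "on False B Far = Av ` B \<union> Cv ` B" "on True B Far = insert Tip (Av ` B \<union> Cv ` B)"
  "card (on False B Far) = 2 * card B" "card (on True B Far) = 2 * card B + 1"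
proof -
  show F: "on False B Far = Av ` B \<union> Cv ` B" "on True B Far = insert Tip (Av ` B \<union> Cv ` B)"
    by (intro set_eqI, case_tac x; auto simp: mem_on)+
  have "card (Av ` B \<union> Cv ` B) = 2 * card B"
    using finite_ground by (subst card_Un_disjoint) (auto simp: card_image inj_on_def)
  then show "card (on False B Far) = 2 * card B" "card (on True B Far) = 2 * card B + 1"
    unfolding F using finite_ground by (auto simp: card_insert_if)
qed

end

lemma traversable_image:
  assumes inj: "inj_on f S" and sub: "\<Union>\<F> \<subseteq> S" and top: "port \<F> B u w c H"
    and u: "u \<notin> insert z (\<beta> ` B)" "w \<noteq> z" "z \<notin> c ` B" and G: "G \<in> \<F>" "z \<notin> G" "u \<notin> G" "card G = k" "\<beta> ` B \<subseteq> G"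
    and c: "c ` B \<subseteq> G" and wk: "walk \<F> B G bs (insert u (c ` B)) c (insert z (\<beta> ` B)) \<beta>"
    and zw: "z \<in> S" "w \<in> S" and lab: "\<And>b. b \<in> B \<Longrightarrow> f (\<beta> b) = b"
  shows "traversable ((\<lambda>A. f ` A) ` \<F>) B (f z) k bs"
proof -
  have M: "insert u (c ` B) \<in> \<F>" "inj_on c B" using top by (auto simp: port_def)
  have cS: "c ` B \<subseteq> S" "u \<in> S" using M(1) sub by auto
  have GS: "G \<subseteq> S" using G(1) sub by blast
  have bS: "\<beta> ` B \<subseteq> S" using G(5) GS by blast
  have fB: "f ` (\<beta> ` B) = B" using lab by (force simp: image_iff)
  have st: "state \<F> B G (insert u (c ` B)) c"
    using G M c unfolding state_def by auto
  have mem: "f x \<in> f ` A \<longleftrightarrow> x \<in> A" if "x \<in> S" "A \<subseteq> S" for x A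
    by (rule inj_on_image_mem_iff[OF inj that])
  have ins: "insert (f z) B = f ` insert z (\<beta> ` B)" using fB by simp
  have im: "insert (f u) ((f \<circ> c) ` B) = f ` insert u (c ` B)" by (simp add: image_comp)
  show ?thesis
    unfolding traversable_def
  proof (intro exI conjI)
    show "port ((\<lambda>A. f ` A) ` \<F>) B (f u) (f w) (f \<circ> c) (\<lambda>b. f ` H b)"
      by (rule port_image[OF inj sub zw(2) top])
    show "f u \<notin> insert (f z) B" unfolding ins using mem[OF cS(2), of "insert z (\<beta> ` B)"] u(1) zw bS by blast
    show "f w \<noteq> f z" using u(2) zw inj by (meson inj_onD)
    show "f z \<notin> (f \<circ> c) ` B" using mem[OF zw(1) cS(1)] u(3) by (simp add: image_comp)
    show "f ` G \<in> (\<lambda>A. f ` A) ` \<F>" using G(1) by blast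
    show "f z \<notin> f ` G" "f u \<notin> f ` G" using mem[OF _ GS] zw cS G(2,3) by auto
    show "card (f ` G) = k" using card_image[OF inj_on_subset[OF inj GS]] G(4) by simp
    show "B \<subseteq> f ` G" using fB G(5) by blast
    show "state ((\<lambda>A. f ` A) ` \<F>) B (f ` G) (insert (f u) ((f \<circ> c) ` B)) (f \<circ> c)"
      unfolding im by (rule state_image[OF inj sub st])
    show "walk ((\<lambda>A. f ` A) ` \<F>) B (f ` G) bs (insert (f u) ((f \<circ> c) ` B)) (f \<circ> c) (insert (f z) B) (f \<circ> \<beta>)"
      unfolding im ins by (rule walk_image[OF inj sub wk st])
    show "\<forall>b\<in>B. (f \<circ> \<beta>) b = b" using lab by simp
  qed
qed

subsection \<open>Extreme rays of the gadget cones\<close>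

text \<open>Convex in s with second difference 1 and zeros at m - 1 and m. The increment from s to s
  + 1 is -(m - 1 - s), the common coordinate of the slab vertex \<open>Pv s\<close>.\<close>

definition lam :: "real \<Rightarrow> nat \<Rightarrow> real" where "lam m s = (m - s) * (m - s - 1) / 2"

text \<open>The cone where all \<open>form\<close>s are nonnegative is the homogenized epigraph of the convex piecewise linear
  function \<open>Y \<mapsto> Max {sum Y S - lam m (card S) | S}\<close> (truncated by the \<open>Cut b\<close> if \<open>v = True\<close>). Its extreme
  rays are spanned by the vectors \<open>(vy m j, vz m n j, ve j)\<close>.\<close>

fun form :: "real \<Rightarrow> 'a set \<Rightarrow> 'a gfacet \<Rightarrow> ('a \<Rightarrow> real) \<Rightarrow> real \<Rightarrow> real \<Rightarrow> real" where
  "form m B Far Y z e = e"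
| "form m B (Lev S) Y z e = z - sum Y S + lam m (card S) * e"
| "form m B (Cut b) Y z e = z - sum Y B + Y b / 2"

fun vy :: "real \<Rightarrow> 'a gvert \<Rightarrow> 'a \<Rightarrow> real" where
  "vy m (Pv s) b = - (m - 1 - s)"
| "vy m (Av c) b = (if b = c then -1 else 0)"
| "vy m (Cv c) b = (if b = c then 1 else 0)"
| "vy m (Tv c) b = (if b = c then -2 else 1)"
| "vy m Tip b = 1"

fun vz :: "real \<Rightarrow> nat \<Rightarrow> 'a gvert \<Rightarrow> real" where
  "vz m n (Pv s) = - (m - 1 - s) * (m + s) / 2"
| "vz m n (Av c) = 0"
| "vz m n (Cv c) = 1"
| "vz m n (Tv c) = real n - 2"
| "vz m n Tip = real n - 1/2"

fun ve :: "'a gvert \<Rightarrow> real" where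
  "ve (Pv s) = 1" | "ve (Av c) = 0" | "ve (Cv c) = 0" | "ve (Tv c) = 1" | "ve Tip = 0"

text \<open>Chosen so that the height vanishes on the last slab: on the levels n - 1 and n of the
  cube, and on n - 3 and n - 2 after truncation, where the cut vertices have height 0 as
  well.\<close>

definition shift :: "bool \<Rightarrow> 'a set \<Rightarrow> real" where
  "shift v B = (if v then real (card B) - 2 else real (card B))"

lemma sum_two_values:
  fixes p q :: real assumes "finite S"
  shows "(\<Sum>b\<in>S. if b = c then p else q) = real (card S) * q + (if c \<in> S then p - q else 0)"
proof -
  have "(\<Sum>b\<in>S. if b = c then p else q) = (\<Sum>b\<in>S. q + (if b = c then p - q else 0))"
    by (rule sum.cong) auto
  then show ?thesis using assms by (simp add: sum.distrib)
qed

lemma consecutive: fixes a b :: nat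
  shows "0 \<le> (real a - real b) * (real a - real b - 1)"
    "(real a - real b) * (real a - real b - 1) = 0 \<longleftrightarrow> a = b \<or> a = Suc b"
proof -
  have "a \<le> b \<or> b + 1 \<le> a" by linarith
  then have "real a - real b \<le> 0 \<or> 1 \<le> real a - real b" by (elim disjE) simp_all
  then show "0 \<le> (real a - real b) * (real a - real b - 1)"
    by (auto intro: mult_nonneg_nonneg mult_nonpos_nonpos)
  show "(real a - real b) * (real a - real b - 1) = 0 \<longleftrightarrow> a = b \<or> a = Suc b" by auto
qed

lemma lam_nonneg: "0 \<le> lam (real k) s" "2 \<le> k \<Longrightarrow> 0 \<le> lam (real k - 2) s"
proof -
  have "real k - 2 = real (k - 2)" if "2 \<le> k" using that by simp
  moreover have "0 \<le> lam (real k) s" for k using consecutive(1)[of k s] by (simp add: lam_def)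
  ultimately show "0 \<le> lam (real k) s" "2 \<le> k \<Longrightarrow> 0 \<le> lam (real k - 2) s" by metis+
qed

text \<open>At a slab vertex a level form is half a product of two consecutive integers, at a corner
  vertex such a half product plus 3 if b belongs to the set. These products are nonnegative, and
  their zeros are the incidences.\<close>

lemma form_value:
  assumes n3: "3 \<le> card B" and i: "i \<in> gfacets v B" and j: "j \<in> gverts v B"
  defines "m \<equiv> shift v B"
  shows "0 \<le> form m B i (vy m j) (vz m (card B) j) (ve j) \<and>
     (form m B i (vy m j) (vz m (card B) j) (ve j) = 0 \<longleftrightarrow> inc (card B) i j)"
proof -
  let ?n = "card B"
  have fB: "finite B" using n3 card.infinite by force
  show ?thesis using i
  proof (cases rule: gfacet_cases)
    case 1 then show ?thesis by (cases j) auto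
  next
    case (2 S)
    have fS: "finite S" using 2(2) fB finite_subset by blast
    have cS: "card S \<le> ?n" using 2(2) fB card_mono by blast
    have cSv: "card S < ?n" if v using 2 that fB by (simp add: psubset_card_mono psubset_eq)
    show ?thesis
    proof (cases j)
      case (Pv s)
      have val: "form m B i (vy m j) (vz m ?n j) (ve j) = (real (card S) - real s) * (real (card S) - real s - 1) / 2"
        unfolding 2(1) Pv by (simp only: form.simps vy.simps vz.simps ve.simps sum_constant lam_def) (simp add: field_simps)
      show ?thesis unfolding val using consecutive[of "card S" s] Pv 2(1) by auto
    next
      case (Tv b)
      then have v using j by simp
      then have m: "m = real ?n - 2" by (simp add: m_def shift_def)
      define r where "r = ?n - 1 - card S"
      have r: "real ?n = real r + 1 + real (card S)" using cSv[OF \<open>v\<close>] by (simp add: r_def of_nat_diff)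
      have "form m B i (vy m j) (vz m ?n j) (ve j) =
          real ?n - 2 - (real (card S) + (if b \<in> S then - 3 else 0)) + lam m (card S)"
        using 2(1) Tv fS by (simp add: sum_two_values)
      also have "\<dots> = real r * (real r - 1) / 2 + (if b \<in> S then 3 else 0)"
        unfolding m r lam_def by (simp add: field_simps)
      finally have val: "form m B i (vy m j) (vz m ?n j) (ve j) = real r * (real r - 1) / 2 + (if b \<in> S then 3 else 0)" .
      have "0 \<le> real r * (real r - 1)" "real r * (real r - 1) = 0 \<longleftrightarrow> r = 0 \<or> r = 1"
        using consecutive[of r 0] by auto
      moreover have "r = 0 \<or> r = 1 \<longleftrightarrow> ?n \<le> card S + 2" using cSv[OF \<open>v\<close>] by (auto simp: r_def)
      ultimately show ?thesis unfolding val using 2(1) Tv by auto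
    next
      case Tip
      then have v using j by simp
      then show ?thesis using 2(1) Tip cSv by simp
    qed (use 2(1) fS in \<open>auto simp: sum_two_values\<close>)
  next
    case (3 b)
    then have m: "m = real ?n - 2" by (simp add: m_def shift_def)
    show ?thesis
    proof (cases j)
      case (Pv s)
      then have s: "s + 3 \<le> ?n" using j 3 by auto
      have val: "form m B i (vy m j) (vz m ?n j) (ve j) = (real ?n - 3 - real s) * (real ?n + 1 - real s) / 2"
        unfolding 3 Pv m by (simp only: form.simps vy.simps vz.simps ve.simps sum_constant) (simp add: field_simps)
      have "0 \<le> real ?n - 3 - real s" "0 < real ?n + 1 - real s" using s by linarith+
      moreover have "real ?n - 3 - real s = 0 \<longleftrightarrow> ?n = s + 3" by auto
      ultimately show ?thesis unfolding val using Pv 3 by simp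
    qed (use 3 fB j in \<open>auto simp: sum_two_values m\<close>)
  qed
qed

text \<open>Here \<open>rigid\<close> says that the active forms determine the vector up to a
  factor, so it spans an extreme ray. It is exploited by exhibiting vectors annihilated by all
  active forms: being proportional to the ray, they either name it or are absurd.\<close>

locale gadget_ray =
  fixes v :: bool and B :: "'a set" and Y :: "'a \<Rightarrow> real" and z e m :: real
  assumes n3: "3 \<le> card B" and m: "m = shift v B"
    and nonneg: "\<And>i. i \<in> gfacets v B \<Longrightarrow> 0 \<le> form m B i Y z e"
    and nonzero: "\<not> ((\<forall>b\<in>B. Y b = 0) \<and> z = 0 \<and> e = 0)"
    and rigid: "\<And>Y' z' e'. (\<forall>i\<in>gfacets v B. form m B i Y z e = 0 \<longrightarrow> form m B i Y' z' e' = 0) \<Longrightarrow>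
        \<exists>t. (\<forall>b\<in>B. Y' b = t * Y b) \<and> z' = t * z \<and> e' = t * e"
begin

abbreviation lev where "lev S \<equiv> S \<subseteq> B \<and> (v \<longrightarrow> S \<noteq> B)"
abbreviation act where "act S \<equiv> lev S \<and> z = sum Y S - lam m (card S) * e"
abbreviation actc where "actc b \<equiv> v \<and> b \<in> B \<and> z = sum Y B - Y b / 2"
abbreviation listed where "listed \<equiv> (\<exists>j\<in>gverts v B. \<exists>t. (\<forall>b\<in>B. vy m j b = t * Y b) \<and> vz m (card B) j = t * z \<and> ve j = t * e)"

lemma finite_B: "finite B" using n3 card.infinite by force
lemma finite_lev: "lev S \<Longrightarrow> finite S" using finite_B finite_subset by auto
lemma B_nonempty: "B \<noteq> {}" using n3 by auto

lemma e_nonneg: "0 \<le> e" using nonneg[of Far] by simp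
lemma lev_le: "lev S \<Longrightarrow> sum Y S - lam m (card S) * e \<le> z" using nonneg[of "Lev S"] by simp
lemma cut_le: "\<lbrakk>v; b \<in> B\<rbrakk> \<Longrightarrow> sum Y B - Y b / 2 \<le> z" using nonneg[of "Cut b"] by simp

lemma rigid_active:
  assumes "\<And>S. act S \<Longrightarrow> z' - sum Y' S + lam m (card S) * e' = 0" "\<And>b. actc b \<Longrightarrow> z' - sum Y' B + Y' b / 2 = 0"
    "e = 0 \<Longrightarrow> e' = 0"
  obtains t where "\<And>b. b \<in> B \<Longrightarrow> Y' b = t * Y b" "z' = t * z" "e' = t * e"
proof -
  have "\<forall>i\<in>gfacets v B. form m B i Y z e = 0 \<longrightarrow> form m B i Y' z' e' = 0"
  proof (intro ballI impI)
    fix i assume i: "i \<in> gfacets v B" "form m B i Y z e = 0"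
    from i(1) show "form m B i Y' z' e' = 0"
    proof (cases rule: gfacet_cases)
      case 1 then show ?thesis using i(2) assms(3) by simp
    next
      case (2 S)
      then have "act S" using i(2) by simp
      then show ?thesis using assms(1) 2 by simp
    next
      case (3 b)
      then have "actc b" using i(2) by simp
      then show ?thesis using assms(2) 3 by simp
    qed
  qed
  then show ?thesis using rigid[of Y' z' e'] that by blast
qed

lemma some_active: "(\<exists>S. act S) \<or> (\<exists>b. actc b)"
proof (rule ccontr)
  assume no: "\<not> ?thesis"
  obtain t where t: "\<And>b. b \<in> B \<Longrightarrow> (0::real) = t * Y b" "1 = t * z" by (rule rigid_active[of 1 "\<lambda>_. 0" 0]) (use no in auto)
  obtain b where b: "b \<in> B" using B_nonempty by blast
  obtain t' where t': "\<And>c. c \<in> B \<Longrightarrow> (if c = b then 1 else 0) = t' * Y c"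
    by (rule rigid_active[of 0 "\<lambda>c. if c = b then 1 else 0" 0]) (use no in auto)
  show False using t(1)[OF b] t(2) t'[OF b] by auto
qed

lemma min_elem: obtains a where "a \<in> B" "\<And>b. b \<in> B \<Longrightarrow> Y a \<le> Y b"
proof -
  have "Min (Y ` B) \<in> Y ` B" by (rule Min_in) (use finite_B B_nonempty in auto)
  then obtain a where "a \<in> B" "Y a = Min (Y ` B)" by (metis imageE)
  then show ?thesis using that[of a] finite_B by simp
qed

text \<open>If all coordinates are positive, only cuts at minimal coordinates are active. A larger
  coordinate could be varied together with z alone, so all are equal and the ray is
  \<open>Tip\<close>.\<close>

lemma zero_case_pos:
  assumes e0: "e = 0" and v and pos: "\<And>b. b \<in> B \<Longrightarrow> 0 < Y b"
  shows listed
proof -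
  obtain a where a: "a \<in> B" "\<And>b. b \<in> B \<Longrightarrow> Y a \<le> Y b" using min_elem by metis
  have za: "sum Y B - Y a / 2 \<le> z" using cut_le[OF \<open>v\<close> a(1)] .
  have noact: "\<not> act S" for S
  proof
    assume S: "act S"
    then obtain c where c: "c \<in> B" "c \<notin> S" "S \<subseteq> B" using \<open>v\<close> by auto
    have "sum Y S \<le> sum Y (B - {c})" by (rule sum_mono2) (use c finite_B pos in \<open>auto intro: less_imp_le\<close>)
    also have "\<dots> = sum Y B - Y c" using c finite_B by (simp add: sum_diff1)
    finally have "sum Y S \<le> sum Y B - Y a" using a(2)[OF c(1)] by simp
    then show False using S za e0 pos[OF a(1)] by simp
  qed
  have cut: "Y b \<le> Y a" if "actc b" for b using that za by simp
  have const: "Y c = Y a" if c: "c \<in> B" for c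
  proof (rule ccontr)
    assume "Y c \<noteq> Y a"
    then have gt: "Y a < Y c" using a(2)[OF c] by simp
    have I: "1 - (\<Sum>b\<in>B. if b = c then 1 else 0) + (if b = c then 1 else 0) / 2 = (0::real)" if "actc b" for b
    proof -
      have "b \<noteq> c" using cut[OF that] gt by auto
      then show ?thesis using c finite_B by simp
    qed
    obtain t where t: "\<And>b. b \<in> B \<Longrightarrow> (if b = c then 1 else 0) = t * Y b"
    proof (rule rigid_active[where z' = 1 and Y' = "\<lambda>b. if b = c then 1 else 0" and e' = 0])
      show "1 - (\<Sum>b\<in>S. if b = c then 1 else 0) + lam m (card S) * 0 = 0" if "act S" for S using noact that by blast
    qed (use I in auto)
    show False using t[OF a(1)] t[OF c] gt pos[OF a(1)] by (auto split: if_splits)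
  qed
  obtain b where b: "actc b" using some_active noact by blast
  have "sum Y B = real (card B) * Y a" using const by simp
  then have z: "z = (real (card B) - 1/2) * Y a" using b const[of b] by (simp add: algebra_simps)
  show listed
        by (intro bexI[of _ Tip] exI[of _ "1 / Y a"]) (use \<open>v\<close> e0 z const pos[OF a(1)] in auto)
qed

text \<open>Now z is the sum of the positive coordinates, and an active set contains a c with
  nonzero coordinate iff that coordinate is positive. So the unit vector of c, with z-value 1 or 0,
  satisfies the active equations, and the ray is \<open>Cv c\<close> or \<open>Av c\<close>.\<close>

lemma zero_case:
  assumes e0: "e = 0" and np: "v \<Longrightarrow> \<exists>b\<in>B. Y b \<le> 0"
  shows listed
proof -
  define P where "P = {b\<in>B. 0 < Y b}"
  define N where "N = {b\<in>B. Y b \<le> 0}"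
  have levP: "lev P" using np by (force simp: P_def)
  have fPN: "finite P" "finite N" using finite_B by (auto simp: P_def N_def)
  have zP: "sum Y P \<le> z" using lev_le[OF levP] e0 by simp
  have sB: "sum Y B = sum Y P + sum Y N"
  proof -
    have "B = P \<union> N" "P \<inter> N = {}" by (auto simp: P_def N_def)
    then show ?thesis using fPN sum.union_disjoint by metis
  qed
  have N0: "sum Y N \<le> 0" by (rule sum_nonpos) (simp add: N_def)
  have sumS: "sum Y S = sum Y P - (sum Y (P - S) - sum Y (S - P))" if "finite S" for S
  proof -
    have "sum Y S = sum Y (S \<inter> P) + sum Y (S - P)" using that by (simp add: sum.Int_Diff)
    moreover have "sum Y P = sum Y (P \<inter> S) + sum Y (P - S)" using fPN by (simp add: sum.Int_Diff)
    ultimately show ?thesis by (simp add: Int_commute)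
  qed
  have nn: "0 \<le> sum Y (P - S)" "sum Y (S - P) \<le> 0" if "S \<subseteq> B" for S
    using that by (auto simp: P_def intro!: sum_nonneg sum_nonpos)
  have SP: "sum Y S \<le> sum Y P" if "S \<subseteq> B" for S
    using sumS[of S] nn[OF that] that finite_B finite_subset by fastforce
  have cutN: "Y b \<le> 0" "sum Y N \<le> Y b" if "sum Y P \<le> sum Y B - Y b / 2" "b \<in> B" for b
  proof -
    show "Y b \<le> 0"
    proof (rule ccontr)
      assume "\<not> Y b \<le> 0" then show False using that sB N0 by simp
    qed
    then have "b \<in> N" using that(2) by (simp add: N_def)
    then have "sum Y N = Y b + sum Y (N - {b})" using fPN by (simp add: sum.remove)
    moreover have "sum Y (N - {b}) \<le> 0" by (rule sum_nonpos) (simp add: N_def)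
    ultimately show "sum Y N \<le> Y b" by simp
  qed
  have z: "z = sum Y P"
  proof (cases "\<exists>S. act S")
    case True
    then obtain S where "act S" by blast
    then have "z \<le> sum Y P" using SP[of S] e0 by simp
    then show ?thesis using zP by simp
  next
    case False
    then obtain b where "actc b" using some_active by blast
    then have b: "z = sum Y B - Y b / 2" "b \<in> B" by auto
    then show ?thesis using cutN[of b] zP sB by simp
  qed
  obtain c where c: "c \<in> B" "Y c \<noteq> 0"
  proof -
    have "\<exists>c\<in>B. Y c \<noteq> 0"
    proof (rule ccontr)
      assume "\<not> ?thesis"
      then have "\<forall>b\<in>B. Y b = 0" by blast
      moreover then have "sum Y P = 0" by (intro sum.neutral) (simp add: P_def)
      ultimately show False using nonzero z e0 by simp
    qed
    then show ?thesis using that by blast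
  qed
  define q :: real where "q = (if 0 < Y c then 1 else 0)"
  have actS: "c \<in> S \<longleftrightarrow> 0 < Y c" if "act S" for S
  proof -
    have S: "S \<subseteq> B" "sum Y S = sum Y P" "finite S" using that z e0 finite_lev by auto
    have z0: "sum Y (P - S) = 0" "sum Y (S - P) = 0" using sumS[OF S(3)] S(2) nn[OF S(1)] by linarith+
    have "\<forall>b\<in>P - S. Y b = 0"
      by (subst sum_nonneg_eq_0_iff[symmetric]) (use fPN z0 in \<open>auto simp: P_def\<close>)
    moreover have "\<forall>b\<in>S - P. - Y b = 0"
    proof -
      have "(\<Sum>b\<in>S - P. - Y b) = 0" using z0 by (simp add: sum_negf)
      moreover have "0 \<le> - Y b" if "b \<in> S - P" for b using that S(1) by (auto simp: P_def)
      ultimately show ?thesis using sum_nonneg_eq_0_iff[of "S - P" "\<lambda>b. - Y b"] S(3) by blast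
    qed
    ultimately have "c \<notin> P - S" "c \<notin> S - P" using c(2) by auto
    moreover have "c \<in> P \<longleftrightarrow> 0 < Y c" using c(1) by (simp add: P_def)
    ultimately show ?thesis by blast
  qed
  have actb: "0 < Y c \<and> b \<noteq> c" if "actc b" for b
  proof -
    have b: "z = sum Y B - Y b / 2" "b \<in> B" using that by auto
    then have "sum Y N = Y b / 2" using z sB by simp
    moreover have "Y b \<le> 0" "sum Y N \<le> Y b" using cutN[of b] b z by auto
    ultimately have "Y b = 0" "sum Y N = 0" by linarith+
    then have "(\<Sum>b\<in>N. - Y b) = 0" by (simp add: sum_negf)
    then have "\<forall>b\<in>N. - Y b = 0" by (subst sum_nonneg_eq_0_iff[symmetric]) (use fPN in \<open>auto simp: N_def\<close>)
    then show ?thesis using c \<open>Y b = 0\<close> by (force simp: N_def)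
  qed
  obtain t where t: "\<And>b. b \<in> B \<Longrightarrow> (if b = c then 1 else 0) = t * Y b" "q = t * z"
    by (rule rigid_active[of q "\<lambda>b. if b = c then 1 else 0" 0])
      (use actS actb c finite_B in \<open>auto simp: q_def finite_lev\<close>)
  show listed
  proof (cases "0 < Y c")
    case True
    show listed
      by (intro bexI[of _ "Cv c"] exI[of _ t]) (use True t c e0 in \<open>auto simp: q_def\<close>)
  next
    case False
    show listed
      by (intro bexI[of _ "Av c"] exI[of _ "- t"]) (use False t(2) c e0 t(1)[symmetric] in \<open>simp_all add: q_def\<close>)
  qed
qed

context
  assumes e_pos: "0 < e"
begin

text \<open>An annihilated vector with last coordinate 0 is a multiple of the ray, and
  \<open>0 < e\<close> makes the factor 0.\<close>

lemma no_direction: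
  fixes Y' :: "'a \<Rightarrow> real"
  assumes "\<And>S. act S \<Longrightarrow> z' = sum Y' S" "\<And>b. actc b \<Longrightarrow> z' - sum Y' B + Y' b / 2 = 0" "b \<in> B"
  shows "Y' b = 0"
proof -
  obtain t where "\<And>b. b \<in> B \<Longrightarrow> Y' b = t * Y b" "0 = t * e"
    by (rule rigid_active[of z' Y' 0]) (use assms in auto)
  then show ?thesis using e_pos assms(3) by auto
qed

text \<open>Exchange argument: swapping a for b keeps the size and hence the height.\<close>

lemma act_upper: assumes S: "act S" and a: "a \<in> S" and b: "b \<in> B" "b \<notin> S" shows "Y b \<le> Y a"
proof -
  let ?S = "insert b (S - {a})"
  have SB: "S \<subseteq> B" "finite S" using S finite_lev by auto
  have "card S = Suc (card (S - {a}))" using a SB card_Suc_Diff1 by metis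
  then have c: "card ?S = card S" using b SB by simp
  have "card S < card B" using SB b finite_B by (intro psubset_card_mono) auto
  then have "?S \<noteq> B" using c by (metis less_irrefl)
  then have "lev ?S" using SB b by blast
  then have "sum Y ?S - lam m (card S) * e \<le> z" using lev_le c by metis
  moreover have "sum Y ?S = sum Y S - Y a + Y b" 
  proof -
    have "sum Y ?S = Y b + sum Y (S - {a})" using b SB by simp
    moreover have "sum Y S = Y a + sum Y (S - {a})" using a SB by (simp add: sum.remove)
    ultimately show ?thesis by simp
  qed
  ultimately show ?thesis using S by simp
qed

text \<open>Moving an element from the larger to the smaller set keeps the sum of the values but
  lowers the total height by \<open>card S' - card S - 1\<close>, so both sets cannot be maximizers
  if this is positive.\<close>

lemma act_sizes: assumes "act S" "act S'" shows "card S' \<le> card S + 1"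
proof (rule ccontr)
  assume far: "\<not> ?thesis"
  have S: "S \<subseteq> B" "finite S" "S' \<subseteq> B" "finite S'" using assms finite_lev by auto
  obtain x where x: "x \<in> S'" "x \<notin> S" using far S card_mono[of S S'] by force
  have le: "card S' \<le> card B" using S finite_B card_mono by blast
  have l1: "lev (insert x S)" using S x far le by auto
  have l2: "lev (S' - {x})" using S x by auto
  have "sum Y S + Y x - lam m (card S + 1) * e \<le> z" using lev_le[OF l1] S x by simp
  moreover have "sum Y S' - Y x - lam m (card S' - 1) * e \<le> z" using lev_le[OF l2] S x by (simp add: sum_diff1)
  ultimately have "(lam m (card S) + lam m (card S') - lam m (card S + 1) - lam m (card S' - 1)) * e \<le> 0"
    using assms by (simp add: algebra_simps)
  moreover have "lam m (card S) + lam m (card S') - lam m (card S + 1) - lam m (card S' - 1) = real (card S') - real (card S) - 1"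
    using far by (simp add: lam_def field_simps of_nat_diff)
  ultimately show False using far e_pos by (simp add: mult_le_0_iff)
qed

text \<open>Let M be the set of maximal coordinates. By exchange and the size bound, either all
  active sets contain M or all lie in M. If M were not B, the indicator of M, respectively of its
  complement, would be a forbidden direction. So Y is constant; two consecutive sizes must be
  active, and their equations give \<open>Pv s\<close>.\<close>

lemma levels_case: assumes noc: "\<And>b. \<not> actc b" shows listed
proof -
  obtain S0 where S0: "act S0" using some_active noc by blast
  have sub: "S \<subseteq> B" "finite S" if "act S" for S using that finite_lev by auto
  have "Max (Y ` B) \<in> Y ` B" by (rule Max_in) (use finite_B B_nonempty in auto)
  then obtain x0 where x0: "x0 \<in> B" "Y x0 = Max (Y ` B)" by (metis imageE)
  have top: "Y b \<le> Y x0" if "b \<in> B" for b using that x0 finite_B by simp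
  define M where "M = {b\<in>B. Y b = Y x0}"
  have fM: "finite M" "M \<subseteq> B" "x0 \<in> M" using finite_B x0 by (auto simp: M_def)
  have big: "M \<subseteq> S" if S: "act S" "card M \<le> card S" for S
  proof (rule ccontr)
    assume "\<not> M \<subseteq> S"
    then obtain x where x: "x \<in> M" "x \<notin> S" by blast
    have "S \<subseteq> M - {x}"
    proof
      fix a assume a: "a \<in> S"
      then have "Y x \<le> Y a" using act_upper[OF S(1) a] x fM by blast
      then show "a \<in> M - {x}" using a sub[OF S(1)] top[of a] x by (auto simp: M_def)
    qed
    then have "card S \<le> card (M - {x})" using fM by (intro card_mono) auto
    also have "\<dots> < card M" using x(1) fM by (intro card_Diff1_less) auto
    finally show False using S(2) by simp
  qed
  have small: "S \<subseteq> M" if S: "act S" "card S \<le> card M" for S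
  proof (rule ccontr)
    assume "\<not> S \<subseteq> M"
    then obtain a where a: "a \<in> S" "a \<notin> M" by blast
    then have lt: "Y a < Y x0" using top[of a] sub[OF S(1)] by (force simp: M_def)
    have "M \<subseteq> S"
    proof
      fix x assume "x \<in> M"
      then show "x \<in> S" using act_upper[OF S(1) a(1), of x] lt by (force simp: M_def)
    qed
    then have "card M < card S" using a sub[OF S(1)] by (intro psubset_card_mono) auto
    then show False using S(2) by simp
  qed
  have MB: "M = B"
  proof (rule ccontr)
    assume "M \<noteq> B"
    then obtain y where y: "y \<in> B" "y \<notin> M" using fM by blast
    show False
    proof (cases "\<forall>S. act S \<longrightarrow> card M \<le> card S")
      case True
      have I: "real (card M) = (\<Sum>b\<in>S. if b \<in> M then 1 else 0)" if S: "act S" for S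
      proof -
        have "S \<inter> M = M" using big[OF S] True S by blast
        then show ?thesis using sub[OF S] by (simp add: sum.If_cases Int_commute)
      qed
      have "(if x0 \<in> M then 1 else 0 :: real) = 0" by (rule no_direction[OF I]) (use noc x0 in auto)
      then show False using fM by simp
    next
      case False
      then obtain S1 where S1: "act S1" "card S1 < card M" using not_le by blast
      have I: "0 = (\<Sum>b\<in>S. if b \<in> M then 0 else 1 :: real)" if S: "act S" for S
      proof -
        have "S \<subseteq> M" using small[OF S] act_sizes[OF S1(1) S] S1(2) by simp
        then show ?thesis by (intro sum.neutral[symmetric]) auto
      qed
      have "(if y \<in> M then 0 else 1 :: real) = 0" by (rule no_direction[OF I]) (use noc y in auto)
      then show False using y by simp
    qed
  qed
  define \<theta> where "\<theta> = Y x0"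
  have Y\<theta>: "Y b = \<theta>" if "b \<in> B" for b using that MB by (auto simp: M_def \<theta>_def)
  have sum\<theta>: "sum Y S = real (card S) * \<theta>" if "act S" for S
    using sub(1)[OF that] Y\<theta> by (simp add: subset_iff)
  have "\<exists>S1. act S1 \<and> card S1 \<noteq> card S0"
  proof (rule ccontr)
    assume "\<not> ?thesis"
    then have I: "real (card S0) = (\<Sum>b\<in>S. 1)" if "act S" for S using that by auto
    have "(1::real) = 0" by (rule no_direction[OF I]) (use noc x0 in auto)
    then show False by simp
  qed
  then obtain S1 where S1: "act S1" "card S1 \<noteq> card S0" by blast
  obtain S S' where S: "act S" "act S'" "card S' = card S + 1"
  proof (cases "card S0 < card S1")
    case True then show ?thesis using that[OF S0 S1(1)] act_sizes[OF S0 S1(1)] by simp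
  next
    case False then show ?thesis using that[OF S1(1) S0] act_sizes[OF S1(1) S0] S1(2) by simp
  qed
  define s where "s = card S"
  have z1: "z = s * \<theta> - lam m s * e" using S(1) sum\<theta>[OF S(1)] by (simp add: s_def)
  have z2: "z = (real s + 1) * \<theta> - lam m (Suc s) * e" using S(2,3) sum\<theta>[OF S(2)] by (simp add: s_def add.commute)
  have th: "\<theta> = - (m - 1 - s) * e"
  proof -
    have "\<theta> = (lam m (Suc s) - lam m s) * e" using z1 z2 by (simp add: algebra_simps)
    also have "lam m (Suc s) - lam m s = - (m - 1 - s)" by (simp add: lam_def field_simps)
    finally show ?thesis .
  qed
  have zz: "z = (- (m - 1 - s) * (m + s) / 2) * e"
    unfolding z1 th by (simp add: lam_def field_simps)
  have sB: "Suc s \<le> card B" using S sub[OF S(2)] finite_B card_mono[of B S'] by (simp add: s_def)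
  have "Pv s \<in> gverts v B"
  proof (cases v)
    case False then show ?thesis using sB by simp
  next
    case True
    have "card S' < card B" using S(2) True finite_B by (intro psubset_card_mono) auto
    then have s2: "s + 2 \<le> card B" using S(3) by (simp add: s_def)
    \<comment> \<open>For s = n - 2 the equations give \<theta> = e and z = m e, while a cut demands
      z to be at least (m + 3/2) e.\<close>
    have "s + 2 \<noteq> card B"
    proof
      assume "s + 2 = card B"
      then have ms: "real s = m" "real (card B) = m + 2" using True m by (auto simp: shift_def)
      have "sum Y B - Y x0 / 2 \<le> z" using cut_le[OF True x0(1)] .
      moreover have "sum Y B = (m + 2) * \<theta>" using Y\<theta> ms by simp
      moreover have "\<theta> = e" "z = m * e" using th zz ms by auto
      ultimately have "(m + 2) * e - e / 2 \<le> m * e" using Y\<theta>[OF x0(1)] by simp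
      then show False using e_pos by (simp add: algebra_simps)
    qed
    then show ?thesis using s2 True by simp
  qed
  then show listed
    using Y\<theta> th zz e_pos
    by (intro bexI[of _ "Pv s"] exI[of _ "1 / e"]) auto
qed

text \<open>An active cut makes \<open>Y i\<close> minimal, and the sets \<open>B - {i, j}\<close>
  bound the other coordinates below by \<open>- Y i / 2\<close>. If \<open>Y i = 0\<close>,
  everything but e vanishes: the ray is the last slab. If \<open>Y i < 0\<close>, active sets can
  omit only i or i and one j, and rigidity yields the corner simplex \<open>Tv i\<close>.\<close>

lemma cut_case: assumes i: "actc i" shows listed
proof -
  have v: v and iB: "i \<in> B" and zi: "z = sum Y B - Y i / 2" using i by auto
  have mv: "m = real (card B) - 2" using m v by (simp add: shift_def)
  have lam2: "lam m (card B - 2) = 0" "lam m (card B - 1) = 1"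
    using n3 by (simp_all add: lam_def mv of_nat_diff)
  have lam0: "0 \<le> lam m s" for s using lam_nonneg(2)[of "card B" s] n3 mv by simp
  have imin: "Y i \<le> Y j" if "j \<in> B" for j using cut_le[OF v that] zi by simp
  have others: "- Y i / 2 \<le> Y j" if "j \<in> B" "j \<noteq> i" for j
  proof -
    have "lev (B - {i, j})" using iB v by auto
    moreover have "card (B - {i, j}) = card B - 2" using card_minus2[OF n3 iB that(1)] that(2) by simp
    moreover have "sum Y (B - {i, j}) = sum Y B - Y i - Y j"
      using that iB finite_B by (simp add: sum_diff)
    ultimately have "sum Y B - Y i - Y j \<le> z" using lev_le[of "B - {i, j}"] lam2 by simp
    then show ?thesis using zi by simp
  qed
  have sumC: "sum Y (B - S) + lam m (card S) * e = Y i / 2" if "act S" for S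
    using that zi finite_B finite_lev by (simp add: sum_diff)
  have Cne: "\<exists>c\<in>B. c \<notin> S" "S \<subseteq> B" if "act S" for S using that v by auto
  have "\<exists>S. act S"
  proof (rule ccontr)
    assume "\<nexists>S. act S"
    then have "(1::real) = 0" by (intro no_direction[of "real (card B) - 1/2" "\<lambda>_. 1" i]) (use iB in auto)
    then show False by simp
  qed
  then obtain S0 where S0: "act S0" by blast
  have neg: "Y i \<le> 0"
  proof (rule ccontr)
    assume pos: "\<not> Y i \<le> 0"
    obtain c where c: "c \<in> B" "c \<notin> S0" using Cne[OF S0] by blast
    have "Y c \<le> sum Y (B - S0)"
      by (rule member_le_sum) (use c finite_B imin pos in force)+
    moreover have "0 \<le> lam m (card S0) * e" using lam0 e_pos by simp
    ultimately show False using sumC[OF S0] imin[OF c(1)] pos by linarith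
  qed
  show listed
  proof (cases "Y i = 0")
    case True
    have nn: "0 \<le> Y j" if "j \<in> B" for j using imin[OF that] True by simp
    have C0: "Y c = 0" if "act S" "c \<in> B" "c \<notin> S" for S c
    proof -
      have "Y c \<le> sum Y (B - S)" by (rule member_le_sum) (use that finite_B nn in auto)
      moreover have "0 \<le> lam m (card S) * e" using lam0 e_pos by simp
      ultimately show ?thesis using sumC[OF that(1)] True nn[OF that(2)] by linarith
    qed
    have Y0: "Y c = 0" if c: "c \<in> B" for c
    proof (rule ccontr)
      assume ne: "Y c \<noteq> 0"
      have "1 = (\<Sum>b\<in>S. if b = c then 1 else 0 :: real)" if "act S" for S
      proof -
        have "c \<in> S" using C0[OF that c] ne by blast
        then show ?thesis using that finite_lev by simp
      qed
      moreover have "1 - (\<Sum>b\<in>B. if b = c then 1 else 0 :: real) + (if b = c then 1 else 0) / 2 = 0" if "actc b" for b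
      proof -
        have "Y b = 0" using that zi True by simp
        then have "b \<noteq> c" using ne by blast
        then show ?thesis using c finite_B by simp
      qed
      ultimately have "(if c = c then 1 else 0 :: real) = 0" by (rule no_direction[OF _ _ c])
      then show False by simp
    qed
    then have "z = 0" using zi True by simp
    have "real (card B - 3) = real (card B) - 3" using n3 by simp
    then show listed
      by (intro bexI[of _ "Pv (card B - 3)"] exI[of _ "1 / e"]) (use Y0 \<open>z = 0\<close> v n3 mv e_pos in auto)
  next
    case False
    then have mu: "Y i < 0" using neg by simp
    have pos: "0 < Y j" if "j \<in> B" "j \<noteq> i" for j using others[OF that] mu by linarith
    have onlyi: "b = i" if "actc b" for b
    proof (rule ccontr)
      assume "b \<noteq> i"
      moreover have "Y b = Y i" "b \<in> B" using that zi by auto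
      ultimately show False using pos[of b] mu by simp
    qed
    have shape: "(S = B - {i} \<and> e = - Y i / 2) \<or> (\<exists>j\<in>B. j \<noteq> i \<and> S = B - {i, j} \<and> Y j = - Y i / 2)" if S: "act S" for S
    proof -
      note C = sumC[OF S] and SB = Cne(2)[OF S]
      have le0: "0 \<le> lam m (card S) * e" using lam0 e_pos by simp
      have iC: "i \<notin> S"
      proof
        assume "i \<in> S"
        then have "0 \<le> sum Y (B - S)" using pos by (intro sum_nonneg) (force intro: less_imp_le)
        then show False using C le0 mu by simp
      qed
      let ?C = "B - S - {i}"
      have C': "sum Y ?C + lam m (card S) * e = - Y i / 2"
      proof -
        have "sum Y (B - S) = Y i + sum Y ?C" using iC iB finite_B by (simp add: sum.remove)
        then show ?thesis using C by simp
      qed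
      have posC: "0 \<le> Y j" if "j \<in> ?C" for j using pos[of j] that by simp
      show ?thesis
      proof (cases "?C = {}")
        case True
        then have "S = B - {i}" using SB iC by blast
        moreover then have "lam m (card S) = 1" using lam2 iB finite_B by simp
        moreover have "sum Y ?C = 0" using True by (simp only: sum.empty)
        ultimately show ?thesis using C' by simp
      next
        case False
        then obtain j where j: "j \<in> ?C" by blast
        have "?C = {j}"
        proof (rule ccontr)
          assume "?C \<noteq> {j}"
          then obtain k where k: "k \<in> ?C" "k \<noteq> j" using j by blast
          have "sum Y {j, k} \<le> sum Y ?C" by (rule sum_mono2) (use j k finite_B posC in auto)
          then have "Y j + Y k \<le> sum Y ?C" using k(2) by simp
          then show False using C' le0 others[of j] others[of k] j k mu by simp
        qed
        then have S': "S = B - {i, j}" using SB iC j by blast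
        then have "lam m (card S) = 0" using lam2 card_minus2[OF n3 iB, of j] j by auto
        then have "Y j = - Y i / 2" using C' \<open>?C = {j}\<close> by simp
        then show ?thesis using S' j by blast
      qed
    qed
    \<comment> \<open>Otherwise \<open>B - {i}\<close> is inactive, and the vector with 2 at i and
      -1 elsewhere satisfies all active equations with z' = 2 - n.\<close>
    have mue: "Y i = - 2 * e"
    proof (rule ccontr)
      assume ne: "Y i \<noteq> - 2 * e"
      have "2 - real (card B) = (\<Sum>b\<in>S. if b = i then 2 else - 1)" if S: "act S" for S
      proof -
        obtain j where j: "j \<in> B" "j \<noteq> i" "S = B - {i, j}" using shape[OF S] ne by auto
        then have "card S = card B - 2" using card_minus2[OF n3 iB j(1)] by simp
        then have "real (card S) = real (card B) - 2" using n3 by simp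
        then show ?thesis using j finite_B by (simp add: sum_two_values)
      qed
      moreover have "2 - real (card B) - (\<Sum>b\<in>B. if b = i then 2 else - 1) + (if b = i then 2 else - 1) / 2 = 0" if "actc b" for b
        using onlyi[OF that] iB finite_B by (simp add: sum_two_values)
      ultimately have "(if i = i then 2 else - 1 :: real) = 0" by (rule no_direction[OF _ _ iB])
      then show False by simp
    qed
    have Ye: "Y c = e" if c: "c \<in> B" "c \<noteq> i" for c
    proof (rule ccontr)
      assume ne: "Y c \<noteq> e"
      have "1 = (\<Sum>b\<in>S. if b = c then 1 else 0 :: real)" if S: "act S" for S
      proof -
        have "c \<in> S" using shape[OF S] c ne mue by auto
        then show ?thesis using S finite_lev by simp
      qed
      moreover have "1 - (\<Sum>b\<in>B. if b = c then 1 else 0 :: real) + (if b = c then 1 else 0) / 2 = 0" if "actc b" for b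
        using onlyi[OF that] c finite_B by simp
      ultimately have "(if c = c then 1 else 0 :: real) = 0" by (rule no_direction[OF _ _ c(1)])
      then show False by simp
    qed
    have "sum Y B = (\<Sum>b\<in>B. if b = i then - 2 * e else e)" by (rule sum.cong) (use Ye mue in auto)
    then have "z = (real (card B) - 2) * e"
      unfolding zi mue using iB finite_B by (simp add: sum_two_values algebra_simps)
    then show listed
      by (intro bexI[of _ "Tv i"] exI[of _ "1 / e"]) (use Ye mue v iB e_pos in auto)
  qed
qed

end

theorem classification: listed
proof (cases "e = 0")
  case True
  show listed
  proof (cases "v \<and> (\<forall>b\<in>B. 0 < Y b)")
    case True then show listed using zero_case_pos \<open>e = 0\<close> by blast
  next
    case False
    then show listed using zero_case[OF \<open>e = 0\<close>] by force
  qed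
next
  case False
  then have "0 < e" using e_nonneg by simp
  then show listed using levels_case cut_case by blast
qed

end

subsection \<open>Realization of the gadgets\<close>

lemma inner_One: "b \<in> Basis \<Longrightarrow> b \<bullet> One = 1"
  by (simp only: inner_sum_right) (simp add: inner_Basis)

text \<open>Linear coordinates in which the facets of the lower port become coordinate forms,
  \<open>F0\<close> the base and \<open>Hf b\<close> the walls. Then \<open>z0\<close> sits at the
  origin, \<open>w0\<close> on the b0-axis and \<open>lab b\<close> at the unit vector b.\<close>

locale gadget_chart =
  fixes v :: bool and b0 :: "'a::euclidean_space" and y :: "'a \<times> real \<Rightarrow> 'a \<Rightarrow> real" and \<zeta> :: "'a \<times> real \<Rightarrow> real"
    and coord :: "('a \<Rightarrow> real) \<Rightarrow> real \<Rightarrow> real \<Rightarrow> 'a \<times> real" and F0 Hf z0 w0 lab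
  assumes b0: "b0 \<in> Basis" and dim: "4 \<le> DIM('a)"
    and lin: "\<And>b. linear (\<lambda>k. y k b)" "linear \<zeta>"
    and coord: "\<And>Y z e b. b \<in> Basis - {b0} \<Longrightarrow> y (coord Y z e) b = Y b" "\<And>Y z e. \<zeta> (coord Y z e) = z" "\<And>Y z e. snd (coord Y z e) = e"
    and inj: "\<And>k. \<lbrakk>\<forall>b\<in>Basis - {b0}. y k b = 0; \<zeta> k = 0; snd k = 0\<rbrakk> \<Longrightarrow> k = 0"
    and bottom: "F0 \<in> gfacets v (Basis - {b0})"
      "\<And>x e. form (shift v (Basis - {b0})) (Basis - {b0}) F0 (y (x, e)) (\<zeta> (x, e)) e = x \<bullet> b0"
    and walls: "\<And>b. b \<in> Basis - {b0} \<Longrightarrow> Hf b \<in> gfacets v (Basis - {b0})"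
      "\<And>b x e. b \<in> Basis - {b0} \<Longrightarrow> form (shift v (Basis - {b0})) (Basis - {b0}) (Hf b) (y (x, e)) (\<zeta> (x, e)) e = x \<bullet> b"
    and low: "\<And>i b. \<lbrakk>i \<in> gfacets v (Basis - {b0}); b \<in> Basis - {b0}\<rbrakk> \<Longrightarrow>
        0 \<le> form (shift v (Basis - {b0})) (Basis - {b0}) i (y (b, 0)) (\<zeta> (b, 0)) 0"
      "\<And>i. \<lbrakk>i \<in> gfacets v (Basis - {b0}); i \<noteq> F0\<rbrakk> \<Longrightarrow>
        form (shift v (Basis - {b0})) (Basis - {b0}) i (y (b0, 0)) (\<zeta> (b0, 0)) 0 \<le> 0"
    and z0: "z0 \<in> gverts v (Basis - {b0})" "\<And>b. b \<in> Basis - {b0} \<Longrightarrow> vy (shift v (Basis - {b0})) z0 b = y (0, 1) b"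
      "vz (shift v (Basis - {b0})) (card (Basis - {b0})) z0 = \<zeta> (0, 1)" "ve z0 = 1"
    and w0: "w0 \<in> gverts v (Basis - {b0})" "\<And>b. b \<in> Basis - {b0} \<Longrightarrow> vy (shift v (Basis - {b0})) w0 b = y (b0, 1) b"
      "vz (shift v (Basis - {b0})) (card (Basis - {b0})) w0 = \<zeta> (b0, 1)" "ve w0 = 1"
    and lab: "\<And>b. b \<in> Basis - {b0} \<Longrightarrow> lab b \<in> gverts v (Basis - {b0}) \<and> (\<exists>t>0. (\<forall>c\<in>Basis - {b0}.
        vy (shift v (Basis - {b0})) (lab b) c = y (t *\<^sub>R b, 0) c) \<and>
        vz (shift v (Basis - {b0})) (card (Basis - {b0})) (lab b) = \<zeta> (t *\<^sub>R b, 0) \<and> ve (lab b) = 0)"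
begin

abbreviation "E \<equiv> Basis - {b0}"
abbreviation "m \<equiv> shift v E"

definition lf where "lf i k = form m E i (y k) (\<zeta> k) (snd k)"
definition h where "h j = coord (vy m j) (vz m (card E) j) (ve j)"

lemma card_ground: "card E + 1 = DIM('a)" "3 \<le> card E"
  using b0 dim by (auto simp: card_Diff_subset)

lemma coord_diff: "y (k - k') b = y k b - y k' b" "\<zeta> (k - k') = \<zeta> k - \<zeta> k'"
  using linear_diff[OF lin(1)] linear_diff[OF lin(2)] by auto

lemma coord_scale: "y (t *\<^sub>R k) b = t * y k b" "\<zeta> (t *\<^sub>R k) = t * \<zeta> k"
  using linear_cmul[OF lin(1)] linear_cmul[OF lin(2)] by auto

lemma eqI: "\<lbrakk>\<And>b. b \<in> E \<Longrightarrow> y k b = y k' b; \<zeta> k = \<zeta> k'; snd k = snd k'\<rbrakk> \<Longrightarrow> k = k'"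
  using inj[of "k - k'"] coord_diff by auto

lemma form_cong: "\<lbrakk>i \<in> gfacets v E; \<And>b. b \<in> E \<Longrightarrow> Y b = Y' b\<rbrakk> \<Longrightarrow> form m E i Y z e = form m E i Y' z e"
  by (erule gfacet_cases) (auto intro!: sum.cong)

lemma lf_h: "i \<in> gfacets v E \<Longrightarrow> lf i (h j) = form m E i (vy m j) (vz m (card E) j) (ve j)"
  unfolding lf_def h_def coord(2,3) by (rule form_cong) (simp_all add: coord)

lemma lf_h_value:
  "\<lbrakk>i \<in> gfacets v E; j \<in> gverts v E\<rbrakk> \<Longrightarrow> 0 \<le> lf i (h j) \<and> (lf i (h j) = 0 \<longleftrightarrow> inc (card E) i j)"
  unfolding lf_h by (rule form_value[OF card_ground(2)])

lemma h_eq: "\<lbrakk>\<And>b. b \<in> E \<Longrightarrow> vy m j b = y k b; vz m (card E) j = \<zeta> k; ve j = snd k\<rbrakk> \<Longrightarrow> h j = k"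
  by (rule eqI) (simp_all add: h_def coord)

lemma h_special: "h z0 = (0, 1)" "h w0 = (b0, 1)" "b \<in> E \<Longrightarrow> \<exists>t>0. h (lab b) = (t *\<^sub>R b, 0)"
proof -
  show "h z0 = (0, 1)" "h w0 = (b0, 1)" using z0 w0 by (auto intro!: h_eq)
  assume "b \<in> E"
  from lab[OF this] obtain t where "0 < t" "\<forall>c\<in>E. vy m (lab b) c = y (t *\<^sub>R b, 0) c"
    "vz m (card E) (lab b) = \<zeta> (t *\<^sub>R b, 0)" "ve (lab b) = 0" by blast
  then show "\<exists>t>0. h (lab b) = (t *\<^sub>R b, 0)" by (intro exI[of _ t]) (auto intro!: h_eq)
qed

lemma linear_lf: "i \<in> gfacets v E \<Longrightarrow> linear (lf i)"
proof (erule gfacet_cases)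
  have ls: "linear (\<lambda>k. sum (y k) S)" for S by (rule linear_compose_sum) (simp add: lin)
  have le: "linear (\<lambda>k. c * snd k :: real)" for c :: real by (rule linearI) (simp_all add: algebra_simps)
  show "linear (lf i)" if "i = Far" using le[of 1] that by (simp add: lf_def[abs_def])
  show "linear (lf i)" if "i = Lev S" for S
    unfolding lf_def[abs_def] that by (simp, intro linear_compose_add linear_compose_sub lin ls le)
  show "linear (lf i)" if "i = Cut b" for b
  proof -
    have "linear (\<lambda>k. y k b / 2)" using lin(1)[of b] linear_compose_scale_right[OF lin(1), of "1/2" b] by simp
    then show ?thesis unfolding lf_def[abs_def] that by (simp, intro linear_compose_add linear_compose_sub lin ls)
  qed
qed

lemma h_ne: assumes "j \<in> gverts v E" shows "h j \<noteq> 0"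
proof
  assume "h j = 0"
  then have "lf i (h j) = 0" if "i \<in> gfacets v E" for i using linear_0[OF linear_lf[OF that]] by simp
  then have all: "inc (card E) i j" if "i \<in> gfacets v E" for i using lf_h_value[OF that assms] that by blast
  obtain j' where "j' \<in> gverts v E" "j' \<noteq> j" using z0(1) w0(1) h_special(1,2) b0 by (metis nonzero_Basis prod.inject)
  then show False using vertex_separation[OF card_ground(2), of j' v j] assms all by blast
qed

lemma lf_rays:
  assumes k: "k \<noteq> 0" "\<forall>i\<in>gfacets v E. 0 \<le> lf i k"
    and r: "\<And>k'. (\<forall>i\<in>gfacets v E. lf i k = 0 \<longrightarrow> lf i k' = 0) \<Longrightarrow> \<exists>t. k' = t *\<^sub>R k"
  shows "\<exists>j\<in>gverts v E. \<exists>t. h j = t *\<^sub>R k"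
proof -
  interpret gadget_ray v E "y k" "\<zeta> k" "snd k" m
  proof
    show "\<not> ((\<forall>b\<in>E. y k b = 0) \<and> \<zeta> k = 0 \<and> snd k = 0)" using inj k(1) by blast
    fix Y' z' e' assume *: "\<forall>i\<in>gfacets v E. form m E i (y k) (\<zeta> k) (snd k) = 0 \<longrightarrow> form m E i Y' z' e' = 0"
    have "lf i (coord Y' z' e') = form m E i Y' z' e'" if "i \<in> gfacets v E" for i
      unfolding lf_def coord(2,3) using that by (rule form_cong) (rule coord)
    then have "\<exists>t. coord Y' z' e' = t *\<^sub>R k" using * by (intro r) (simp add: lf_def)
    then obtain t where t: "coord Y' z' e' = t *\<^sub>R k" by blast
    show "\<exists>t. (\<forall>b\<in>E. Y' b = t * y k b) \<and> z' = t * \<zeta> k \<and> e' = t * snd k"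
    proof (intro exI conjI ballI)
      show "Y' b = t * y k b" if "b \<in> E" for b using coord(1)[OF that, of Y' z' e'] unfolding t coord_scale by simp
      show "z' = t * \<zeta> k" using coord(2)[of Y' z' e'] unfolding t coord_scale by simp
      show "e' = t * snd k" using coord(3)[of Y' z' e'] unfolding t by simp
    qed
  qed (use card_ground k(2) in \<open>auto simp: lf_def\<close>)
  obtain j t where j: "j \<in> gverts v E" "\<forall>b\<in>E. vy m j b = t * y k b" "vz m (card E) j = t * \<zeta> k" "ve j = t * snd k"
    using classification by blast
  then have "h j = t *\<^sub>R k" by (intro h_eq) (simp_all add: coord_scale)
  then show ?thesis using j(1) by blast
qed

sublocale incidence_polytope "gfacets v E" "gverts v E" lf h b0 F0 Hf Far
proof (rule incidence_polytope.intro)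
  show "finite (gfacets v E)" "finite (gverts v E)" by (simp_all add: finite_gfacets finite_gverts)
  show "b0 \<in> Basis" by (rule b0)
  show "linear (lf i)" if "i \<in> gfacets v E" for i using linear_lf[OF that] .
  show "0 \<le> lf i (h j)" if "i \<in> gfacets v E" "j \<in> gverts v E" for i j using lf_h_value[OF that] by blast
  show "F0 \<in> gfacets v E" "lf F0 (x, e) = x \<bullet> b0" for x e using bottom by (simp_all add: lf_def)
  show "Hf b \<in> gfacets v E \<and> (\<forall>x e. lf (Hf b) (x, e) = x \<bullet> b)" if "b \<in> E" for b
    using walls[OF that] by (simp add: lf_def)
  show "Far \<in> gfacets v E" "lf Far (x, e) = e" for x e by (simp_all add: lf_def)
  show "\<exists>j\<in>gverts v E. lf i (h j) = 0 \<and> lf i' (h j) \<noteq> 0"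
    if "i \<in> gfacets v E" "i' \<in> gfacets v E" "i \<noteq> i'" for i i'
    using facet_separation[OF card_ground(2) that] lf_h_value that by blast
  show "\<exists>i\<in>gfacets v E. lf i (h j) = 0 \<and> lf i (h j') \<noteq> 0"
    if "j \<in> gverts v E" "j' \<in> gverts v E" "j \<noteq> j'" for j j'
    using vertex_separation[OF card_ground(2) that] lf_h_value that by blast
  show "h j \<noteq> 0" if "j \<in> gverts v E" for j by (rule h_ne[OF that])
  show "\<exists>j\<in>gverts v E. \<exists>t. h j = t *\<^sub>R k"
    if "k \<noteq> 0" "\<forall>i\<in>gfacets v E. 0 \<le> lf i k"
      "\<And>k'. (\<forall>i\<in>gfacets v E. lf i k = 0 \<longrightarrow> lf i k' = 0) \<Longrightarrow> \<exists>t. k' = t *\<^sub>R k" for k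
    by (rule lf_rays[OF that])
  show "\<exists>j\<in>gverts v E. h j = (0, 1)" using z0(1) h_special(1) by blast
  show "0 \<le> lf i (b, 0)" if "i \<in> gfacets v E" "b \<in> E" for i b using low(1)[OF that] by (simp add: lf_def)
  show "lf i (b0, 0) \<le> 0" if "i \<in> gfacets v E" "i \<noteq> F0" for i using low(2)[OF that] by (simp add: lf_def)
qed

lemma pt_special: "pt z0 = 0" "pt w0 = (1/2) *\<^sub>R b0" "b \<in> E \<Longrightarrow> pt (lab b) = b"
proof -
  show "pt z0 = 0" "pt w0 = (1/2) *\<^sub>R b0" unfolding pt_def deg_def h_special using inner_One[OF b0] by simp_all
  assume b: "b \<in> E"
  then obtain t where "0 < t" "h (lab b) = (t *\<^sub>R b, 0)" using h_special(3) by blast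
  then show "pt (lab b) = b" unfolding pt_def deg_def using inner_One[of b] b by simp
qed

lemma family_Q: "facet_family Q = (\<lambda>A. pt ` A) ` (on v E ` gfacets v E)"
proof -
  have "{j \<in> gverts v E. lf i (h j) = 0} = on v E i" if "i \<in> gfacets v E" for i
    using lf_h_value[OF that] by (auto simp: mem_on)
  then show ?thesis unfolding facet_family_Q by (simp cong: image_cong_simp)
qed

lemma on_sub: "\<Union>(on v E ` gfacets v E) \<subseteq> gverts v E" by (auto simp: mem_on)

lemma gadget_Q:
  assumes p: "port (on v E ` gfacets v E) E z0 w0 lab H"
    and tr: "traversable (facet_family Q) E 0 (sz l) (bs l)"
    and net: "card (gverts v E) = DIM('a) + 1 + net l"
  shows "gadget b0 sz bs net l Q"
proof -
  have "port (facet_family Q) E (pt z0) (pt w0) (pt \<circ> lab) (\<lambda>b. pt ` H b)"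
    unfolding family_Q by (rule port_image[OF inj_pt on_sub w0(1) p])
  then have "port (facet_family Q) E 0 ((1/2) *\<^sub>R b0) id (\<lambda>b. pt ` H b)"
    unfolding pt_special(1,2) by (rule port_cong) (simp_all add: pt_special)
  moreover have "spread DIM('a) (facet_family Q)"
    unfolding family_Q card_ground(1)[symmetric]
    by (rule spread_image[OF inj_pt on_sub spread_on]) (use card_ground in auto)
  ultimately show ?thesis
    unfolding gadget_def using polytope_Q aff_dim_Q Q_ineq(3) net tr low_facets_Q
    by (simp add: card_verts_Q) (rule exI[of _ "1/2"], auto)
qed

end

section \<open>Charts for the cube and the truncated cube\<close>

context
  fixes b0 :: "'a::euclidean_space"
  assumes b0: "b0 \<in> Basis" and dim: "4 \<le> DIM('a)"
begin

private abbreviation "B \<equiv> Basis - {b0}"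

lemma ground: "card B + 1 = DIM('a)" "3 \<le> card B" "real (card B) = real DIM('a) - 1"
  using b0 dim by (auto simp: card_Diff_subset of_nat_diff)

lemma combination_inner:
  "(Z *\<^sub>R b0 + (\<Sum>b\<in>B. c b *\<^sub>R b)) \<bullet> b0 = Z" "b' \<in> B \<Longrightarrow> (Z *\<^sub>R b0 + (\<Sum>b\<in>B. c b *\<^sub>R b)) \<bullet> b' = c b'"
proof -
  have "(\<Sum>b\<in>B. c b *\<^sub>R b) \<bullet> b' = (\<Sum>b\<in>B. if b = b' then c b else 0)" if "b' \<in> Basis" for b'
    unfolding inner_sum_left using that by (intro sum.cong) (auto simp: inner_Basis)
  then show "(Z *\<^sub>R b0 + (\<Sum>b\<in>B. c b *\<^sub>R b)) \<bullet> b0 = Z" "b' \<in> B \<Longrightarrow> (Z *\<^sub>R b0 + (\<Sum>b\<in>B. c b *\<^sub>R b)) \<bullet> b' = c b'"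
    using b0 by (auto simp: inner_add_left inner_Basis)
qed

lemma zero_if_inner: "\<lbrakk>x \<bullet> b0 = 0; \<And>b. b \<in> B \<Longrightarrow> x \<bullet> b = 0\<rbrakk> \<Longrightarrow> x = 0"
  using euclidean_eqI[of x 0] by (metis Diff_iff inner_zero_left singletonD)

lemma inner_unit: "b \<in> B \<Longrightarrow> b \<bullet> b0 = 0" "b \<in> B \<Longrightarrow> b0 \<bullet> b = 0" "b0 \<bullet> b0 = 1"
  "\<lbrakk>b \<in> B; c \<in> B\<rbrakk> \<Longrightarrow> b \<bullet> c = (if c = b then 1 else 0)"
  using b0 by (auto simp: inner_Basis)

text \<open>Obtained by solving for the requirement that \<open>Lev B\<close> be
  \<open>x \<bullet> b0\<close> and \<open>Lev (B - {b})\<close> be \<open>x \<bullet> b\<close>;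
  both levels have height 0.\<close>

definition wy :: "'a \<times> real \<Rightarrow> 'a \<Rightarrow> real" where "wy k b = fst k \<bullet> b - fst k \<bullet> b0"
definition wz :: "'a \<times> real \<Rightarrow> real" where "wz k = fst k \<bullet> b0 + (\<Sum>b\<in>B. wy k b)"
definition wback :: "('a \<Rightarrow> real) \<Rightarrow> real \<Rightarrow> real \<Rightarrow> 'a \<times> real" where
  "wback Y z e = ((z - sum Y B) *\<^sub>R b0 + (\<Sum>b\<in>B. (Y b + (z - sum Y B)) *\<^sub>R b), e)"

lemma linear_wy: "linear (\<lambda>k. wy k b)"
  by (rule linearI) (simp_all add: wy_def algebra_simps)

lemma wy_unit: "b \<in> B \<Longrightarrow> c \<in> B \<Longrightarrow> wy (t *\<^sub>R b, e) c = (if c = b then t else 0)" "c \<in> B \<Longrightarrow> wy (b0, e) c = - 1"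
  "wy (0, e) c = 0"
  by (auto simp: wy_def inner_unit)

lemma cube_chart: "gadget_chart False b0 wy wz wback (Lev B) (\<lambda>b. Lev (B - {b})) (Pv (card B - 1)) (Pv (card B - 2)) Cv"
proof (rule gadget_chart.intro)
  have m: "shift False B = real (card B)" by (simp add: shift_def)
  have cut: "sum f (B - {b}) = sum f B - f b" if "b \<in> B" for f :: "'a \<Rightarrow> real" and b
    using that by (simp add: sum_diff1)
  have uz: "wz (t *\<^sub>R b, e) = t" if "b \<in> B" for b e and t :: real
    using that by (simp add: wz_def wy_unit inner_unit)
  have bz: "wz (b0, e) = 1 - real (card B)" for e
    by (simp add: wz_def wy_unit inner_unit)
  show "b0 \<in> Basis" "4 \<le> DIM('a)" using b0 dim by auto
  show "linear (\<lambda>k. wy k b)" for b by (rule linear_wy)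
  show "linear wz" unfolding wz_def[abs_def]
    by (intro linear_compose_add linear_compose_sum ballI linear_wy) (rule linearI; simp add: algebra_simps)
  show yb: "wy (wback Y z e) b = Y b" if "b \<in> B" for Y z e b
    using that by (simp add: wy_def wback_def combination_inner)
  show "wz (wback Y z e) = z" for Y z e
  proof -
    have "(\<Sum>b\<in>B. wy (wback Y z e) b) = sum Y B" by (rule sum.cong) (simp_all add: yb)
    then show ?thesis unfolding wz_def by (simp add: wback_def combination_inner)
  qed
  show "snd (wback Y z e) = e" for Y z e by (simp add: wback_def)
  show "k = 0" if "\<forall>b\<in>B. wy k b = 0" "wz k = 0" "snd k = 0" for k
  proof -
    have "fst k \<bullet> b0 = 0" using that(1,2) by (simp add: wz_def)
    then have "fst k = 0" using that(1) by (intro zero_if_inner) (simp_all add: wy_def)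
    then show ?thesis using that(3) by (simp add: prod_eq_iff)
  qed
  show "Lev B \<in> gfacets False B" "Lev (B - {b}) \<in> gfacets False B" for b by auto
  show "form (shift False B) B (Lev B) (wy (x, e)) (wz (x, e)) e = x \<bullet> b0" for x e
    by (simp add: m lam_def wz_def)
  show "form (shift False B) B (Lev (B - {b})) (wy (x, e)) (wz (x, e)) e = x \<bullet> b" if "b \<in> B" for b x e
    using that ground(2) by (simp add: m lam_def wz_def cut of_nat_diff) (simp add: wy_def)
  show "0 \<le> form (shift False B) B i (wy (b, 0)) (wz (b, 0)) 0" if "i \<in> gfacets False B" "b \<in> B" for i b
    using that(1)
  proof (cases rule: gfacet_cases)
    case (2 S)
    have "sum (wy (b, 0)) S = (\<Sum>c\<in>S. if c = b then 1 else 0)"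
      using 2(2) that(2) wy_unit(1)[of b _ 1 0] by (intro sum.cong) (auto simp: subset_iff)
    also have "\<dots> \<le> 1" using finite_subset[OF 2(2)] by simp
    finally show ?thesis using 2(1) uz[OF that(2), of 1 0] by simp
  qed auto
  show "form (shift False B) B i (wy (b0, 0)) (wz (b0, 0)) 0 \<le> 0" if "i \<in> gfacets False B" "i \<noteq> Lev B" for i
    using that(1)
  proof (cases rule: gfacet_cases)
    case (2 S)
    have "sum (wy (b0, 0)) S = (\<Sum>c\<in>S. - 1)" using 2(2) by (intro sum.cong) (auto simp: wy_unit subset_iff)
    moreover have "card S < card B" using 2 that(2) by (intro psubset_card_mono) auto
    ultimately show ?thesis using 2(1) by (simp add: bz)
  qed auto
  show "Pv (card B - 1) \<in> gverts False B" "Pv (card B - 2) \<in> gverts False B" using ground(2) by auto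
  show "vy (shift False B) (Pv (card B - 1)) b = wy (0, 1) b" if "b \<in> B" for b
    using ground(2) by (simp add: m wy_unit of_nat_diff)
  show "vz (shift False B) (card B) (Pv (card B - 1)) = wz (0, 1)"
    using ground(2) by (simp add: m wz_def wy_unit of_nat_diff)
  show "vy (shift False B) (Pv (card B - 2)) b = wy (b0, 1) b" if "b \<in> B" for b
    using ground(2) that by (simp add: m wy_unit of_nat_diff)
  show "vz (shift False B) (card B) (Pv (card B - 2)) = wz (b0, 1)"
    using ground(2) by (simp add: m bz of_nat_diff)
  show "Cv b \<in> gverts False B \<and> (\<exists>t>0. (\<forall>c\<in>B. vy (shift False B) (Cv b) c = wy (t *\<^sub>R b, 0) c) \<and>
      vz (shift False B) (card B) (Cv b) = wz (t *\<^sub>R b, 0) \<and> ve (Cv b) = 0)" if "b \<in> B" for b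
    using that by (intro conjI exI[of _ 1]) (simp_all add: uz wy_unit del: scaleR_one)
qed (simp_all)

text \<open>The excess is 3(d - 1) - (d + 1) = 2d - 4.\<close>

lemma cube_gadget:
  assumes sz: "sz l = 2 * card B" and bs: "distinct (bs l)" "set (bs l) = B" and net: "net l = 2 * DIM('a) - 4"
  obtains Q where "gadget b0 sz bs net l Q"
proof -
  interpret gadget_chart False b0 wy wz wback "Lev B" "\<lambda>b. Lev (B - {b})" "Pv (card B - 1)" "Pv (card B - 2)" Cv
    by (rule cube_chart)
  note n3 = ground(2)
  have "traversable (facet_family Q) B (pt (Pv (card B - 1))) (sz l) (bs l)"
    unfolding family_Q
  proof (rule traversable_image[OF inj_pt on_sub cube_top(1)[OF n3]])
    show "on False B Far \<in> on False B ` gfacets False B" by (intro imageI) simp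
    show "walk (on False B ` gfacets False B) B (on False B Far) (bs l) (insert (Pv 0) (Av ` B)) Av
        (insert (Pv (card B - 1)) ((\<lambda>b. if b \<in> B then Cv b else Av b) ` B)) (\<lambda>b. if b \<in> B then Cv b else Av b)"
      using cube_walk[OF n3 bs] by (simp cong: image_cong_simp)
    show "pt (if b \<in> B then Cv b else Av b) = b" if "b \<in> B" for b using that pt_special(3) by simp
  qed (use n3 sz far_facet[OF n3] in \<open>auto simp: mem_on\<close>)
  then show ?thesis
    using ground net card_gverts(1)[of B] cube_bottom(1)[OF n3] pt_special(1)
    by (intro that[OF gadget_Q]) auto
qed

context
  fixes be assumes be: "be \<in> B"
begin

text \<open>Solves for \<open>Lev (B - {be})\<close>, of height 1, to be
  \<open>x \<bullet> b0\<close>, for \<open>Cut be\<close> to be \<open>x \<bullet> be\<close> and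
  for \<open>Lev (B - {be, b})\<close> to be \<open>x \<bullet> b\<close>. The factor 2 undoes the
  half in the form of a cut.\<close>

definition ty :: "'a \<times> real \<Rightarrow> 'a \<Rightarrow> real" where
  "ty k b = (if b = be then 2 * (fst k \<bullet> b0 - snd k - fst k \<bullet> be) else fst k \<bullet> b - fst k \<bullet> b0 + snd k)"
definition tz :: "'a \<times> real \<Rightarrow> real" where "tz k = fst k \<bullet> b0 - snd k + (\<Sum>b\<in>B - {be}. ty k b)"
definition tcoord :: "('a \<Rightarrow> real) \<Rightarrow> real \<Rightarrow> real \<Rightarrow> 'a \<times> real" where
  "tcoord Y z e = (let u = z - sum Y (B - {be}) in
     ((u + e) *\<^sub>R b0 + (\<Sum>b\<in>B. (if b = be then u - Y be / 2 else Y b + u) *\<^sub>R b), e))"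

lemma linear_ty: "linear (\<lambda>k. ty k b)"
  by (rule linearI) (simp_all add: ty_def algebra_simps)

lemma ty_unit:
  "b \<in> B \<Longrightarrow> b \<noteq> be \<Longrightarrow> c \<in> B \<Longrightarrow> ty (t *\<^sub>R b, 0) c = (if c = b then t else 0)"
  "c \<in> B \<Longrightarrow> ty (t *\<^sub>R be, 0) c = (if c = be then - 2 * t else 0)"
  "c \<in> B \<Longrightarrow> ty (b0, e) c = (if c = be then 2 - 2 * e else e - 1)"
  "ty (0, e) c = (if c = be then - 2 * e else e)"
  using inner_unit be by (auto simp: ty_def)

lemma card_rest: "card (B - {be}) + 2 = DIM('a)" "real (card (B - {be})) = real (card B) - 1"
  using ground be by (auto simp: card_Diff_subset of_nat_diff)

lemma tz_unit:
  "b \<in> B \<Longrightarrow> tz (t *\<^sub>R b, 0) = (if b = be then 0 else t)"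
  "tz (b0, e) = (1 - e) * (2 - real (card B))" "tz (0, e) = e * (real (card B) - 2)"
proof -
  have s: "(\<Sum>c\<in>B - {be}. ty (t *\<^sub>R b, 0) c) = (if b = be then 0 else t)" if "b \<in> B" for b
  proof -
    have "(\<Sum>c\<in>B - {be}. ty (t *\<^sub>R b, 0) c) = (\<Sum>c\<in>B - {be}. if c = b then t else 0)"
      using that ty_unit(1)[of b] ty_unit(2) by (cases "b = be") (auto intro!: sum.cong)
    then show ?thesis using that by simp
  qed
  show "tz (t *\<^sub>R b, 0) = (if b = be then 0 else t)" if "b \<in> B"
    unfolding tz_def s[OF that] using inner_unit(1)[OF that] by simp
  have "(\<Sum>c\<in>B - {be}. ty (b0, e) c) = (\<Sum>c\<in>B - {be}. e - 1)" by (rule sum.cong) (auto simp: ty_unit)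
  then show "tz (b0, e) = (1 - e) * (2 - real (card B))"
    unfolding tz_def using inner_unit(3) by (simp add: card_rest(2)) (simp add: algebra_simps)
  have "(\<Sum>c\<in>B - {be}. ty (0, e) c) = (\<Sum>c\<in>B - {be}. e)" by (rule sum.cong) (auto simp: ty_unit)
  then show "tz (0, e) = e * (real (card B) - 2)"
    unfolding tz_def by (simp add: card_rest(2)) (simp add: algebra_simps)
qed

lemma sum_without: "sum f B = f be + sum f (B - {be})" for f :: "'a \<Rightarrow> real"
  using be by (simp add: sum.remove)

private abbreviation "thf \<equiv> \<lambda>b. if b = be then Cut be else Lev (B - {be, b})"

lemma trunc_chart: "gadget_chart True b0 ty tz tcoord (Lev (B - {be})) thf (Tv be) (Pv (card B - 3)) (tlab be)"
proof (rule gadget_chart.intro)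
  have m: "shift True B = real (card B) - 2" by (simp add: shift_def)
  note n3 = ground(2)
  show "b0 \<in> Basis" "4 \<le> DIM('a)" using b0 dim by auto
  show "linear (\<lambda>k. ty k b)" for b by (rule linear_ty)
  show "linear tz" unfolding tz_def[abs_def]
    by (intro linear_compose_add linear_compose_sum ballI linear_ty) (rule linearI; simp add: algebra_simps)
  show yb: "ty (tcoord Y z e) b = Y b" if "b \<in> B" for Y z e b
    using that be combination_inner by (auto simp: ty_def tcoord_def Let_def)
  show "tz (tcoord Y z e) = z" for Y z e
  proof -
    have "(\<Sum>b\<in>B - {be}. ty (tcoord Y z e) b) = sum Y (B - {be})" by (rule sum.cong) (simp_all add: yb)
    then show ?thesis unfolding tz_def by (simp add: tcoord_def combination_inner Let_def)
  qed
  show "snd (tcoord Y z e) = e" for Y z e by (simp add: tcoord_def Let_def)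
  show "k = 0" if "\<forall>b\<in>B. ty k b = 0" "tz k = 0" "snd k = 0" for k
  proof -
    have "fst k \<bullet> b0 = 0" using that by (simp add: tz_def)
    then have "fst k \<bullet> b = 0" if "b \<in> B" for b
      using \<open>\<forall>b\<in>B. ty k b = 0\<close> \<open>snd k = 0\<close> that be by (auto simp: ty_def split: if_splits)
    then have "fst k = 0" using \<open>fst k \<bullet> b0 = 0\<close> by (intro zero_if_inner)
    then show ?thesis using that(3) by (simp add: prod_eq_iff)
  qed
  show "Lev (B - {be}) \<in> gfacets True B" "thf b \<in> gfacets True B" for b using be by auto
  have c1: "card (B - {be}) = card B - 1" by (rule card_minus1[OF n3 be])
  show "form (shift True B) B (Lev (B - {be})) (ty (x, e)) (tz (x, e)) e = x \<bullet> b0" for x e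
    using n3 by (simp add: m lam_def tz_def c1 of_nat_diff)
  show "form (shift True B) B (thf b) (ty (x, e)) (tz (x, e)) e = x \<bullet> b" if b: "b \<in> B" for b x e
  proof (cases "b = be")
    case True
    then show ?thesis by (simp add: m tz_def sum_without) (simp add: ty_def field_simps)
  next
    case False
    have eq: "B - {be, b} = B - {be} - {b}" by blast
    have "sum f (B - {be, b}) = sum f (B - {be}) - f b" for f :: "'a \<Rightarrow> real"
      unfolding eq by (subst sum_diff1) (use b False in simp_all)
    then show ?thesis using False n3 card_minus2[OF n3 be b]
      by (simp add: m lam_def tz_def of_nat_diff) (simp add: ty_def)
  qed
  have fS: "finite S" if "S \<subseteq> B" for S :: "'a set" using that finite_subset[OF that] by simp
  show "0 \<le> form (shift True B) B i (ty (b, 0)) (tz (b, 0)) 0" if i: "i \<in> gfacets True B" and b: "b \<in> B" for i b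
  proof -
    define p :: real where "p = (if b = be then - 2 else 1)"
    have y: "ty (b, 0) c = (if c = b then p else 0)" if "c \<in> B" for c
      using that b ty_unit(1)[of b c 1] ty_unit(2)[of c 1] by (auto simp: p_def)
    have z: "tz (b, 0) = (if b = be then 0 else 1)" using tz_unit(1)[OF b, of 1] by simp
    have s: "sum (ty (b, 0)) S = (if b \<in> S then p else 0)" if "S \<subseteq> B" for S
    proof -
      have "sum (ty (b, 0)) S = (\<Sum>c\<in>S. if c = b then p else 0)" using that y by (intro sum.cong) (auto simp: subset_iff)
      then show ?thesis using fS[OF that] by simp
    qed
    from i show ?thesis
    proof (cases rule: gfacet_cases)
      case (2 S)
      then show ?thesis using s[of S] z by (auto simp: p_def)
    next
      case (3 c)
      then show ?thesis using s[of B] z y[of c] b by (auto simp: p_def)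
    qed simp
  qed
  show "form (shift True B) B i (ty (b0, 0)) (tz (b0, 0)) 0 \<le> 0" if i: "i \<in> gfacets True B" "i \<noteq> Lev (B - {be})" for i
  proof -
    have y: "ty (b0, 0) c = (if c = be then 2 else - 1)" if "c \<in> B" for c using ty_unit(3)[OF that] by simp
    have z: "tz (b0, 0) = 2 - real (card B)" using tz_unit(2) by simp
    have s: "sum (ty (b0, 0)) S = (if be \<in> S then 3 else 0) - real (card S)" if "S \<subseteq> B" for S
    proof -
      have "sum (ty (b0, 0)) S = (\<Sum>c\<in>S. if c = be then 2 else - 1)" using that y by (intro sum.cong) (auto simp: subset_iff)
      then show ?thesis using fS[OF that] by (simp add: sum_two_values)
    qed
    from i(1) show ?thesis
    proof (cases rule: gfacet_cases)
      case (2 S)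
      have "card S + 2 \<le> card B \<or> be \<in> S \<and> card S \<le> card B"
      proof (cases "be \<in> S")
        case True then show ?thesis using 2(2) by (simp add: card_mono)
      next
        case False
        then have "S \<subset> B - {be}" using 2 i(2) by blast
        then have "card S < card B - 1" unfolding c1[symmetric] by (intro psubset_card_mono) auto
        then show ?thesis by (intro disjI1) linarith
      qed
      then show ?thesis using 2 s[of S] z by (auto split: if_splits)
    next
      case (3 c)
      then show ?thesis using s[of B] z y[of c] be by auto
    qed simp
  qed
  show "Tv be \<in> gverts True B" "Pv (card B - 3) \<in> gverts True B" using be n3 by auto
  show "vy (shift True B) (Tv be) b = ty (0, 1) b" "vz (shift True B) (card B) (Tv be) = tz (0, 1)" for b
    by (simp_all add: ty_unit tz_unit)
  show "vy (shift True B) (Pv (card B - 3)) b = ty (b0, 1) b" if "b \<in> B" for b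
    using n3 ty_unit(3)[OF that] by (simp add: m of_nat_diff)
  show "vz (shift True B) (card B) (Pv (card B - 3)) = tz (b0, 1)"
    using n3 by (simp add: m tz_unit of_nat_diff)
  show "tlab be b \<in> gverts True B \<and> (\<exists>t>0. (\<forall>c\<in>B. vy (shift True B) (tlab be b) c = ty (t *\<^sub>R b, 0) c) \<and>
      vz (shift True B) (card B) (tlab be b) = tz (t *\<^sub>R b, 0) \<and> ve (tlab be b) = 0)" if "b \<in> B" for b
  proof (cases "b = be")
    case True
    then show ?thesis using be tz_unit(1)[OF be]
      by (intro conjI exI[of _ "1/2"]) (simp_all add: ty_unit(2))
  next
    case False
    then show ?thesis using that tz_unit(1)[OF that]
      by (intro conjI exI[of _ 1]) (simp_all add: ty_unit(1) del: scaleR_one)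
  qed
qed (simp_all)

text \<open>The excess is 4(d - 1) - 1 - (d + 1) = 3d - 6.\<close>

lemma trunc_gadget:
  assumes be2: "be2 \<in> B" "be2 \<noteq> be"
    and sz: "sz l = 2 * card B + 1" and bs: "bs l = [be, be2]" and net: "net l = 3 * DIM('a) - 6"
  obtains Q where "gadget b0 sz bs net l Q"
proof -
  interpret gadget_chart True b0 ty tz tcoord "Lev (B - {be})" thf "Tv be" "Pv (card B - 3)" "tlab be"
    by (rule trunc_chart)
  note n3 = ground(2)
  have "traversable (facet_family Q) B (pt (Tv be)) (sz l) (bs l)"
    unfolding family_Q bs
  proof (rule traversable_image[OF inj_pt on_sub trunc_port(1)[OF n3 be2(1)]])
    show "on True B Far \<in> on True B ` gfacets True B" by (intro imageI) simp
    show "walk (on True B ` gfacets True B) B (on True B Far) [be, be2]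
       (insert (Tv be2) (tlab be2 ` B)) (tlab be2) (insert (Tv be) (tlab be ` B)) (tlab be)"
      by (rule trunc_walk[OF n3 be be2(1)]) (use be2 in auto)
    show "pt (tlab be b) = b" if "b \<in> B" for b using that by (rule pt_special(3))
  qed (use n3 be be2 sz far_facet[OF n3] in \<open>auto simp: mem_on\<close>)
  then show ?thesis
    using ground net card_gverts(2)[of B] trunc_port(1)[OF n3 be] pt_special(1)
    by (intro that[OF gadget_Q]) auto
qed

end

end

subsection \<open>Chains realizing words\<close>

text \<open>The chain starts with the port at 0 on the facet opposite b0. The marked facet, opposite
  0, has d vertices, so reading stops at once.\<close>

lemma chained_simplex:
  fixes b0 :: "'a::euclidean_space"
  assumes b0: "b0 \<in> Basis"
  defines "S \<equiv> insert (0::'a) Basis"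
  shows "chained b0 sz bs [] (convex hull S) 0 b0 id (\<lambda>b. S - {b}) Basis" "card (verts (convex hull S)) = DIM('a) + 1"
proof -
  let ?P = "convex hull S"
  have fS: "finite S" and cS: "card S = DIM('a) + 1" by (simp_all add: S_def)
  have ind: "\<not> affine_dependent S"
    unfolding S_def using independent_Basis by (subst affine_dependent_iff_dependent) simp_all
  have V: "verts (convex hull T) = T" if "T \<subseteq> S" for T
    using extreme_point_of_convex_hull_affine_independent[OF affine_independent_subset[OF ind that]]
    by (auto simp: verts_def)
  show "card (verts ?P) = DIM('a) + 1" by (simp add: V cS)
  have pP: "polytope ?P" using fS by (auto simp: polytope_def)
  have facets: "Y facet_of ?P \<longleftrightarrow> (\<exists>u\<in>S. Y = convex hull (S - {u}))" for Y
  proof -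
    have "S - {u} \<noteq> {}" for u using b0 by (auto simp: S_def)
    then show ?thesis using facet_of_convex_hull_affine_independent[OF ind, of Y] by (metis convex_hull_eq_empty)
  qed
  have fam: "facet_family ?P = (\<lambda>u. S - {u}) ` S"
  proof -
    have "verts ?P \<inter> convex hull (S - {u}) = S - {u}" if "u \<in> S" for u
    proof -
      have "convex hull (S - {u}) face_of ?P" using facets that facet_of_imp_face_of by blast
      then show ?thesis using verts_face V[of "S - {u}"] by (metis Diff_subset)
    qed
    moreover have "{Y. Y facet_of ?P} = (\<lambda>u. convex hull (S - {u})) ` S" using facets by auto
    ultimately show ?thesis unfolding facet_family_def by (simp add: image_image cong: image_cong_simp)
  qed
  have "spread DIM('a) (facet_family ?P)"
    unfolding spread_def fam
  proof (intro allI impI, elim conjE)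
    fix \<G> assume \<G>: "\<G> \<subseteq> (\<lambda>u. S - {u}) ` S" "2 \<le> card \<G>" "card \<G> \<le> 4"
    obtain U where U: "U \<subseteq> S" "\<G> = (\<lambda>u. S - {u}) ` U" "inj_on (\<lambda>u. S - {u}) U"
      using \<G>(1) unfolding subset_image_inj by blast
    have fU: "finite U" using U(1) fS finite_subset by blast
    have c: "card \<G> = card U" using U by (simp add: card_image)
    then have "U \<noteq> {}" using \<G>(2) by auto
    then have "\<Inter>\<G> = S - U" unfolding U(2) by blast
    then show "card (\<Inter>\<G>) + card \<G> \<le> DIM('a) + 1"
      using U(1) fU c cS card_mono[OF fS U(1)] by (simp add: card_Diff_subset)
  qed
  moreover have "aff_dim ?P = int DIM('a)" using aff_dim_affine_independent[OF ind] cS by (simp add: aff_dim_convex_hull)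
  moreover have F: "insert 0 (Basis - {b0}) = S - {b0}" using b0 by (auto simp: S_def)
  moreover have "port (facet_family ?P) (Basis - {b0}) 0 b0 id (\<lambda>b. S - {b})"
  proof -
    have "b0 \<noteq> 0" using b0 by auto
    moreover have "A = S - {b0} \<or> A \<in> (\<lambda>b. S - {b}) ` (Basis - {b0})" if "A \<in> (\<lambda>u. S - {u}) ` S" "0 \<in> A" for A
      using that by (auto simp: S_def)
    moreover have "0 \<notin> Basis - {b0}" "b0 \<in> S" "0 \<in> S" "Basis - {b0} \<subseteq> S" using b0 by (auto simp: S_def)
    ultimately show ?thesis unfolding port_def fam image_id id_apply F by (auto simp: S_def)
  qed
  moreover have "state (facet_family ?P) (Basis - {b0}) Basis (insert 0 (id ` (Basis - {b0}))) id"
  proof -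
    have "Basis = S - {0}" by (auto simp: S_def)
    then have "Basis \<in> facet_family ?P" "S - {b0} \<in> facet_family ?P" using b0 unfolding fam by (auto simp: S_def)
    moreover have "Basis \<noteq> S - {b0}" using b0 by auto
    ultimately show ?thesis unfolding state_def image_id using F by (auto simp: S_def)
  qed
  moreover have "decodes (facet_family ?P) (Basis - {b0}) DIM('a) sz bs (verts ?P - {0}) [] Basis
      (insert 0 (id ` (Basis - {b0}))) id"
    by (rule dec_Nil) (auto simp: V, auto simp: S_def)
  ultimately show "chained b0 sz bs [] ?P 0 b0 id (\<lambda>b. S - {b}) Basis"
    unfolding chained_def using pP by simp
qed

text \<open>Letters are the variants of the gadgets: \<open>False\<close> for the cube, \<open>True\<close> for the truncated cube.\<close>

definition letter_size :: "nat \<Rightarrow> bool \<Rightarrow> nat" where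
  "letter_size d l = 2 * (d - 1) + (if l then 1 else 0)"

definition letter_net :: "nat \<Rightarrow> bool \<Rightarrow> nat" where
  "letter_net d l = (if l then 3 * d - 6 else 2 * d - 4)"

lemma chains_exist:
  fixes b0 :: "'a::euclidean_space"
  assumes b0: "b0 \<in> Basis" and dim: "4 \<le> DIM('a)"
  obtains bs :: "bool \<Rightarrow> 'a list" where "\<And>ws. \<exists>P v w a H G. chained b0 (letter_size DIM('a)) bs ws P v w a H G \<and>
    card (verts P) = DIM('a) + 1 + sum_list (map (letter_net DIM('a)) ws)"
proof -
  let ?B = "Basis - {b0}" and ?sz = "letter_size DIM('a)" and ?net = "letter_net DIM('a)"
  have cB: "card ?B + 1 = DIM('a)" by (rule ground(1)[OF b0 dim])
  obtain es where es: "distinct es" "set es = ?B" using finite_distinct_list[of ?B] by auto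
  have "2 \<le> card ?B" using cB dim by linarith
  then obtain be be2 where be: "be \<in> ?B" "be2 \<in> ?B" "be2 \<noteq> be" by (metis obtain_two)
  define bs where "bs l = (if l then [be, be2] else es)" for l
  have sz: "?sz l = 2 * card ?B + (if l then 1 else 0)" for l using cB by (simp add: letter_size_def)
  obtain Q0 where Q0: "gadget b0 ?sz bs ?net False Q0"
    by (rule cube_gadget[OF b0 dim, of ?sz False bs ?net]) (use es sz in \<open>auto simp: bs_def letter_net_def\<close>)
  obtain Q1 where Q1: "gadget b0 ?sz bs ?net True Q1"
    by (rule trunc_gadget[OF b0 dim be, of ?sz True bs ?net]) (use sz in \<open>auto simp: bs_def letter_net_def\<close>)
  have gad: "\<exists>Q. gadget b0 ?sz bs ?net l Q" for l using Q0 Q1 by (cases l) auto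
  have big: "DIM('a) \<le> ?sz l" for l using dim by (simp add: letter_size_def)
  have "\<exists>P v w a H G. chained b0 ?sz bs ws P v w a H G \<and> card (verts P) = DIM('a) + 1 + sum_list (map ?net ws)" for ws
  proof (induction ws)
    case Nil
    show ?case using chained_simplex[OF b0] by fastforce
  next
    case (Cons l ws)
    then obtain P v w a H G where P: "chained b0 ?sz bs ws P v w a H G"
      "card (verts P) = DIM('a) + 1 + sum_list (map ?net ws)" by blast
    obtain Q where "gadget b0 ?sz bs ?net l Q" using gad by blast
    then obtain P' v' w' a' H' G' where "chained b0 ?sz bs (l # ws) P' v' w' a' H' G'" "card (verts P') = card (verts P) + ?net l"
      using attach_gadget[OF b0 dim big P(1)] by metis
    then show ?case using P(2) by fastforce
  qed
  then show ?thesis using that by blast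
qed

subsection \<open>Counting\<close>

lemma card_le_fibres:
  assumes "finite W" and K: "\<And>C. C \<in> f ` W \<Longrightarrow> card {w \<in> W. f w = C} \<le> K"
  shows "card W \<le> card (f ` W) * K"
proof -
  have "W = (\<Union>C\<in>f ` W. {w \<in> W. f w = C})" by blast
  then have "card W \<le> (\<Sum>C\<in>f ` W. card {w \<in> W. f w = C})"
    using card_UN_le[of "f ` W" "\<lambda>C. {w \<in> W. f w = C}"] assms(1) by simp
  also have "\<dots> \<le> card (f ` W) * K" using sum_bounded_above[of "f ` W" _ K] K by simp
  finally show ?thesis .
qed

text \<open>Labellings are extensional so that each flag has only finitely many.\<close>

definition markings :: "'v set set \<Rightarrow> 'b set \<Rightarrow> ('v set \<times> 'v set \<times> ('b \<Rightarrow> 'v)) set" where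
  "markings \<F> B = {(G, Y, r). state \<F> B G Y r \<and> r \<in> extensional B}"

text \<open>Three facets share at most d - 2 vertices, so at most two contain the d - 1 labelled
  ones. This leaves four ordered pairs for each of the at most V^(d - 1) labellings, where V is the
  number of vertices in use.\<close>

lemma card_markings:
  assumes sp: "spread d \<F>" and fin: "finite (\<Union>\<F>)" and B: "finite B" "card B + 1 = d" "4 \<le> d"
  shows "finite (markings \<F> B)" "card (markings \<F> B) \<le> card (\<Union>\<F>) ^ card B * 4"
proof -
  let ?R = "{r \<in> B \<rightarrow>\<^sub>E \<Union>\<F>. inj_on r B}" and ?through = "\<lambda>r. {A \<in> \<F>. r ` B \<subseteq> A}"
  let ?M = "SIGMA r:?R. ?through r \<times> ?through r"
  have finF: "finite \<F>" using fin by (rule finite_UnionD)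
  have finR: "finite (B \<rightarrow>\<^sub>E \<Union>\<F>)" using B(1) fin by (intro finite_PiE) auto
  have two: "card (?through r) \<le> 2" if "r \<in> ?R" for r
  proof (rule ccontr)
    assume "\<not> card (?through r) \<le> 2"
    then obtain \<G> where \<G>: "\<G> \<subseteq> ?through r" "card \<G> = 3" using ex_card[of 3 "?through r"] by auto
    have "r ` B \<subseteq> \<Inter>\<G>" using \<G>(1) by blast
    moreover have "\<G> \<noteq> {}" using \<G>(2) by auto
    ultimately have "card (r ` B) + card \<G> \<le> d + 1"
      using \<G> by (intro spread_mono_card[OF sp fin]) auto
    moreover have "card (r ` B) = card B" using that by (simp add: card_image)
    ultimately show False using \<G>(2) B by simp
  qed
  have sub: "(\<lambda>(G, Y, r). (r, G, Y)) ` markings \<F> B \<subseteq> ?M"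
    by (auto simp: markings_def state_def PiE_def Pi_def)
  have finM: "finite ?M" using finR finF by (intro finite_SigmaI) auto
  have inj: "inj_on (\<lambda>(G, Y, r). (r, G, Y)) (markings \<F> B)" by (auto simp: inj_on_def)
  show "finite (markings \<F> B)" using finite_subset[OF sub finM] inj by (rule finite_imageD)
  have "card (markings \<F> B) \<le> card ?M" by (rule card_inj_on_le[OF inj sub finM])
  also have "\<dots> = (\<Sum>r\<in>?R. card (?through r) * card (?through r))"
    using finR finF by (subst card_SigmaI) (auto simp: card_cartesian_product)
  also have "\<dots> \<le> (\<Sum>r\<in>?R. 4)" 
    by (rule sum_mono) (use two mult_le_mono[OF two two] in fastforce)
  also have "\<dots> = card ?R * 4" by simp
  also have "\<dots> \<le> card (\<Union>\<F>) ^ card B * 4"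
    using card_mono[OF finR, of ?R] B(1) by (simp add: card_PiE)
  finally show "card (markings \<F> B) \<le> card (\<Union>\<F>) ^ card B * 4" .
qed

text \<open>In each class one representative is fixed. Every word realized in the class carries its
  marked flag over to it, and by determinism distinct words arrive at distinct markings. So the
  fibres over the classes are bounded by the number of markings.\<close>

lemma comb_types_ge_words:
  fixes b0 :: "'a::euclidean_space" and N :: nat and W :: "'l list set"
  assumes b0: "b0 \<in> Basis" and dim: "4 \<le> DIM('a)" and sz: "inj sz" "DIM('a) \<notin> range sz"
    and W: "finite W" and ch: "\<And>ws. ws \<in> W \<Longrightarrow> \<exists>P v w a H G. chained b0 sz bs ws P v w a H G \<and> card (verts P) = N"
  shows "card W \<le> num_comb_types (simplicial_simple_polytopes DIM('a) N :: 'a set set) * (N ^ (DIM('a) - 1) * 4)"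
proof -
  let ?B = "Basis - {b0}" and ?A = "simplicial_simple_polytopes DIM('a) N :: 'a set set"
  let ?r = "{(P, Q). P \<in> ?A \<and> Q \<in> ?A \<and> comb_equiv P Q}"
  have cB: "finite ?B" "card ?B + 1 = DIM('a)" using ground(1)[OF b0 dim] by auto
  obtain P v w a H G where ch: "\<And>ws. ws \<in> W \<Longrightarrow> chained b0 sz bs ws (P ws) (v ws) (w ws) (a ws) (H ws) (G ws)"
    and cV: "\<And>ws. ws \<in> W \<Longrightarrow> card (verts (P ws)) = N"
    using ch by metis
  have poly: "polytope (P ws)" "aff_dim (P ws) = int DIM('a)" "spread DIM('a) (facet_family (P ws))" if "ws \<in> W" for ws
    using ch[OF that] by (auto simp: chained_def)
  have fin: "finite (\<Union>(facet_family (P ws)))" "card (\<Union>(facet_family (P ws))) \<le> N" if "ws \<in> W" for ws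
  proof -
    have "\<Union>(facet_family (P ws)) \<subseteq> verts (P ws)" using facet_family_subset by blast
    then show "finite (\<Union>(facet_family (P ws)))" "card (\<Union>(facet_family (P ws))) \<le> N"
      using finite_verts[OF poly(1)[OF that]] cV[OF that] finite_subset card_mono by metis+
  qed
  have PA: "P ws \<in> ?A" if "ws \<in> W" for ws
    using poly[OF that] cV[OF that] spread_imp_simplicial_simple[OF poly(1,2)[OF that] dim poly(3)[OF that]]
    by (simp add: simplicial_simple_polytopes_def d_polytope_def verts_def)
  define cls where "cls ws = ?r `` {P ws}" for ws
  have finA: "finite (?A // ?r)"
    by (rule finite_comb_types[where N = N]) (auto simp: simplicial_simple_polytopes_def d_polytope_def verts_def)
  have "card W \<le> card (cls ` W) * (N ^ (DIM('a) - 1) * 4)"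
  proof (rule card_le_fibres[OF W])
    fix C assume "C \<in> cls ` W"
    then obtain w0 where w0: "w0 \<in> W" "cls w0 = C" by blast
    let ?\<F> = "facet_family (P w0)"
    have "\<exists>M\<in>markings ?\<F> ?B. decodes ?\<F> ?B DIM('a) sz bs (verts (P w0)) ws (fst M) (fst (snd M)) (snd (snd M))"
      if ws: "ws \<in> W" "cls ws = C" for ws
    proof -
      have "P ws \<in> cls ws" unfolding cls_def using PA[OF ws(1)] comb_equiv_refl by blast
      then have "P ws \<in> cls w0" using ws(2) w0(2) by simp
      then have "comb_equiv (P w0) (P ws)" by (simp add: cls_def)
      then have "comb_equiv (P ws) (P w0)" by (rule comb_equiv_sym)
      then obtain \<phi> where \<phi>: "bij_betw \<phi> (verts (P ws)) (verts (P w0))"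
        "facet_family (P w0) = (\<lambda>A. \<phi> ` A) ` facet_family (P ws)"
        using comb_equiv_imp_family_iso[of "P ws" "P w0"] poly(1,2)[OF ws(1)] poly(1,2)[OF w0(1)] dim by auto
      have inj: "inj_on \<phi> (verts (P ws))" and img: "\<phi> ` verts (P ws) = verts (P w0)"
        using \<phi>(1) by (auto simp: bij_betw_def)
      have sub: "\<Union>(facet_family (P ws)) \<subseteq> verts (P ws)" using facet_family_subset by blast
      let ?Y = "insert (v ws) (a ws ` ?B)" and ?F = "facet_family (P ws)"
      have st: "state ?F ?B (G ws) ?Y (a ws)"
        and dec: "decodes ?F ?B DIM('a) sz bs (verts (P ws)) ws (G ws) ?Y (a ws)"
        using ch[OF ws(1)] decodes_mono[of ?F ?B "DIM('a)" sz bs _ ws "G ws" ?Y "a ws" "verts (P ws)"]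
        by (auto simp: chained_def)
      let ?r' = "restrict (\<phi> \<circ> a ws) ?B"
      have st': "state ?\<F> ?B (\<phi> ` G ws) (\<phi> ` ?Y) ?r'"
        using state_image[OF inj sub st] unfolding \<phi>(2) by (rule state_cong) simp
      have dec': "decodes ?\<F> ?B DIM('a) sz bs (verts (P w0)) ws (\<phi> ` G ws) (\<phi> ` ?Y) ?r'"
        using decodes_image[OF inj sub dec st] unfolding \<phi>(2) img by (rule decodes_cong) simp
      show ?thesis
        by (rule bexI[of _ "(\<phi> ` G ws, \<phi> ` ?Y, ?r')"]) (use st' dec' in \<open>auto simp: markings_def\<close>)
    qed
    then obtain M where M: "\<And>ws. \<lbrakk>ws \<in> W; cls ws = C\<rbrakk> \<Longrightarrow> M ws \<in> markings ?\<F> ?B \<and>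
        decodes ?\<F> ?B DIM('a) sz bs (verts (P w0)) ws (fst (M ws)) (fst (snd (M ws))) (snd (snd (M ws)))"
      by metis
    have "inj_on M {ws \<in> W. cls ws = C}"
    proof (rule inj_onI)
      fix x y assume xy: "x \<in> {ws \<in> W. cls ws = C}" "y \<in> {ws \<in> W. cls ws = C}" "M x = M y"
      have "state ?\<F> ?B (fst (M x)) (fst (snd (M x))) (snd (snd (M x)))"
        using M[of x] xy(1) by (auto simp: markings_def)
      then show "x = y"
        using decodes_det[OF poly(3)[OF w0(1)] fin(1)[OF w0(1)] cB dim sz] M[of x] M[of y] xy by (metis (mono_tags, lifting) mem_Collect_eq)
    qed
    moreover have "M ` {ws \<in> W. cls ws = C} \<subseteq> markings ?\<F> ?B" using M by blast
    moreover note mk = card_markings[OF poly(3)[OF w0(1)] fin(1)[OF w0(1)] cB dim]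
    ultimately have "card {ws \<in> W. cls ws = C} \<le> card (markings ?\<F> ?B)" using card_inj_on_le by blast
    also have "\<dots> \<le> card (\<Union>?\<F>) ^ card ?B * 4" by (rule mk(2))
    also have "\<dots> \<le> N ^ card ?B * 4" using fin(2)[OF w0(1)] by (simp add: power_mono)
    finally show "card {ws \<in> W. cls ws = C} \<le> N ^ (DIM('a) - 1) * 4" using cB(2) by (metis add_diff_cancel_right')
  qed
  also have "card (cls ` W) \<le> num_comb_types ?A"
    unfolding num_comb_types_def by (rule card_mono[OF finA]) (use PA in \<open>auto simp: cls_def quotient_def\<close>)
  finally show ?thesis by simp
qed

text \<open>Both blocks add \<open>6d - 12\<close> vertices; the letters \<open>False\<close> at the end of a word take care of the
  residue of \<open>k + 1\<close> modulo 3.\<close>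

definition block :: "bool \<Rightarrow> bool list" where "block b = (if b then [True, True] else [False, False, False])"

definition word :: "nat \<Rightarrow> bool list \<Rightarrow> bool list" where "word t cs = concat (map block cs) @ replicate t False"

text \<open>A block is recognized by its first letter, so blocks form a prefix code; the number of
  blocks is fixed.\<close>

lemma inj_on_word: "inj_on (word t) {cs. length cs = q}"
proof (rule inj_onI)
  fix cs cs' assume "cs \<in> {cs. length cs = q}" "cs' \<in> {cs. length cs = q}" and eq: "word t cs = word t cs'"
  then have "length cs = length cs'" by simp
  then show "cs = cs'" using eq
    by (induction cs cs' rule: list_induct2) (auto simp: word_def block_def split: if_splits)
qed

lemma net_word:
  assumes "4 \<le> d"
  shows "sum_list (map (letter_net d) (word t cs)) = (3 * length cs + t) * (2 * d - 4)"
proof -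
  have "sum_list (map (letter_net d) (block c)) = 3 * (2 * d - 4)" for c
    using assms by (auto simp: block_def letter_net_def)
  then have "sum_list (map (letter_net d) (concat (map block cs))) = length cs * (3 * (2 * d - 4))"
    by (induction cs) auto
  moreover have "sum_list (map (letter_net d) (replicate t False)) = t * (2 * d - 4)"
    by (simp add: letter_net_def sum_list_replicate)
  ultimately show ?thesis by (simp only: word_def map_append sum_list_append add_mult_distrib mult.commute mult.left_commute)
qed

text \<open>Since N k = (d + 1) + (k + 1)(2d - 4), there are k + 1 units of 2d - 4 vertices to add
  to the simplex, and every three of them leave a free binary choice.\<close>

lemma many_comb_types:
  assumes d: "DIM('a::euclidean_space) = d" "4 \<le> d"
  defines "N \<equiv> \<lambda>k. (3 * d - 3) + k * (2 * d - 4)"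
  shows "2 ^ ((k + 1) div 3) \<le> num_comb_types (simplicial_simple_polytopes d (N k) :: 'a set set) * (N k ^ (d - 1) * 4)"
proof -
  define q where "q = (k + 1) div 3"
  define t where "t = (k + 1) mod 3"
  let ?W = "word t ` {cs. length cs = q}"
  have dim: "4 \<le> DIM('a)" using d by simp
  obtain b0 :: 'a where b0: "b0 \<in> Basis" using nonempty_Basis by blast
  obtain bs :: "bool \<Rightarrow> 'a list" where bs: "\<And>ws. \<exists>P v w a H G. chained b0 (letter_size DIM('a)) bs ws P v w a H G \<and>
    card (verts P) = DIM('a) + 1 + sum_list (map (letter_net DIM('a)) ws)"
    using chains_exist[OF b0 dim] by metis
  have fin: "finite {cs :: bool list. length cs = q}" "card {cs :: bool list. length cs = q} = 2 ^ q"
    using finite_lists_length_eq[of "UNIV :: bool set" q] card_lists_length_eq[of "UNIV :: bool set" q]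
    by simp_all
  have "DIM('a) + 1 + sum_list (map (letter_net DIM('a)) ws) = N k" if "ws \<in> ?W" for ws
  proof -
    have "sum_list (map (letter_net d) ws) = (k + 1) * (2 * d - 4)"
      using that net_word[OF d(2)] by (auto simp: q_def t_def)
    moreover have "d + 1 + (2 * d - 4) = 3 * d - 3" using d by simp
    ultimately show ?thesis unfolding N_def d(1) by (simp only: add_mult_distrib mult_1)
  qed
  note net = this
  have "card ?W \<le> num_comb_types (simplicial_simple_polytopes DIM('a) (N k) :: 'a set set) * (N k ^ (DIM('a) - 1) * 4)"
  proof (intro comb_types_ge_words[OF b0 dim, of "letter_size DIM('a)"])
    show "inj (letter_size DIM('a))" by (rule injI) (simp add: letter_size_def split: if_splits)
    have "d < letter_size DIM('a) l" for l using d by (simp add: letter_size_def)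
    then show "DIM('a) \<notin> range (letter_size DIM('a))" using d(1) by (metis imageE less_irrefl)
    show "finite ?W" using fin(1) by simp
    show "\<exists>P v w a H G. chained b0 (letter_size DIM('a)) bs ws P v w a H G \<and> card (verts P) = N k" if "ws \<in> ?W" for ws
      using bs[of ws] net[OF that] by metis
  qed
  moreover have "card ?W = 2 ^ q" using card_image[OF inj_on_word] fin(2) by metis
  ultimately show ?thesis using d(1) by (simp add: q_def)
qed

lemma eventually_log_linear_le:
  fixes c1 c2 D c3 :: real assumes "0 < c2" 
  shows "eventually (\<lambda>k::nat. D * log 2 (c1 + c2 * real k) + c3 \<le> real k / 6) at_top"
  using assms by real_asymp

theorem theorem6p13:
  fixes d :: nat and N :: "nat \<Rightarrow> nat" and count :: "nat \<Rightarrow> nat"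
  defines "N \<equiv> \<lambda>k. (3 * d - 3) + k * (2 * d - 4)"
  defines "count \<equiv> \<lambda>k. num_comb_types (simplicial_simple_polytopes d (N k) :: 'a::euclidean_space set set)"
  assumes "d \<ge> 4" and "DIM('a) = d"
  shows "(\<lambda>k. log 2 (real (count k))) \<in> \<Omega>(\<lambda>k. real (N k)) \<and>
         (\<lambda>k. log 2 (real (count k))) \<in> \<Omega>(\<lambda>k. real k)"
proof -
  have N: "real (N k) = (3 * real d - 3) + (2 * real d - 4) * real k" for k
  proof -
    have "real (3 * d - 3) = 3 * real d - 3" "real (2 * d - 4) = 2 * real d - 4" using assms(3) by (simp_all add: of_nat_diff)
    then show ?thesis by (simp add: N_def mult.commute)
  qed
  \<comment> \<open>Logarithm of the counting bound: the 2 is log 4 from the pairs of facets, and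
    2/3 is the rounding loss of the division by 3.\<close>
  have lower: "real k / 3 - 2 / 3 - 2 - (real d - 1) * log 2 (real (N k)) \<le> log 2 (real (count k))" for k
  proof -
    have le: "2 ^ ((k + 1) div 3) \<le> count k * (N k ^ (d - 1) * 4)"
      unfolding count_def N_def by (rule many_comb_types[OF assms(4,3)])
    \<comment> \<open>The counting bound itself shows that the count is positive, so its logarithm
      is not a default value.\<close>
    have pos: "0 < count k" "0 < N k"
    proof -
      have "0 < count k * (N k ^ (d - 1) * 4)" using le by (rule less_le_trans[rotated]) simp
      then show "0 < count k" by simp
      show "0 < N k" using assms(3) by (simp add: N_def)
    qed
    have "real ((k + 1) div 3) = log 2 (2 ^ ((k + 1) div 3))" by simp
    also have "\<dots> \<le> log 2 (real (count k) * (real (N k) ^ (d - 1) * 4))"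
    proof -
      have "(2::real) ^ ((k + 1) div 3) \<le> real (count k * (N k ^ (d - 1) * 4))"
        using of_nat_mono[OF le, where 'a = real] by simp
      then show ?thesis using pos by (subst log_le_cancel_iff) simp_all
    qed
    also have "\<dots> = log 2 (real (count k)) + (real (d - 1) * log 2 (real (N k)) + log 2 4)"
      using pos by (simp add: log_mult log_nat_power)
    also have "log 2 4 = (2::real)" using log_pow_cancel[of 2 2] by simp
    finally have "real ((k + 1) div 3) \<le> log 2 (real (count k)) + ((real d - 1) * log 2 (real (N k)) + 2)"
      using assms(3) by (simp add: of_nat_diff)
    moreover have "real k / 3 - 2 / 3 \<le> real ((k + 1) div 3)"
    proof -
      have "k \<le> 3 * ((k + 1) div 3) + 2" by presburger
      then show ?thesis by linarith
    qed
    ultimately show ?thesis by linarith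
  qed
  \<comment> \<open>Half of k / 3 absorbs the logarithmic loss, which leaves the slope 1/6.\<close>
  have small: "eventually (\<lambda>k::nat. (real d - 1) * log 2 ((3 * real d - 3) + (2 * real d - 4) * real k) + (2 / 3 + 2) \<le> real k / 6) at_top"
    by (rule eventually_log_linear_le) (use assms(3) in simp)
  have big: "eventually (\<lambda>k. real k \<le> 6 * log 2 (real (count k))) at_top"
    using small
  proof eventually_elim
    case (elim k)
    then show ?case using lower[of k] unfolding N by linarith
  qed
  have k: "(\<lambda>k. log 2 (real (count k))) \<in> \<Omega>(\<lambda>k. real k)"
  proof (rule landau_omega.bigI[of "1 / 6"])
    show "eventually (\<lambda>k. 1 / 6 * norm (real k) \<le> norm (log 2 (real (count k)))) at_top"
      using big by eventually_elim simp
  qed simp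
  moreover have "(\<lambda>k. real k) \<in> \<Omega>(\<lambda>k. real (N k))"
  \<comment> \<open>For \<open>k \<ge> 1\<close> the constant part is at most 3dk and the linear
    part at most 2dk.\<close>
  proof (rule landau_omega.bigI[of "1 / (5 * real d)"])
    show "eventually (\<lambda>k. 1 / (5 * real d) * norm (real (N k)) \<le> norm (real k)) at_top"
      using eventually_ge_at_top[of 1]
    proof eventually_elim
      case (elim k)
      have "real d * 1 \<le> real d * real k" using elim by (intro mult_left_mono) auto
      moreover have "real (N k) = 3 * real d - 3 + 2 * (real d * real k) - 4 * real k"
        unfolding N by (simp add: algebra_simps)
      ultimately have "real (N k) \<le> 5 * (real d * real k)" by linarith
      then show ?case using assms(3) by (simp add: divide_le_eq mult_ac)
    qed
  qed (use assms(3) in simp)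
  ultimately show ?thesis using landau_omega.big_trans by blast
qed

end
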